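(* Let $d\in\{1,2,3\}$ and let $\alpha$ be a positive integer. Let $X,X_1,X_2,\dots$ be i.i.d. $\mathbb{Z}^d$-valued random variables which are genuinely $d$-dimensional, let $S_0=0$, $S_n=\sum_{j=1}^nX_j$, and let $L_n(\alpha)$ be its $\alpha$-fold self-intersection local time. If $$\liminf_{n\to\infty}\frac{\operatorname{Var}(L_n(\alpha))}{v_{d,\alpha}(n)}>0,$$ where $v_{1,\alpha}(n)=n^{1+\alpha}$, $v_{2,\alpha}(n)=n^2\log(n)^{2\alpha-4}$, $v_{3,\alpha}(n)=n\log n$, then $\mathbb{E}|X|^2<\infty$ and $\mathbb{E}X=0$.
   Context: The local time at $x\in\mathbb{Z}^d$ is $l(n,x)=\sum_{j=1}^n \mathbf{1}(S_j=x)$, and the $\alpha$-fold self-intersection local time is $L_n(\alpha)=\sum_{x\in\mathbb{Z}^d} l(n,x)^\alpha$. The i.i.d. increments are called genuinely $d$-dimensional if the support of $X_1-X_2$ linearly generates $\mathbb{R}^d$. *)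

theory Defs
  imports "HOL-Probability.Probability"
begin

definition walk :: "(nat \<Rightarrow> 'a \<Rightarrow> int ^ 'd) \<Rightarrow> nat \<Rightarrow> 'a \<Rightarrow> int ^ 'd" where
  "walk X n \<omega> = (\<Sum>j\<in>{1..n}. X j \<omega>)"

definition local_time :: "(nat \<Rightarrow> 'a \<Rightarrow> int ^ 'd) \<Rightarrow> nat \<Rightarrow> int ^ 'd \<Rightarrow> 'a \<Rightarrow> nat" where
  "local_time X n x \<omega> = card {j \<in> {1..n}. walk X j \<omega> = x}"

text \<open>alpha-fold self-intersection local time L_n(alpha) = sum_x l(n,x)^alpha;
  only the finitely many visited sites contribute (alpha \<ge> 1).\<close>
definition self_int_lt :: "(nat \<Rightarrow> 'a \<Rightarrow> int ^ 'd) \<Rightarrow> nat \<Rightarrow> nat \<Rightarrow> 'a \<Rightarrow> real" where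
  "self_int_lt X \<alpha> n \<omega> =
     (\<Sum>x\<in>(\<lambda>j. walk X j \<omega>) ` {1..n}. real (local_time X n x \<omega>) ^ \<alpha>)"

definition to_real_vec :: "int ^ 'd \<Rightarrow> real ^ 'd" where
  "to_real_vec z = (\<chi> i. real_of_int (z $ i))"

definition genuinely_d_dim :: "'a measure \<Rightarrow> (nat \<Rightarrow> 'a \<Rightarrow> int ^ 'd) \<Rightarrow> bool" where
  "genuinely_d_dim M X \<longleftrightarrow>
     span (to_real_vec ` {z. measure M {\<omega>\<in>space M. X 1 \<omega> - X 2 \<omega> = z} > 0}) = UNIV"

definition v_norm :: "nat \<Rightarrow> nat \<Rightarrow> nat \<Rightarrow> real" where
  "v_norm d \<alpha> n =
     (if d = 1 then real n ^ (1 + \<alpha>)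
      else if d = 2 then real n ^ 2 * ln (real n) powi (2 * int \<alpha> - 4)
      else real n * ln (real n))"

end

theory Submission
  imports Defs "HOL-Real_Asymp.Real_Asymp"
begin

text \<open>
  Suppose the conclusion fails. If \<open>E |X|^2 = \<infinity>\<close>, a Fourier bound on the concentration function
  and the divergence of the truncated second moments give \<open>P(S_m = 0) = o(m^(-d/2))\<close>; if \<open>E |X|^2 < \<infinity>\<close> but \<open>E X \<noteq> 0\<close>, the
  same follows from Chebyshev's inequality applied to the two halves of the path. In all cases
  \<open>sup_z P(S_m = z) \<le> q_m = O(m^(-d/2))\<close>.

  Writing \<open>l^\<alpha>\<close> in the binomial basis reduces the variance of \<open>L_n(\<alpha>)\<close> to covariances of the events
  that \<open>S\<close> is constant on \<open>J\<close> and that \<open>S\<close> is constant on \<open>J'\<close>, for \<open>k\<close>-element sets of times. Merge two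
  disjoint \<open>J\<close>, \<open>J'\<close> into one increasing sequence labelled by \<open>J\<close> and \<open>J'\<close>. With one change of label the
  events are independent. With two changes one set lies in a gap of the other, and the covariance
  contains a difference \<open>p(a + c) - p(a + b + c)\<close> of return probabilities, whose sum over \<open>a, c\<close>
  telescopes to at most \<open>\<Sum>m. min m b * p(m)\<close>. With at least three changes the displacement \<open>x\<close> between the two
  levels occurs in the pattern \<open>x, -x, x\<close>, and \<open>\<Sum>x. p_a(x) p_c(-x) p_b(x) \<le> q_b p(a + c)\<close>. Hence the
  contribution of disjoint sets carries the factor \<open>\<Sum>b m. q_b * min m b * p(m)\<close>, which is small relative to the
  normalisation because \<open>p(m) = o(m^(-d/2))\<close>; that of meeting sets is of lower order.
\<close>

section \<open>Time sets, gaps and alternating words\<close>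

text \<open>Two bounds run through the proof: q dominates every point probability, while only the
  return probability p is known to be small. With a drift this cannot be improved, since sup_z P(S_m
  = z) then has the exact order m^(-d/2), attained near m times the mean. Hence every covariance
  estimate must leave one factor p intact, and \<open>overlap_sum\<close> takes two functions. With
  two changes it cannot: without cancellation the sum over a, c is of order
  \<open>\<Sum>m. m * p m\<close>, too large in dimensions 2 and 3. Return probabilities need not be
  monotone in time (periodicity), so the difference has no sign and the domain of summation may not
  be enlarged before it telescopes. The three normalisations share the shape n * L^(2 alpha - 4) *
  Y, where L is the order of the partial sums of q and Y the order that \<open>overlap_sum\<close>
  would have if p were merely O(m^(-d/2)).\<close>

lemma sum_PiE_insert:
  assumes "x \<notin> A"
  shows "(\<Sum>g\<in>PiE (insert x A) B. F g) = (\<Sum>y\<in>B x. \<Sum>g\<in>PiE A B. F (g(x := y)))"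
proof -
  have "(\<Sum>g\<in>PiE (insert x A) B. F g) = (\<Sum>(y, g)\<in>B x \<times> PiE A B. F (g(x := y)))"
    unfolding PiE_insert_eq using inj_combinator[OF assms, of B]
    by (subst sum.reindex) (auto simp: case_prod_unfold)
  then show ?thesis
    by (simp add: sum.cartesian_product)
qed

definition gap_time :: "(nat \<Rightarrow> nat) \<Rightarrow> nat \<Rightarrow> nat" where
  "gap_time g i = (\<Sum>j\<le>i. g j)"

text \<open>Coordinate 0 is the first time itself, the other coordinates are the gaps between
  successive times. Keeping the values in {1..n} places all vectors in a finite box, over which sums
  of products factorise.\<close>

definition gap_vectors :: "nat \<Rightarrow> nat \<Rightarrow> (nat \<Rightarrow> nat) set" where
  "gap_vectors u n = {g \<in> PiE {..<u} (\<lambda>_. {1..n}). (\<Sum>j<u. g j) \<le> n}"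

lemma finite_gap_vectors [simp]: "finite (gap_vectors u n)"
  unfolding gap_vectors_def by (rule finite_subset[of _ "PiE {..<u} (\<lambda>_. {1..n})"]) (auto intro: finite_PiE)

lemma gap_time_less:
  assumes "g \<in> gap_vectors u n" "i < j" "j < u"
  shows "gap_time g i < gap_time g j"
proof -
  have "g j \<ge> 1"
    using assms by (force simp: gap_vectors_def PiE_def Pi_def)
  moreover have "(\<Sum>l\<le>i. g l) \<le> (\<Sum>l<j. g l)"
    using assms by (intro sum_mono2) auto
  moreover have "gap_time g j = (\<Sum>l<j. g l) + g j"
    unfolding gap_time_def by (simp add: lessThan_Suc_atMost[symmetric])
  ultimately show ?thesis
    unfolding gap_time_def by linarith
qed

lemma inj_on_gap_time: "g \<in> gap_vectors u n \<Longrightarrow> inj_on (gap_time g) {..<u}"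
  by (rule linorder_inj_onI) (use gap_time_less in \<open>force+\<close>)

lemma gap_time_range:
  assumes "g \<in> gap_vectors u n" "i < u"
  shows "gap_time g i \<in> {1..n}"
proof -
  have "1 \<le> g i"
    using assms by (force simp: gap_vectors_def PiE_def Pi_def)
  also have "g i \<le> gap_time g i"
    unfolding gap_time_def by (rule member_le_sum) auto
  finally have "1 \<le> gap_time g i" .
  moreover have "gap_time g i \<le> (\<Sum>j<u. g j)"
    unfolding gap_time_def using assms by (intro sum_mono2) auto
  ultimately show ?thesis
    using assms by (auto simp: gap_vectors_def)
qed

lemma gap_time_Suc: "gap_time g (Suc i) = gap_time g i + g (Suc i)"
  by (simp add: gap_time_def)

lemma sorted_list_of_gap_times:
  assumes "g \<in> gap_vectors u n"
  shows "sorted_list_of_set (gap_time g ` {..<u}) = map (gap_time g) [0..<u]"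
proof (rule sorted_distinct_set_unique)
  show "sorted (map (gap_time g) [0..<u])"
    using gap_time_less[OF assms] by (auto simp: sorted_iff_nth_mono_less less_imp_le)
  show "distinct (map (gap_time g) [0..<u])"
    using inj_on_gap_time[OF assms] by (simp add: distinct_map lessThan_atLeast0)
qed auto

lemma bij_betw_gap_vectors:
  "bij_betw (\<lambda>g. gap_time g ` {..<u}) (gap_vectors u n) {K. K \<subseteq> {1..n} \<and> card K = u}"
proof (rule bij_betw_imageI)
  show "inj_on (\<lambda>g. gap_time g ` {..<u}) (gap_vectors u n)"
  proof (rule inj_onI)
    fix g h assume g: "g \<in> gap_vectors u n" and h: "h \<in> gap_vectors u n"
      and "gap_time g ` {..<u} = gap_time h ` {..<u}"
    then have "map (gap_time g) [0..<u] = map (gap_time h) [0..<u]"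
      using sorted_list_of_gap_times by metis
    then have eq: "gap_time g i = gap_time h i" if "i < u" for i
      using that by simp
    show "g = h"
    proof (rule PiE_ext)
      show "g \<in> PiE {..<u} (\<lambda>_. {1..n})" "h \<in> PiE {..<u} (\<lambda>_. {1..n})"
        using g h by (auto simp: gap_vectors_def)
      show "g i = h i" if "i \<in> {..<u}" for i
        using eq[of i] eq[of "i - 1"] that
        by (cases i) (auto simp: gap_time_Suc, simp add: gap_time_def)
    qed
  qed
next
  show "(\<lambda>g. gap_time g ` {..<u}) ` gap_vectors u n = {K. K \<subseteq> {1..n} \<and> card K = u}"
  proof (intro subset_antisym subsetI)
    fix K assume "K \<in> (\<lambda>g. gap_time g ` {..<u}) ` gap_vectors u n"
    then show "K \<in> {K. K \<subseteq> {1..n} \<and> card K = u}"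
      using gap_time_range inj_on_gap_time by (fastforce simp: card_image)
  next
    fix K assume "K \<in> {K. K \<subseteq> {1..n} \<and> card K = u}"
    then have K: "K \<subseteq> {1..n}" "card K = u" "finite K"
      by (auto intro: finite_subset)
    define ts where "ts = sorted_list_of_set K"
    have ts: "length ts = u" "set ts = K" "sorted ts" "distinct ts"
      using K by (simp_all add: ts_def)
    \<comment> \<open>The inverse map: consecutive differences of the sorted list, with the first
      time itself at position 0.\<close>
    define g where "g = (\<lambda>i\<in>{..<u}. if i = 0 then ts ! 0 else ts ! i - ts ! (i - 1))"
    have less: "ts ! i < ts ! j" if "i < j" "j < u" for i j
      using sorted_wrt_nth_less[OF strict_sorted_list_of_set[of K]] ts(1) that by (simp add: ts_def)
    have tm: "gap_time g i = ts ! i" if "i < u" for i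
      using that
    proof (induction i)
      case 0
      then show ?case by (simp add: gap_time_def g_def)
    next
      case (Suc i)
      then show ?case using less[of i "Suc i"] by (simp add: gap_time_Suc g_def)
    qed
    have rng: "ts ! i \<in> {1..n}" if "i < u" for i
      using that ts K by (metis nth_mem subsetD)
    have "g \<in> gap_vectors u n"
    proof -
      have "g i \<in> {1..n}" if i: "i < u" for i
      proof (cases "i = 0")
        case True
        then show ?thesis using rng[OF i] i by (simp add: g_def)
      next
        case False
        then show ?thesis using less[of "i - 1" i] rng[OF i] i by (simp add: g_def) linarith
      qed
      moreover have "(\<Sum>j<u. g j) \<le> n"
      proof (cases u)
        case (Suc v)
        then show ?thesis
          using tm[of v] rng[of v] by (simp add: gap_time_def lessThan_Suc_atMost)
      qed auto
      ultimately show ?thesis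
        by (auto simp: gap_vectors_def g_def)
    qed
    moreover have "gap_time g ` {..<u} = K"
      using tm ts by (auto simp: set_conv_nth image_def)
    ultimately show "K \<in> (\<lambda>g. gap_time g ` {..<u}) ` gap_vectors u n"
      by blast
  qed
qed

lemma sum_subsets_gap_vectors:
  "(\<Sum>K | K \<subseteq> {1..n} \<and> card K = u. F K) = (\<Sum>g\<in>gap_vectors u n. F (gap_time g ` {..<u}))"
  by (rule sum.reindex_bij_betw[OF bij_betw_gap_vectors, symmetric])

text \<open>A disjoint pair is its union, coded by gaps, together with the set W of positions that
  the first set occupies in the union. W is a word in two labels and ranges over a family
  independent of n, so the pattern can be fixed before the gaps are summed.\<close>

lemma sum_disjoint_pairs_gap_vectors:
  fixes F :: "nat set \<Rightarrow> nat set \<Rightarrow> real"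
  shows "(\<Sum>(J, J') | J \<subseteq> {1..n} \<and> card J = k \<and> J' \<subseteq> {1..n} \<and> card J' = k \<and> J \<inter> J' = {}. F J J')
    = (\<Sum>W | W \<subseteq> {..<2*k} \<and> card W = k. \<Sum>g\<in>gap_vectors (2*k) n.
         F (gap_time g ` W) (gap_time g ` ({..<2*k} - W)))"
proof -
  let ?P = "{(J, J'). J \<subseteq> {1..n} \<and> card J = k \<and> J' \<subseteq> {1..n} \<and> card J' = k \<and> J \<inter> J' = {}}"
  let ?K = "{K. K \<subseteq> {1..n} \<and> card K = 2 * k}"
  have fin: "finite J" if "J \<subseteq> {1..n}" for J
    using that finite_subset by blast
  have finK: "finite ?K"
    by (rule finite_subset[of _ "Pow {1..n}"]) auto
  have "(\<Sum>(J, J')\<in>?P. F J J') = (\<Sum>(K, J)\<in>Sigma ?K (\<lambda>K. {J. J \<subseteq> K \<and> card J = k}). F J (K - J))"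
  proof (rule sum.reindex_bij_witness[where i="\<lambda>(K, J). (J, K - J)" and j="\<lambda>(J, J'). (J \<union> J', J)"])
    fix a assume "a \<in> ?P"
    then show "(case (case a of (J, J') \<Rightarrow> (J \<union> J', J)) of (K, J) \<Rightarrow> (J, K - J)) = a"
      by auto
    show "(case a of (J, J') \<Rightarrow> (J \<union> J', J)) \<in> Sigma ?K (\<lambda>K. {J. J \<subseteq> K \<and> card J = k})"
      using \<open>a \<in> ?P\<close> by (auto simp: card_Un_disjoint fin)
    show "(case (case a of (J, J') \<Rightarrow> (J \<union> J', J)) of (K, J) \<Rightarrow> F J (K - J)) = (case a of (J, J') \<Rightarrow> F J J')"
      using \<open>a \<in> ?P\<close> by (auto intro!: arg_cong[where f="F _"])
  next
    fix b assume b: "b \<in> Sigma ?K (\<lambda>K. {J. J \<subseteq> K \<and> card J = k})"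
    then show "(case (case b of (K, J) \<Rightarrow> (J, K - J)) of (J, J') \<Rightarrow> (J \<union> J', J)) = b"
      by auto
    show "(case b of (K, J) \<Rightarrow> (J, K - J)) \<in> ?P"
      using b by (auto simp: card_Diff_subset fin finite_subset[OF _ fin])
  qed
  also have "\<dots> = (\<Sum>K\<in>?K. \<Sum>J | J \<subseteq> K \<and> card J = k. F J (K - J))"
    using finK by (intro sum.Sigma[symmetric]) (auto dest!: fin intro: finite_subset[OF _ finite_Pow_iff[THEN iffD2]])
  also have "\<dots> = (\<Sum>g\<in>gap_vectors (2*k) n. \<Sum>J | J \<subseteq> gap_time g ` {..<2*k} \<and> card J = k. F J (gap_time g ` {..<2*k} - J))"
    by (rule sum_subsets_gap_vectors)
  also have "\<dots> = (\<Sum>g\<in>gap_vectors (2*k) n. \<Sum>W | W \<subseteq> {..<2*k} \<and> card W = k.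
         F (gap_time g ` W) (gap_time g ` ({..<2*k} - W)))"
  proof (rule sum.cong[OF refl])
    fix g assume "g \<in> gap_vectors (2*k) n"
    then have inj: "inj_on (gap_time g) {..<2*k}"
      by (rule inj_on_gap_time)
    have *: "gap_time g ` ({..<2*k} - W) = gap_time g ` {..<2*k} - gap_time g ` W" if "W \<subseteq> {..<2*k}" for W
      using inj_on_image_set_diff[OF inj, of "{..<2*k}" W] that by auto
    have "bij_betw (\<lambda>W. gap_time g ` W) {W. W \<subseteq> {..<2*k} \<and> card W = k} {J. J \<subseteq> gap_time g ` {..<2*k} \<and> card J = k}"
    proof (rule bij_betw_imageI)
      show "inj_on (\<lambda>W. gap_time g ` W) {W. W \<subseteq> {..<2*k} \<and> card W = k}"
        using inj_on_image_Pow[OF inj] by (rule inj_on_subset) auto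
      show "(\<lambda>W. gap_time g ` W) ` {W. W \<subseteq> {..<2*k} \<and> card W = k} = {J. J \<subseteq> gap_time g ` {..<2*k} \<and> card J = k}"
      proof (intro subset_antisym subsetI)
        fix J assume "J \<in> (\<lambda>W. gap_time g ` W) ` {W. W \<subseteq> {..<2*k} \<and> card W = k}"
        then obtain W where "W \<subseteq> {..<2*k}" "card W = k" "J = gap_time g ` W"
          by auto
        then show "J \<in> {J. J \<subseteq> gap_time g ` {..<2*k} \<and> card J = k}"
          using card_image[OF inj_on_subset[OF inj]] by (simp add: image_mono)
      next
        fix J assume "J \<in> {J. J \<subseteq> gap_time g ` {..<2*k} \<and> card J = k}"
        then obtain W where "W \<subseteq> {..<2*k}" "J = gap_time g ` W" "card J = k"
          by (auto simp: subset_image_iff)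
        moreover from this have "card W = k"
          using card_image[OF inj_on_subset[OF inj]] by metis
        ultimately show "J \<in> (\<lambda>W. gap_time g ` W) ` {W. W \<subseteq> {..<2*k} \<and> card W = k}"
          by simp
      qed
    qed
    then show "(\<Sum>J | J \<subseteq> gap_time g ` {..<2*k} \<and> card J = k. F J (gap_time g ` {..<2*k} - J))
      = (\<Sum>W | W \<subseteq> {..<2*k} \<and> card W = k. F (gap_time g ` W) (gap_time g ` ({..<2*k} - W)))"
      by (subst sum.reindex_bij_betw[symmetric], assumption) (intro sum.cong refl, simp add: *)
  qed
  also have "\<dots> = (\<Sum>W | W \<subseteq> {..<2*k} \<and> card W = k. \<Sum>g\<in>gap_vectors (2*k) n.
         F (gap_time g ` W) (gap_time g ` ({..<2*k} - W)))"
    by (rule sum.swap)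
  finally show ?thesis
    by simp
qed

section \<open>Powers in the binomial basis\<close>

lemma power_binomial_basis:
  assumes "\<alpha> > 0"
  shows "\<exists>c :: nat \<Rightarrow> real. \<forall>l. real l ^ \<alpha> = (\<Sum>k\<in>{1..\<alpha>}. c k * real (l choose k))"
  using assms
proof (induction \<alpha> rule: nat_induct_non_zero)
  case 1
  show ?case by (rule exI[of _ "\<lambda>_. 1"]) simp
next
  case (Suc \<alpha>)
  then obtain c :: "nat \<Rightarrow> real" where c: "\<And>l. real l ^ \<alpha> = (\<Sum>k\<in>{1..\<alpha>}. c k * real (l choose k))"
    by blast
  \<comment> \<open>This recurrence never produces \<open>l choose 0\<close>, so the expansion
    starts at k = 1. A term k = 0 would count the empty time set at every site.\<close>
  have id: "real l * real (l choose k) = real k * real (l choose k) + real (Suc k) * real (l choose Suc k)" for l k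
  proof (cases "k \<le> l")
    case True
    have "Suc k * (l choose Suc k) = (l - k) * (l choose k)"
      using binomial_absorb_comp[of l k] binomial_absorption[of k l] by simp
    then have "real (Suc k) * real (l choose Suc k) = (real l - real k) * real (l choose k)"
      using True by (metis of_nat_diff of_nat_mult)
    then show ?thesis by (simp add: algebra_simps)
  qed (simp add: binomial_eq_0)
  define c' where "c' k = (if k \<le> \<alpha> then c k * real k else 0) + (if 2 \<le> k then c (k - 1) * real k else 0)" for k
  have "real l ^ Suc \<alpha> = (\<Sum>k\<in>{1..Suc \<alpha>}. c' k * real (l choose k))" for l
  proof -
    have "real l ^ Suc \<alpha> = (\<Sum>k\<in>{1..\<alpha>}. c k * (real l * real (l choose k)))"
      by (simp add: c sum_distrib_left algebra_simps)
    also have "\<dots> = (\<Sum>k\<in>{1..\<alpha>}. c k * real k * real (l choose k)) + (\<Sum>k\<in>{1..\<alpha>}. c k * real (Suc k) * real (l choose Suc k))"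
      unfolding id by (simp add: algebra_simps sum.distrib)
    also have "(\<Sum>k\<in>{1..\<alpha>}. c k * real (Suc k) * real (l choose Suc k)) = (\<Sum>k\<in>{2..Suc \<alpha>}. c (k - 1) * real k * real (l choose k))"
      by (rule sum.reindex_bij_witness[of _ "\<lambda>k. k - 1" Suc]) auto
    also have "\<dots> = (\<Sum>k\<in>{1..Suc \<alpha>}. (if 2 \<le> k then c (k - 1) * real k else 0) * real (l choose k))"
      by (rule sum.mono_neutral_cong_left) auto
    also have "(\<Sum>k\<in>{1..\<alpha>}. c k * real k * real (l choose k)) = (\<Sum>k\<in>{1..Suc \<alpha>}. (if k \<le> \<alpha> then c k * real k else 0) * real (l choose k))"
      by (rule sum.mono_neutral_cong_left) auto
    finally show ?thesis
      by (simp only: c'_def distrib_right sum.distrib)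
  qed
  then show ?case by blast
qed

section \<open>Label changes of a word\<close>

definition alternations :: "nat \<Rightarrow> nat set \<Rightarrow> nat set" where
  "alternations u W = {i \<in> {1..<u}. (i \<in> W) \<noteq> (i - 1 \<in> W)}"

lemma no_alternation_between:
  assumes "i \<le> j" "j < u" "\<And>l. i < l \<Longrightarrow> l \<le> j \<Longrightarrow> l \<notin> alternations u W"
  shows "j \<in> W \<longleftrightarrow> i \<in> W"
  using assms
proof (induction j rule: dec_induct)
  case (step j)
  then have "Suc j \<notin> alternations u W" by auto
  then show ?case
    using step by (auto simp: alternations_def)
qed auto

text \<open>One or two changes determine the word up to exchanging the labels, hence the equations
  between unordered pairs. With more changes only the first three are recorded: at a and b the label
  switches in the same direction, at c in the opposite one, which fixes the signs of the
  displacements.\<close>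

lemma alternations_cases:
  assumes W: "W \<subseteq> {..<u}" "W \<noteq> {}" "W \<noteq> {..<u}"
  obtains (one) a where "0 < a" "a < u" "{W, {..<u} - W} = {{..<a}, {a..<u}}"
  | (two) a c where "0 < a" "a < c" "c < u" "{W, {..<u} - W} = {{a..<c}, {..<a} \<union> {c..<u}}"
  | (three) a c b where "a \<in> alternations u W" "c \<in> alternations u W" "b \<in> alternations u W"
      "a < c" "c < b" "c \<in> W \<longleftrightarrow> a \<notin> W" "b \<in> W \<longleftrightarrow> a \<in> W"
proof -
  let ?A = "alternations u W"
  have fin [simp]: "finite ?A"
    by (simp add: alternations_def)
  have ne: "?A \<noteq> {}"
  proof
    assume "?A = {}"
    then have "i \<in> W \<longleftrightarrow> 0 \<in> W" if "i < u" for i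
      using no_alternation_between[of 0 i u W] that by auto
    then show False
      using W by (cases "0 \<in> W") auto
  qed
  define a where "a = Min ?A"
  have a: "a \<in> ?A" "\<And>i. i \<in> ?A \<Longrightarrow> a \<le> i"
    using ne by (auto simp: a_def)
  have a_in: "0 < a" "a < u" "a \<in> W \<longleftrightarrow> a - 1 \<notin> W"
    using a(1) by (auto simp: alternations_def)
  have below_a: "i \<in> W \<longleftrightarrow> a \<notin> W" if "i < a" for i
    using no_alternation_between[of i "a - 1" u W] a(2) that a_in by fastforce
  show thesis
  proof (cases "?A - {a} = {}")
    case True
    then have "i \<in> W \<longleftrightarrow> a \<in> W" if "a \<le> i" "i < u" for i
      using no_alternation_between[of a i u W] that by auto
    then have "W = (if a \<in> W then {a..<u} else {..<a})"
    proof (intro set_eqI)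
      fix i
      show "i \<in> W \<longleftrightarrow> i \<in> (if a \<in> W then {a..<u} else {..<a})"
        using below_a[of i] \<open>\<And>i. a \<le> i \<Longrightarrow> i < u \<Longrightarrow> i \<in> W \<longleftrightarrow> a \<in> W\<close>[of i] W(1) a_in
        by (cases "i < u"; cases "i < a") auto
    qed
    moreover have "{..<u} - {a..<u} = {..<a}" "{..<u} - {..<a} = {a..<u}"
      using a_in by auto
    ultimately have "{W, {..<u} - W} = {{..<a}, {a..<u}}"
      by (metis insert_commute)
    then show thesis by (rule one[OF a_in(1,2)])
  next
    case False
    define c where "c = Min (?A - {a})"
    have c: "c \<in> ?A" "c \<noteq> a" "\<And>i. i \<in> ?A \<Longrightarrow> i \<noteq> a \<Longrightarrow> c \<le> i"
      using False Min_in[of "?A - {a}"] by (auto simp: c_def)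
    have ac: "a < c" "c < u"
      using c a(2)[of c] by (auto simp: alternations_def)
    have mid: "i \<in> W \<longleftrightarrow> a \<in> W" if "a \<le> i" "i < c" for i
      using no_alternation_between[of a i u W] c(3) that ac by fastforce
    have c_in: "c \<in> W \<longleftrightarrow> a \<notin> W"
      using mid[of "c - 1"] c(1) ac by (auto simp: alternations_def)
    show thesis
    proof (cases "?A - {a, c} = {}")
      case True
      then have "i \<in> W \<longleftrightarrow> a \<notin> W" if "c \<le> i" "i < u" for i
      proof -
        have "l \<notin> ?A" if "c < l" for l
          using True that ac by fastforce
        then show ?thesis
          using no_alternation_between[of c i u W] that c_in by simp
      qed
      then have "W = (if a \<in> W then {a..<c} else {..<a} \<union> {c..<u})"
      proof (intro set_eqI)
        fix i
        show "i \<in> W \<longleftrightarrow> i \<in> (if a \<in> W then {a..<c} else {..<a} \<union> {c..<u})"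
          using below_a[of i] mid[of i] \<open>\<And>i. c \<le> i \<Longrightarrow> i < u \<Longrightarrow> i \<in> W \<longleftrightarrow> a \<notin> W\<close>[of i] W(1) a_in ac
          by (cases "i < u"; cases "i < a"; cases "i < c") auto
      qed
      moreover have "{..<u} - {a..<c} = {..<a} \<union> {c..<u}" "{..<u} - ({..<a} \<union> {c..<u}) = {a..<c}"
        using a_in ac by auto
      ultimately have "{W, {..<u} - W} = {{a..<c}, {..<a} \<union> {c..<u}}"
        by (metis insert_commute)
      then show thesis by (rule two[OF a_in(1) ac])
    next
      case False
      define b where "b = Min (?A - {a, c})"
      have b: "b \<in> ?A" "b \<noteq> a" "b \<noteq> c" "\<And>i. i \<in> ?A \<Longrightarrow> i \<noteq> a \<Longrightarrow> i \<noteq> c \<Longrightarrow> b \<le> i"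
        using False Min_in[of "?A - {a, c}"] by (auto simp: b_def)
      have cb: "c < b" "b < u"
        using b c(3)[of b] by (auto simp: alternations_def)
      have "b - 1 \<in> W \<longleftrightarrow> c \<in> W"
        using no_alternation_between[of c "b - 1" u W] b(4) cb ac by fastforce
      then have "b \<in> W \<longleftrightarrow> a \<in> W"
        using b(1) c_in by (auto simp: alternations_def)
      then show thesis
        by (intro three[OF a(1) c(1) b(1) ac(1) cb(1) c_in])
    qed
  qed
qed

section \<open>Sums over gap vectors\<close>

lemma sum_PiE_prod_card:
  fixes f :: "nat \<Rightarrow> real"
  assumes "finite R"
  shows "(\<Sum>g\<in>PiE R (\<lambda>_. B). \<Prod>i\<in>R. f (g i)) = (\<Sum>m\<in>B. f m) ^ card R"
proof (cases "finite B")
  case True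
  then show ?thesis
    using prod_sum_PiE[OF assms, of "\<lambda>_. B" "\<lambda>_. f"] assms by simp
next
  \<comment> \<open>For infinite B the sums are 0 by convention on both sides, except that an empty
    R gives 1 on both.\<close>
  case False
  show ?thesis
  proof (cases "R = {}")
    case False
    then have "infinite (PiE R (\<lambda>_. B))"
      using \<open>infinite B\<close> assms by (auto simp: finite_PiE_iff PiE_eq_empty_iff)
    then show ?thesis
      using \<open>infinite B\<close> False assms by (simp add: card_gt_0_iff)
  qed simp
qed

text \<open>Here q stands for the uniform bound on point probabilities and r for the return
  probability. The inner sum reaches 2*n because its argument is a sum of two gaps, each at most
  n.\<close>

definition overlap_sum :: "(nat \<Rightarrow> real) \<Rightarrow> (nat \<Rightarrow> real) \<Rightarrow> nat \<Rightarrow> real" where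
  "overlap_sum q r n = (\<Sum>b=1..n. q b * (\<Sum>m=1..2*n. real (min m b) * r m))"

lemma overlap_sum_nonneg:
  assumes "\<And>m. 1 \<le> m \<Longrightarrow> 0 \<le> q m" "\<And>m. 0 \<le> r m"
  shows "0 \<le> overlap_sum q r n"
  unfolding overlap_sum_def using assms by (intro sum_nonneg mult_nonneg_nonneg) auto

text \<open>For a given total m the admissible a satisfy both a <= b and a <= m, so r m is counted
  at most min m b times.\<close>

lemma sum_shift_le_min_sum:
  fixes r :: "nat \<Rightarrow> real"
  assumes r: "\<And>m. 0 \<le> r m" and "b \<le> n"
  shows "(\<Sum>a=1..b. \<Sum>c=1..n. r (a + c)) \<le> (\<Sum>m=1..2*n. real (min m b) * r m)"
proof -
  have "(\<Sum>c=1..n. r (a + c)) \<le> (\<Sum>m=1..2*n. if a \<le> m then r m else 0)" if "a \<in> {1..b}" for a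
  proof -
    have "(\<Sum>c=1..n. r (a + c)) = (\<Sum>m=a+1..a+n. r m)"
      by (rule sum.reindex_bij_witness[of _ "\<lambda>m. m - a" "\<lambda>c. a + c"]) auto
    also have "\<dots> = (\<Sum>m=a+1..a+n. if a \<le> m then r m else 0)"
      by (rule sum.cong) auto
    also have "\<dots> \<le> (\<Sum>m=1..2*n. if a \<le> m then r m else 0)"
      using that assms by (intro sum_mono2) auto
    finally show ?thesis .
  qed
  then have "(\<Sum>a=1..b. \<Sum>c=1..n. r (a + c)) \<le> (\<Sum>a=1..b. \<Sum>m=1..2*n. if a \<le> m then r m else 0)"
    by (rule sum_mono)
  also have "\<dots> = (\<Sum>m=1..2*n. \<Sum>a=1..b. if a \<le> m then r m else 0)"
    by (rule sum.swap)
  also have "\<dots> = (\<Sum>m=1..2*n. real (min m b) * r m)"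
  proof (rule sum.cong[OF refl])
    fix m
    have "(\<Sum>a=1..b. if a \<le> m then r m else 0) = (\<Sum>a\<in>{1..b} \<inter> {a. a \<le> m}. r m)"
      by (subst sum.inter_restrict) simp_all
    also have "{1..b} \<inter> {a. a \<le> m} = {1..min m b}"
      by auto
    finally show "(\<Sum>a=1..b. if a \<le> m then r m else 0) = real (min m b) * r m"
      by simp
  qed
  finally show ?thesis .
qed

text \<open>The longer of the gaps a, b is charged to q, the shorter one goes with c into r. The gap
  inside r is then at most the one inside q, as \<open>sum_shift_le_min_sum\<close> requires; the
  two cases are mirror images, whence the factor 2.\<close>

lemma sum_min_le_overlap_sum:
  fixes q r :: "nat \<Rightarrow> real"
  assumes q: "\<And>m. 1 \<le> m \<Longrightarrow> 0 \<le> q m" and r: "\<And>m. 0 \<le> r m"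
  shows "(\<Sum>a=1..n. \<Sum>c=1..n. \<Sum>b=1..n. min (q b * r (a + c)) (q a * r (b + c))) \<le> 2 * overlap_sum q r n"
proof -
  let ?S = "\<Sum>a=1..n. \<Sum>c=1..n. \<Sum>b=1..n. if a \<le> b then q b * r (a + c) else 0"
  let ?S' = "\<Sum>a=1..n. \<Sum>c=1..n. \<Sum>b=1..n. if b \<le> a then q a * r (b + c) else 0"
  have "?S' = (\<Sum>c=1..n. \<Sum>a=1..n. \<Sum>b=1..n. if b \<le> a then q a * r (b + c) else 0)"
    by (rule sum.swap)
  also have "\<dots> = (\<Sum>c=1..n. \<Sum>b=1..n. \<Sum>a=1..n. if b \<le> a then q a * r (b + c) else 0)"
    by (rule sum.cong[OF refl], rule sum.swap)
  also have "\<dots> = ?S"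
    by (rule sum.swap)
  finally have S': "?S' = ?S" .
  have "?S = (\<Sum>c=1..n. \<Sum>a=1..n. \<Sum>b=1..n. if a \<le> b then q b * r (a + c) else 0)"
    by (rule sum.swap)
  also have "\<dots> = (\<Sum>c=1..n. \<Sum>b=1..n. \<Sum>a=1..n. if a \<le> b then q b * r (a + c) else 0)"
    by (rule sum.cong[OF refl], rule sum.swap)
  also have "\<dots> = (\<Sum>b=1..n. \<Sum>c=1..n. \<Sum>a=1..n. if a \<le> b then q b * r (a + c) else 0)"
    by (rule sum.swap)
  also have "\<dots> = (\<Sum>b=1..n. \<Sum>c=1..n. q b * (\<Sum>a=1..b. r (a + c)))"
  proof (intro sum.cong refl)
    fix b c assume "b \<in> {1..n}"
    have "(\<Sum>a=1..n. if a \<le> b then q b * r (a + c) else 0) = (\<Sum>a\<in>{1..n} \<inter> {a. a \<le> b}. q b * r (a + c))"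
      by (simp add: sum.inter_restrict)
    also have "{1..n} \<inter> {a. a \<le> b} = {1..b}"
      using \<open>b \<in> {1..n}\<close> by auto
    finally show "(\<Sum>a=1..n. if a \<le> b then q b * r (a + c) else 0) = q b * (\<Sum>a=1..b. r (a + c))"
      by (simp add: sum_distrib_left)
  qed
  also have "\<dots> = (\<Sum>b=1..n. q b * (\<Sum>a=1..b. \<Sum>c=1..n. r (a + c)))"
    by (subst sum.swap[of _ "{1..n}" "{1.._}"]) (simp add: sum_distrib_left)
  also have "\<dots> \<le> overlap_sum q r n"
    unfolding overlap_sum_def
    by (intro sum_mono mult_left_mono sum_shift_le_min_sum) (use q r in auto)
  finally have S: "?S \<le> overlap_sum q r n" .
  have "(\<Sum>a=1..n. \<Sum>c=1..n. \<Sum>b=1..n. min (q b * r (a + c)) (q a * r (b + c)))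
    \<le> (\<Sum>a=1..n. \<Sum>c=1..n. \<Sum>b=1..n. (if a \<le> b then q b * r (a + c) else 0) + (if b \<le> a then q a * r (b + c) else 0))"
    by (intro sum_mono) (use q r in \<open>auto simp: min_def\<close>)
  also have "\<dots> = ?S + ?S'"
    by (simp only: sum.distrib)
  finally show ?thesis
    using S S' by linarith
qed

text \<open>The weight m - 1 counts the ways to write m as an ordered sum of two positive
  integers.\<close>

lemma sum_pairs_by_total:
  fixes f :: "nat \<Rightarrow> real"
  assumes "N \<le> n"
  shows "(\<Sum>x=1..n. \<Sum>y=1..n. if x + y \<le> N then f (x + y) else 0) = (\<Sum>m=1..N. real (m - 1) * f m)"
proof -
  have "(\<Sum>x=1..n. \<Sum>y=1..n. if x + y \<le> N then f (x + y) else 0)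
      = (\<Sum>x=1..n. \<Sum>m=1..N. if x < m then f m else 0)"
  proof (rule sum.cong[OF refl])
    fix x assume "x \<in> {1..n}"
    have "(\<Sum>y=1..n. if x + y \<le> N then f (x + y) else 0) = (\<Sum>y\<in>{1..n} \<inter> {y. x + y \<le> N}. f (x + y))"
      by (simp add: sum.inter_restrict)
    also have "\<dots> = (\<Sum>m\<in>{1..N} \<inter> {m. x < m}. f m)"
      by (rule sum.reindex_bij_witness[of _ "\<lambda>m. m - x" "\<lambda>y. x + y"]) (use assms in auto)
    finally show "(\<Sum>y=1..n. if x + y \<le> N then f (x + y) else 0) = (\<Sum>m=1..N. if x < m then f m else 0)"
      by (simp add: sum.inter_restrict)
  qed
  also have "\<dots> = (\<Sum>m=1..N. \<Sum>x=1..n. if x < m then f m else 0)"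
    by (rule sum.swap)
  also have "\<dots> = (\<Sum>m=1..N. real (m - 1) * f m)"
  proof (rule sum.cong[OF refl])
    fix m assume m: "m \<in> {1..N}"
    have "(\<Sum>x=1..n. if x < m then f m else 0) = (\<Sum>x\<in>{1..n} \<inter> {x. x < m}. f m)"
      by (subst sum.inter_restrict) simp_all
    also have "{1..n} \<inter> {x. x < m} = {1..m - 1}"
      using m assms by auto
    finally show "(\<Sum>x=1..n. if x < m then f m else 0) = real (m - 1) * f m"
      by simp
  qed
  finally show ?thesis .
qed

text \<open>Summation by parts: after shifting by beta, the coefficient of r m is m - 1 minus the
  truncated difference m - 1 - beta, at most min m beta, while shifted terms beyond N only lower the
  sum. The constraint x + y + s <= n sees x and y only through x + y, so it survives as the cutoff N
  and the argument works for r that is not monotone.\<close>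

lemma telescoped_gap_sum:
  fixes r :: "nat \<Rightarrow> real"
  assumes r: "\<And>m. 0 \<le> r m" and "\<beta> \<le> s"
  shows "(\<Sum>x=1..n. \<Sum>y=1..n. if x + y + s \<le> n then r (x + y) - r (x + y + \<beta>) else 0)
     \<le> (\<Sum>m=1..n. real (min m \<beta>) * r m)"
proof (cases "s \<le> n")
  case False
  then have "(\<Sum>x=1..n. \<Sum>y=1..n. if x + y + s \<le> n then r (x + y) - r (x + y + \<beta>) else 0) = 0"
    by (intro sum.neutral ballI) auto
  then show ?thesis
    using r by (auto intro!: sum_nonneg)
next
  case True
  define N where "N = n - s"
  have N: "N \<le> n"
    by (simp add: N_def)
  have "(\<Sum>x=1..n. \<Sum>y=1..n. if x + y + s \<le> n then r (x + y) - r (x + y + \<beta>) else 0)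
      = (\<Sum>x=1..n. \<Sum>y=1..n. if x + y \<le> N then r (x + y) - r (x + y + \<beta>) else 0)"
    using True by (intro sum.cong refl if_cong) (auto simp: N_def)
  also have "\<dots> = (\<Sum>m=1..N. real (m - 1) * (r m - r (m + \<beta>)))"
    using sum_pairs_by_total[OF N, of "\<lambda>m. r m - r (m + \<beta>)"] by simp
  also have "\<dots> = (\<Sum>m=1..N. real (m - 1) * r m) - (\<Sum>m=1..N. real (m - 1) * r (m + \<beta>))"
    by (simp add: left_diff_distrib right_diff_distrib sum_subtractf)
  also have "(\<Sum>m=1..N. real (m - 1) * r (m + \<beta>)) = (\<Sum>m=\<beta>+1..N+\<beta>. real (m - 1 - \<beta>) * r m)"
    by (rule sum.reindex_bij_witness[of _ "\<lambda>m. m - \<beta>" "\<lambda>m. m + \<beta>"]) auto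
  also have "(\<Sum>m=1..N. real (m - 1) * r m) - (\<Sum>m=\<beta>+1..N+\<beta>. real (m - 1 - \<beta>) * r m)
    \<le> (\<Sum>m=1..N. real (m - 1) * r m) - (\<Sum>m=1..N. real (m - 1 - \<beta>) * r m)"
  proof -
    have "(\<Sum>m=1..N. real (m - 1 - \<beta>) * r m) = (\<Sum>m\<in>{1..N} \<inter> {\<beta>+1..}. real (m - 1 - \<beta>) * r m)"
      by (rule sum.mono_neutral_right) auto
    also have "\<dots> \<le> (\<Sum>m=\<beta>+1..N+\<beta>. real (m - 1 - \<beta>) * r m)"
      by (rule sum_mono2) (use r in auto)
    finally show ?thesis by linarith
  qed
  also have "\<dots> = (\<Sum>m=1..N. (real (m - 1) - real (m - 1 - \<beta>)) * r m)"
    by (simp add: left_diff_distrib right_diff_distrib sum_subtractf)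
  also have "\<dots> \<le> (\<Sum>m=1..N. real (min m \<beta>) * r m)"
  proof (intro sum_mono mult_right_mono r)
    fix m
    have "m - 1 \<le> (m - 1 - \<beta>) + min m \<beta>"
      by auto
    then show "real (m - 1) - real (m - 1 - \<beta>) \<le> real (min m \<beta>)"
      by linarith
  qed
  also have "\<dots> \<le> (\<Sum>m=1..n. real (min m \<beta>) * r m)"
    by (rule sum_mono2) (use r N in auto)
  finally show ?thesis .
qed

lemma min_sum_le:
  "finite A \<Longrightarrow> min m (\<Sum>l\<in>A. g l) \<le> (\<Sum>l\<in>A. min m (g l))" for m :: nat
  by (induction A rule: finite_induct) auto

lemma sum_gap_vectors_le_PiE:
  fixes F :: "(nat \<Rightarrow> nat) \<Rightarrow> real"
  assumes "\<And>g. g \<in> PiE {..<u} (\<lambda>_. {1..n}) \<Longrightarrow> 0 \<le> F g"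
  shows "(\<Sum>g\<in>gap_vectors u n. F g) \<le> (\<Sum>g\<in>PiE {..<u} (\<lambda>_. {1..n}). F g)"
  by (rule sum_mono2) (use assms in \<open>auto simp: gap_vectors_def intro: finite_PiE\<close>)

text \<open>The first time is free and yields the factor n; once the constraint on the total is
  dropped, the other u - 1 gaps are summed independently.\<close>

lemma sum_gap_vectors_prod:
  fixes q :: "nat \<Rightarrow> real"
  assumes q: "\<And>m. 1 \<le> m \<Longrightarrow> 0 \<le> q m" and "0 < u"
  shows "(\<Sum>g\<in>gap_vectors u n. \<Prod>i\<in>{1..<u}. q (g i)) \<le> real n * (\<Sum>m=1..n. q m) ^ (u - 1)"
proof -
  have "(\<Sum>g\<in>gap_vectors u n. \<Prod>i\<in>{1..<u}. q (g i)) \<le> (\<Sum>g\<in>PiE {..<u} (\<lambda>_. {1..n}). \<Prod>i\<in>{1..<u}. q (g i))"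
    by (intro sum_gap_vectors_le_PiE prod_nonneg) (use q in \<open>force simp: PiE_def Pi_def\<close>)
  also have "{..<u} = insert 0 {1..<u}"
    using \<open>0 < u\<close> by auto
  also have "(\<Sum>g\<in>PiE (insert 0 {1..<u}) (\<lambda>_. {1..n}). \<Prod>i\<in>{1..<u}. q (g i))
      = (\<Sum>y=1..n. \<Sum>g\<in>PiE {1..<u} (\<lambda>_. {1..n}). \<Prod>i\<in>{1..<u}. q (g i))"
    by (subst sum_PiE_insert) (auto intro!: sum.cong prod.cong)
  also have "\<dots> = real n * (\<Sum>m=1..n. q m) ^ (u - 1)"
    by (simp add: sum_PiE_prod_card)
  finally show ?thesis .
qed

text \<open>The summand is nonnegative, so the gap vectors may be enlarged to the full box. The
  first time gives n, the u - 4 gaps outside 0, a, b, c factor out, and the remaining triple sum is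
  \<open>sum_min_le_overlap_sum\<close>.\<close>

lemma sum_gap_vectors_interlaced:
  fixes q r :: "nat \<Rightarrow> real"
  assumes q: "\<And>m. 1 \<le> m \<Longrightarrow> 0 \<le> q m" and r: "\<And>m. 0 \<le> r m"
    and abc: "0 < a" "a < c" "c < b" "b < u"
  shows "(\<Sum>g\<in>gap_vectors u n. (\<Prod>i\<in>{1..<u} - {a, b, c}. q (g i))
            * min (q (g b) * r (g a + g c)) (q (g a) * r (g b + g c)))
    \<le> 2 * real n * (\<Sum>m=1..n. q m) ^ (u - 4) * overlap_sum q r n" (is "?L \<le> _")
proof -
  define R where "R = {1..<u} - {a, b, c}"
  define H where "H x y z = min (q z * r (x + y)) (q x * r (z + y))" for x y z
  have R: "finite R" "a \<notin> R" "b \<notin> R" "c \<notin> R" "0 \<notin> R" "card R = u - 4"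
    using abc by (auto simp: R_def card_Diff_subset)
  have "?L \<le> (\<Sum>g\<in>PiE {..<u} (\<lambda>_. {1..n}). (\<Prod>i\<in>R. q (g i)) * H (g a) (g c) (g b))"
    unfolding R_def[symmetric] H_def
  proof (intro sum_gap_vectors_le_PiE mult_nonneg_nonneg prod_nonneg ballI)
    fix g assume g: "g \<in> PiE {..<u} (\<lambda>_. {1..n})"
    have *: "0 \<le> q (g i)" if "i < u" for i
      using g that by (intro q) (force simp: PiE_def Pi_def)
    show "0 \<le> q (g i)" if "i \<in> R" for i
      using that by (intro *) (auto simp: R_def)
    show "0 \<le> min (q (g b) * r (g a + g c)) (q (g a) * r (g b + g c))"
      using *[of a] *[of b] r abc by auto
  qed
  also have "{..<u} = insert 0 (insert a (insert c (insert b R)))"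
    using abc by (auto simp: R_def)
  also have "(\<Sum>g\<in>PiE (insert 0 (insert a (insert c (insert b R)))) (\<lambda>_. {1..n}). (\<Prod>i\<in>R. q (g i)) * H (g a) (g c) (g b))
    = (\<Sum>t=1..n. \<Sum>x=1..n. \<Sum>y=1..n. \<Sum>z=1..n. \<Sum>g\<in>PiE R (\<lambda>_. {1..n}). (\<Prod>i\<in>R. q (g i)) * H x y z)"
  proof -
    have *: "(\<Prod>i\<in>R. q ((g(b := z, c := y, a := x, 0 := t)) i)) = (\<Prod>i\<in>R. q (g i))" for g x y z t
      using R by (intro prod.cong) auto
    show ?thesis
      using R abc by (simp add: sum_PiE_insert * del: fun_upd_apply) (simp add: *)
  qed
  also have "\<dots> = real n * (\<Sum>m=1..n. q m) ^ (u - 4) * (\<Sum>x=1..n. \<Sum>y=1..n. \<Sum>z=1..n. H x y z)"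
    by (simp add: sum_distrib_right[symmetric] sum_PiE_prod_card R) (simp add: sum_distrib_left)
  also have "\<dots> \<le> real n * (\<Sum>m=1..n. q m) ^ (u - 4) * (2 * overlap_sum q r n)"
    unfolding H_def using q r
    by (intro mult_left_mono sum_min_le_overlap_sum mult_nonneg_nonneg zero_le_power sum_nonneg) auto
  finally show ?thesis
    by (simp add: algebra_simps)
qed

text \<open>The difference of values of r has no sign, so the constraint on the total is kept as a
  condition until the sums over the gaps at a and c have telescoped. The shift there is the sum of
  the inner gaps; subadditivity of min m distributes it over single inner gaps l, and r (g l) then
  supplies the outer weight of \<open>overlap_sum\<close>. The factor u bounds the number of choices
  of l.\<close>

lemma sum_gap_vectors_nested:
  fixes q r :: "nat \<Rightarrow> real"
  assumes rq: "\<And>m. 1 \<le> m \<Longrightarrow> r m \<le> q m" and r: "\<And>m. 0 \<le> r m"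
    and ac: "0 < a" "a < c" "c < u"
  shows "(\<Sum>g\<in>gap_vectors u n. (\<Prod>i\<in>{1..<u} - {a, c}. r (g i)) * (r (g a + g c) - r (\<Sum>i=a..c. g i)))
    \<le> real u * real n * (\<Sum>m=1..n. q m) ^ (u - 4) * overlap_sum q r n" (is "?L \<le> _")
proof -
  define R where "R = {1..<u} - {a, c}"
  define I where "I = {a<..<c}"
  define D where "D b = (\<Sum>m=1..n. real (min m b) * r m)" for b
  let ?P = "\<lambda>R. PiE R (\<lambda>_. {1..n})"
  have R: "finite R" "a \<notin> R" "c \<notin> R" "0 \<notin> R" "card R = u - 3"
    using ac by (auto simp: R_def card_Diff_subset)
  have I: "finite I" "I \<subseteq> R" "card I \<le> u"
    using ac by (auto simp: R_def I_def)
  have D: "0 \<le> D b" for b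
    unfolding D_def using r by (auto intro!: sum_nonneg)
  have q: "0 \<le> q m" if "1 \<le> m" for m
    using rq[OF that] r[of m] by linarith
  have iac: "(\<Sum>i=a..c. g i) = g a + g c + sum g I" for g :: "nat \<Rightarrow> nat"
  proof -
    have "{a..c} = insert a (insert c I)"
      using ac by (auto simp: I_def)
    then show ?thesis
      using ac by (simp add: I_def)
  qed
  have U: "{..<u} = insert a (insert c (insert 0 R))"
    using ac by (auto simp: R_def)
  have "?L = (\<Sum>g\<in>?P {..<u}. if (\<Sum>j<u. g j) \<le> n then (\<Prod>i\<in>R. r (g i)) * (r (g a + g c) - r (g a + g c + sum g I)) else 0)"
    unfolding gap_vectors_def iac R_def by (subst sum.inter_filter) (auto intro: finite_PiE)
  also have "\<dots> = (\<Sum>x=1..n. \<Sum>y=1..n. \<Sum>g\<in>?P (insert 0 R). if x + y + sum g (insert 0 R) \<le> n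
        then (\<Prod>i\<in>R. r (g i)) * (r (x + y) - r (x + y + sum g I)) else 0)"
  proof -
    have *: "(\<Prod>i\<in>R. r ((g(c := y, a := x)) i)) = (\<Prod>i\<in>R. r (g i))"
      "sum (g(c := y, a := x)) I = sum g I"
      "sum (g(c := y, a := x)) (insert a (insert c (insert 0 R))) = x + y + sum g (insert 0 R)" for g x y
    proof -
      show "(\<Prod>i\<in>R. r ((g(c := y, a := x)) i)) = (\<Prod>i\<in>R. r (g i))"
        using R by (intro prod.cong) auto
      show "sum (g(c := y, a := x)) I = sum g I"
        using R I by (intro sum.cong) auto
      have "sum (g(c := y, a := x)) (insert 0 R) = sum g (insert 0 R)"
        using R ac by (intro sum.cong) auto
      then show "sum (g(c := y, a := x)) (insert a (insert c (insert 0 R))) = x + y + sum g (insert 0 R)"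
        using R ac by simp
    qed
    have upd: "(g(c := y, a := x)) a = x" "(g(c := y, a := x)) c = y" for g :: "nat \<Rightarrow> nat" and x y
      using ac by auto
    have "(\<Sum>g\<in>?P (insert a (insert c (insert 0 R))). if sum g (insert a (insert c (insert 0 R))) \<le> n
        then (\<Prod>i\<in>R. r (g i)) * (r (g a + g c) - r (g a + g c + sum g I)) else 0)
      = (\<Sum>x=1..n. \<Sum>y=1..n. \<Sum>g\<in>?P (insert 0 R). (\<lambda>g. if sum g (insert a (insert c (insert 0 R))) \<le> n
        then (\<Prod>i\<in>R. r (g i)) * (r (g a + g c) - r (g a + g c + sum g I)) else 0) (g(c := y, a := x)))"
      using R ac by (subst sum_PiE_insert, simp, subst sum_PiE_insert, simp_all)
    then show ?thesis
      by (simp only: U * upd)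
  qed
  also have "\<dots> = (\<Sum>x=1..n. \<Sum>g\<in>?P (insert 0 R). \<Sum>y=1..n. if x + y + sum g (insert 0 R) \<le> n
        then (\<Prod>i\<in>R. r (g i)) * (r (x + y) - r (x + y + sum g I)) else 0)"
    by (rule sum.cong[OF refl], rule sum.swap)
  also have "\<dots> = (\<Sum>g\<in>?P (insert 0 R). \<Sum>x=1..n. \<Sum>y=1..n. if x + y + sum g (insert 0 R) \<le> n
        then (\<Prod>i\<in>R. r (g i)) * (r (x + y) - r (x + y + sum g I)) else 0)"
    by (rule sum.swap)
  also have "\<dots> = (\<Sum>g\<in>?P (insert 0 R). (\<Prod>i\<in>R. r (g i)) * (\<Sum>x=1..n. \<Sum>y=1..n. if x + y + sum g (insert 0 R) \<le> n
        then r (x + y) - r (x + y + sum g I) else 0))"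
    by (simp add: sum_distrib_left if_distrib[of "\<lambda>x. _ * x"] cong: if_cong)
  also have "\<dots> \<le> (\<Sum>g\<in>?P (insert 0 R). (\<Prod>i\<in>R. r (g i)) * (\<Sum>l\<in>I. D (g l)))"
  proof (intro sum_mono mult_left_mono prod_nonneg ballI r)
    fix g
    have "(\<Sum>x=1..n. \<Sum>y=1..n. if x + y + sum g (insert 0 R) \<le> n
        then r (x + y) - r (x + y + sum g I) else 0) \<le> D (sum g I)"
      unfolding D_def by (rule telescoped_gap_sum[OF r], rule sum_mono2) (use R I in auto)
    also have "\<dots> \<le> (\<Sum>m=1..n. (\<Sum>l\<in>I. real (min m (g l))) * r m)"
      unfolding D_def of_nat_sum[symmetric]
      by (intro sum_mono mult_right_mono r of_nat_mono min_sum_le I)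
    also have "\<dots> = (\<Sum>l\<in>I. D (g l))"
      unfolding D_def sum_distrib_right by (rule sum.swap)
    finally show "(\<Sum>x=1..n. \<Sum>y=1..n. if x + y + sum g (insert 0 R) \<le> n
        then r (x + y) - r (x + y + sum g I) else 0) \<le> (\<Sum>l\<in>I. D (g l))" .
  qed
  also have "\<dots> = (\<Sum>t=1..n. \<Sum>g\<in>?P R. (\<Prod>i\<in>R. r (g i)) * (\<Sum>l\<in>I. D (g l)))"
  proof -
    have *: "(\<Prod>i\<in>R. r ((g(0 := t)) i)) = (\<Prod>i\<in>R. r (g i))" "(\<Sum>l\<in>I. D ((g(0 := t)) l)) = (\<Sum>l\<in>I. D (g l))" for g t
      using R I by (auto intro!: prod.cong sum.cong)
    show ?thesis
      using R by (subst sum_PiE_insert) (simp_all only: *, simp)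
  qed
  also have "\<dots> = real n * (\<Sum>l\<in>I. \<Sum>g\<in>?P R. \<Prod>i\<in>R. r (g i) * (if i = l then D (g i) else 1))"
  proof -
    have "(\<Prod>i\<in>R. r (g i)) * D (g l) = (\<Prod>i\<in>R. r (g i) * (if i = l then D (g i) else 1))" if "l \<in> I" for g l
      using that I R by (auto simp: prod.distrib prod.delta)
    then have "(\<Sum>g\<in>?P R. (\<Prod>i\<in>R. r (g i)) * (\<Sum>l\<in>I. D (g l)))
        = (\<Sum>g\<in>?P R. \<Sum>l\<in>I. \<Prod>i\<in>R. r (g i) * (if i = l then D (g i) else 1))"
      unfolding sum_distrib_left by (intro sum.cong refl) auto
    also have "\<dots> = (\<Sum>l\<in>I. \<Sum>g\<in>?P R. \<Prod>i\<in>R. r (g i) * (if i = l then D (g i) else 1))"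
      by (rule sum.swap)
    finally show ?thesis by simp
  qed
  \<comment> \<open>Of the u - 3 gaps in R, the gap l is absorbed by \<open>overlap_sum\<close>;
    this leaves the exponent u - 4.\<close>
  also have "\<dots> \<le> real n * (\<Sum>l\<in>I. (\<Sum>m=1..n. q m) ^ (u - 4) * overlap_sum q r n)"
  proof (intro mult_left_mono sum_mono)
    fix l assume l: "l \<in> I"
    have "(\<Sum>g\<in>?P R. \<Prod>i\<in>R. r (g i) * (if i = l then D (g i) else 1))
        = (\<Prod>i\<in>R. \<Sum>m=1..n. r m * (if i = l then D m else 1))"
      using R by (intro prod_sum_PiE[symmetric]) auto
    also have "\<dots> = (\<Sum>m=1..n. r m * D m) * (\<Prod>i\<in>R - {l}. \<Sum>m=1..n. r m * (if i = l then D m else 1))"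
      using l I R by (subst prod.remove[of R l]) auto
    also have "(\<Prod>i\<in>R - {l}. \<Sum>m=1..n. r m * (if i = l then D m else 1)) = (\<Sum>m=1..n. r m) ^ (u - 4)"
      using l I R by (simp add: card_Diff_subset subset_iff)
    also have "(\<Sum>m=1..n. r m * D m) * (\<Sum>m=1..n. r m) ^ (u - 4) \<le> overlap_sum q r n * (\<Sum>m=1..n. q m) ^ (u - 4)"
    proof (intro mult_mono power_mono sum_mono overlap_sum_nonneg zero_le_power sum_nonneg)
      show "(\<Sum>m=1..n. r m * D m) \<le> overlap_sum q r n"
        unfolding overlap_sum_def
      proof (intro sum_mono mult_mono)
        show "D m \<le> (\<Sum>ma = 1..2 * n. real (min ma m) * r ma)" for m
          unfolding D_def by (rule sum_mono2) (use r in auto)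
      qed (use rq q D in auto)
    qed (use rq r q in auto)
    finally show "(\<Sum>g\<in>?P R. \<Prod>i\<in>R. r (g i) * (if i = l then D (g i) else 1))
      \<le> (\<Sum>m=1..n. q m) ^ (u - 4) * overlap_sum q r n"
      by (simp add: mult.commute)
  qed simp
  also have "\<dots> = real (card I) * (real n * (\<Sum>m=1..n. q m) ^ (u - 4) * overlap_sum q r n)"
    by simp
  also have "\<dots> \<le> real u * (real n * (\<Sum>m=1..n. q m) ^ (u - 4) * overlap_sum q r n)"
    using I q r by (intro mult_right_mono mult_nonneg_nonneg zero_le_power sum_nonneg overlap_sum_nonneg) auto
  finally show ?thesis
    by (simp add: algebra_simps)
qed

section \<open>Independence of block sums\<close>

text \<open>The walk uses X 1, X 2, and so on; X 0 serves as the reference copy of a single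
  step.\<close>

locale iid_walk = prob_space M for M :: "'a measure" +
  fixes X :: "nat \<Rightarrow> 'a \<Rightarrow> int ^ 'd"
  assumes X_measurable [measurable]: "\<And>i. X i \<in> measurable M (count_space UNIV)"
    and X_indep: "indep_vars (\<lambda>_. count_space UNIV) X UNIV"
    and X_distr: "\<And>i. distr M (count_space UNIV) (X i) = distr M (count_space UNIV) (X 0)"
begin

definition block_sum :: "nat set \<Rightarrow> 'a \<Rightarrow> int ^ 'd" where
  "block_sum B \<omega> = (\<Sum>j\<in>B. X j \<omega>)"

definition hit :: "nat \<Rightarrow> int ^ 'd \<Rightarrow> real" where
  "hit m z = prob {\<omega>\<in>space M. walk X m \<omega> = z}"

lemma block_sum_measurable [measurable]:
  "block_sum B \<in> measurable M (count_space UNIV)"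
proof (induction B rule: infinite_finite_induct)
  case (insert j B)
  have "(\<lambda>\<omega>. X j \<omega> + block_sum B \<omega>) \<in> measurable M (count_space UNIV)"
    by (rule measurable_compose_countable[where g="block_sum B" and f="\<lambda>b \<omega>. X j \<omega> + b"])
      (use insert.IH in auto)
  thus ?case
    using insert by (simp add: block_sum_def[abs_def])
qed (simp_all add: block_sum_def[abs_def])

lemma walk_eq_block_sum: "walk X n = block_sum {1..n}"
  by (simp add: walk_def block_sum_def fun_eq_iff)

lemma walk_measurable [measurable]: "walk X n \<in> measurable M (count_space UNIV)"
  by (simp add: walk_eq_block_sum)

text \<open>Disjoint blocks read disjoint groups of independent steps. Finiteness of a block makes
  its product sigma-algebra discrete, so that summation over it is measurable.\<close>

lemma indep_vars_block_sum:
  assumes "\<And>l. l \<in> L \<Longrightarrow> finite (B l)" "disjoint_family_on B L"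
  shows "indep_vars (\<lambda>_. count_space UNIV) (\<lambda>l. block_sum (B l)) L"
proof -
  have "indep_vars (\<lambda>l. PiM (B l) (\<lambda>_. count_space UNIV))
          (\<lambda>l \<omega>. restrict (\<lambda>i. X i \<omega>) (B l)) L"
    by (rule indep_vars_restrict[OF X_indep _ assms(2)]) auto
  then have "indep_vars (\<lambda>_. count_space UNIV)
      (\<lambda>l \<omega>. (\<lambda>f. \<Sum>j\<in>B l. f j) (restrict (\<lambda>i. X i \<omega>) (B l))) L"
  proof (rule indep_vars_compose2)
    fix l assume "l \<in> L"
    have "PiM (B l) (\<lambda>_. count_space (UNIV :: (int ^ 'd) set)) = count_space (PiE (B l) (\<lambda>_. UNIV))"
      using assms(1)[OF \<open>l \<in> L\<close>] by (intro count_space_PiM_finite) auto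
    then show "(\<lambda>f. \<Sum>j\<in>B l. f j) \<in> measurable (PiM (B l) (\<lambda>_. count_space (UNIV :: (int ^ 'd) set))) (count_space UNIV)"
      by simp
  qed
  then show ?thesis
    by (simp add: block_sum_def[abs_def])
qed

lemma prob_blocks_prod:
  assumes "finite L" "\<And>l. l \<in> L \<Longrightarrow> finite (B l)" "disjoint_family_on B L"
  shows "prob {\<omega>\<in>space M. \<forall>l\<in>L. block_sum (B l) \<omega> \<in> A l}
       = (\<Prod>l\<in>L. prob {\<omega>\<in>space M. block_sum (B l) \<omega> \<in> A l})"
proof (cases "L = {}")
  case True
  then show ?thesis by (simp add: prob_space)
next
  case False
  have "prob (\<Inter>l\<in>L. block_sum (B l) -` A l \<inter> space M)
      = (\<Prod>l\<in>L. prob (block_sum (B l) -` A l \<inter> space M))"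
    by (rule indep_varsD_finite[OF indep_vars_block_sum[OF assms(2,3)]]) (use False assms(1) in auto)
  also have "(\<Inter>l\<in>L. block_sum (B l) -` A l \<inter> space M) = {\<omega>\<in>space M. \<forall>l\<in>L. block_sum (B l) \<omega> \<in> A l}"
    using False by auto
  finally show ?thesis
    by (simp add: vimage_def Int_def conj_commute)
qed

lemma prob_two_blocks:
  assumes "finite B" "finite C" "B \<inter> C = {}"
  shows "prob {\<omega>\<in>space M. block_sum B \<omega> \<in> A \<and> block_sum C \<omega> \<in> A'}
       = prob {\<omega>\<in>space M. block_sum B \<omega> \<in> A} * prob {\<omega>\<in>space M. block_sum C \<omega> \<in> A'}"
proof -
  have "prob {\<omega>\<in>space M. \<forall>l\<in>{0, 1}. block_sum (if l = (0::nat) then B else C) \<omega> \<in> (if l = 0 then A else A')}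
       = (\<Prod>l\<in>{0, 1}. prob {\<omega>\<in>space M. block_sum (if l = (0::nat) then B else C) \<omega> \<in> (if l = 0 then A else A')})"
    by (rule prob_blocks_prod) (use assms in \<open>auto simp: disjoint_family_on_def\<close>)
  then show ?thesis
    by simp
qed

text \<open>The convolution formula, by splitting over the value of the first block sum. The
  integral against counting measure avoids summability conditions on the lattice; the constraint A
  is what the drift argument later exploits.\<close>

lemma emeasure_two_blocks_eq:
  assumes "finite B" "finite C" "B \<inter> C = {}"
  shows "emeasure M {\<omega>\<in>space M. block_sum (B \<union> C) \<omega> = z \<and> block_sum B \<omega> \<in> A}
       = (\<integral>\<^sup>+x. ennreal (prob {\<omega>\<in>space M. block_sum B \<omega> = x} * prob {\<omega>\<in>space M. block_sum C \<omega> = z - x})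
            * indicator A x \<partial>count_space UNIV)"
proof -
  have *: "block_sum (B \<union> C) \<omega> = block_sum B \<omega> + block_sum C \<omega>" for \<omega>
    unfolding block_sum_def using assms by (simp add: sum.union_disjoint)
  have "{\<omega>\<in>space M. block_sum (B \<union> C) \<omega> = z \<and> block_sum B \<omega> \<in> A}
      = (\<Union>x\<in>UNIV. {\<omega>\<in>space M. block_sum B \<omega> \<in> {x} \<inter> A \<and> block_sum C \<omega> \<in> {z - x}})"
    by (auto simp: * algebra_simps)
  also have "emeasure M \<dots> = (\<integral>\<^sup>+x. emeasure M {\<omega>\<in>space M. block_sum B \<omega> \<in> {x} \<inter> A \<and> block_sum C \<omega> \<in> {z - x}} \<partial>count_space UNIV)"
    by (rule emeasure_UN_countable) (auto simp: disjoint_family_on_def)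
  also have "\<dots> = (\<integral>\<^sup>+x. ennreal (prob {\<omega>\<in>space M. block_sum B \<omega> = x} * prob {\<omega>\<in>space M. block_sum C \<omega> = z - x})
            * indicator A x \<partial>count_space UNIV)"
    unfolding emeasure_eq_measure prob_two_blocks[OF assms]
  proof (intro nn_integral_cong)
    fix x
    show "ennreal (prob {\<omega>\<in>space M. block_sum B \<omega> \<in> {x} \<inter> A} * prob {\<omega>\<in>space M. block_sum C \<omega> \<in> {z - x}})
      = ennreal (prob {\<omega>\<in>space M. block_sum B \<omega> = x} * prob {\<omega>\<in>space M. block_sum C \<omega> = z - x}) * indicator A x"
    proof (cases "x \<in> A")
      case True
      then have "{x} \<inter> A = {x}" by auto
      then show ?thesis using True by simp
    next
      case False
      then have "{x} \<inter> A = {}" by auto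
      then show ?thesis using False by simp
    qed
  qed
  finally show ?thesis .
qed

text \<open>Peeling one index off each set and convolving reduces the claim to single steps, which
  share one law.\<close>

lemma prob_block_sum_card:
  assumes "finite B" "finite C" "card B = card C"
  shows "prob {\<omega>\<in>space M. block_sum B \<omega> = z} = prob {\<omega>\<in>space M. block_sum C \<omega> = z}"
  using assms
proof (induction B arbitrary: C z rule: finite_induct)
  case empty
  then show ?case by simp
next
  case (insert b B)
  then obtain c C' where C: "C = insert c C'" "c \<notin> C'" "finite C'" "card C' = card B"
    by (metis card_Suc_eq card_insert_disjoint finite_insert)
  have single: "prob {\<omega>\<in>space M. block_sum {i} \<omega> = x} = prob {\<omega>\<in>space M. X 0 \<omega> = x}" for i x
  proof -
    have "measure (distr M (count_space UNIV) (X i)) {x} = measure (distr M (count_space UNIV) (X 0)) {x}"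
      by (simp only: X_distr[of i])
    then show ?thesis
      by (simp add: measure_distr block_sum_def vimage_def Int_def conj_commute)
  qed
  have "emeasure M {\<omega>\<in>space M. block_sum ({b} \<union> B) \<omega> = z} = emeasure M {\<omega>\<in>space M. block_sum ({c} \<union> C') \<omega> = z}"
    using emeasure_two_blocks_eq[of "{b}" B z UNIV] emeasure_two_blocks_eq[of "{c}" C' z UNIV]
      insert.IH[OF C(3) C(4)[symmetric]] insert.hyps C by (simp add: single)
  then show ?case
    by (simp add: C emeasure_eq_measure)
qed

lemma prob_block_sum:
  assumes "finite B"
  shows "prob {\<omega>\<in>space M. block_sum B \<omega> = z} = hit (card B) z"
  unfolding hit_def walk_eq_block_sum by (rule prob_block_sum_card) (use assms in auto)

lemma prob_blocks_hit:
  assumes "finite L" "\<And>l. l \<in> L \<Longrightarrow> finite (B l)" "disjoint_family_on B L"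
  shows "prob {\<omega>\<in>space M. \<forall>l\<in>L. block_sum (B l) \<omega> = z l} = (\<Prod>l\<in>L. hit (card (B l)) (z l))"
  using prob_blocks_prod[OF assms, where A="\<lambda>l. {z l}"] assms by (simp add: prob_block_sum)

lemma hit_nonneg [simp]: "0 \<le> hit m z"
  by (simp add: hit_def)

lemma hit_convolution_zero:
  "(\<integral>\<^sup>+x. ennreal (hit a x * hit c (- x)) \<partial>count_space UNIV) = ennreal (hit (a + c) 0)"
proof -
  have "ennreal (hit (a + c) 0) = emeasure M {\<omega>\<in>space M. block_sum ({1..a} \<union> {a+1..a+c}) \<omega> = 0 \<and> block_sum {1..a} \<omega> \<in> UNIV}"
    by (subst iso_tuple_UNIV_I, simp only: simp_thms emeasure_eq_measure)
      (subst prob_block_sum, auto simp: ivl_disj_un card_Un_disjoint)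
  also have "\<dots> = (\<integral>\<^sup>+x. ennreal (hit a x * hit c (- x)) \<partial>count_space UNIV)"
    by (subst emeasure_two_blocks_eq) (auto simp: prob_block_sum)
  finally show ?thesis ..
qed

end

section \<open>Covariances of level events\<close>

context iid_walk
begin

definition level_event :: "nat set \<Rightarrow> 'a set" where
  "level_event J = {\<omega>\<in>space M. \<forall>i\<in>J. \<forall>j\<in>J. walk X i \<omega> = walk X j \<omega>}"

lemma level_event_sets [measurable]: "finite J \<Longrightarrow> level_event J \<in> sets M"
  unfolding level_event_def by measurable

lemma level_eventI:
  "\<omega> \<in> space M \<Longrightarrow> (\<And>i. i \<in> J \<Longrightarrow> walk X i \<omega> = v) \<Longrightarrow> \<omega> \<in> level_event J"
  by (simp add: level_event_def)

lemma level_event_Un: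
  "i \<in> J \<Longrightarrow> i \<in> J' \<Longrightarrow> level_event J \<inter> level_event J' \<subseteq> level_event (J \<union> J')"
proof
  fix \<omega> assume i: "i \<in> J" "i \<in> J'" and \<omega>: "\<omega> \<in> level_event J \<inter> level_event J'"
  have "walk X j \<omega> = walk X i \<omega>" if "j \<in> J \<union> J'" for j
    using \<omega> i that unfolding level_event_def by blast
  moreover have "\<omega> \<in> space M"
    using \<omega> by (simp add: level_event_def)
  ultimately show "\<omega> \<in> level_event (J \<union> J')"
    by (rule level_eventI[rotated])
qed

text \<open>The steps between two consecutive times. Truncated subtraction makes
  \<open>gap_block g 0\<close> empty: steps up to the first time belong to no block, since level
  events depend only on differences of the walk. Hence the conditions excluding index 0
  below.\<close>

definition gap_block :: "(nat \<Rightarrow> nat) \<Rightarrow> nat \<Rightarrow> nat set" where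
  "gap_block g i = {gap_time g (i - 1)<..gap_time g i}"

lemma finite_gap_block [simp]: "finite (gap_block g i)"
  by (simp add: gap_block_def)

lemma card_gap_block [simp]: "0 < i \<Longrightarrow> card (gap_block g i) = g i"
  by (cases i) (simp_all add: gap_block_def gap_time_Suc)

lemma gap_time_mono: "i \<le> j \<Longrightarrow> gap_time g i \<le> gap_time g j"
  unfolding gap_time_def by (intro sum_mono2) auto

lemma gap_time_le_pred: "i < j \<Longrightarrow> gap_time g i \<le> gap_time g (j - 1)"
  by (rule gap_time_mono) simp

lemma disjoint_gap_block:
  assumes "0 < i" "i < j"
  shows "gap_block g i \<inter> gap_block g j = {}"
  using gap_time_le_pred[OF assms(2), of g] by (auto simp: gap_block_def)

lemma disjoint_family_gap_block: "0 \<notin> L \<Longrightarrow> disjoint_family_on (gap_block g) L"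
  unfolding disjoint_family_on_def
  by (metis disjoint_gap_block gr0I inf_commute linorder_neqE_nat)

lemma block_sum_walk:
  assumes "i \<le> j"
  shows "block_sum {i<..j} \<omega> = walk X j \<omega> - walk X i \<omega>"
proof -
  have "{1..j} = {1..i} \<union> {i<..j}"
    using assms by auto
  then have "walk X j \<omega> = walk X i \<omega> + block_sum {i<..j} \<omega>"
    unfolding walk_def block_sum_def by (simp only:) (rule sum.union_disjoint, auto)
  then show ?thesis by simp
qed

lemma block_sum_gap_block:
  "0 < i \<Longrightarrow> block_sum (gap_block g i) \<omega> = walk X (gap_time g i) \<omega> - walk X (gap_time g (i - 1)) \<omega>"
  unfolding gap_block_def by (rule block_sum_walk) (simp add: gap_time_mono)

lemma prob_gap_blocks:
  assumes "finite L" "0 \<notin> L"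
  shows "prob {\<omega>\<in>space M. \<forall>i\<in>L. block_sum (gap_block g i) \<omega> = z i} = (\<Prod>i\<in>L. hit (g i) (z i))"
proof -
  have "prob {\<omega>\<in>space M. \<forall>i\<in>L. block_sum (gap_block g i) \<omega> = z i} = (\<Prod>i\<in>L. hit (card (gap_block g i)) (z i))"
    by (rule prob_blocks_hit) (use assms in \<open>auto intro: disjoint_family_gap_block\<close>)
  also have "\<dots> = (\<Prod>i\<in>L. hit (g i) (z i))"
    using assms by (intro prod.cong refl) (metis card_gap_block gr0I)
  finally show ?thesis .
qed

lemma walk_gap_time_const:
  assumes "\<And>i. a < i \<Longrightarrow> i \<le> b \<Longrightarrow> block_sum (gap_block g i) \<omega> = 0" "a \<le> b"
  shows "walk X (gap_time g b) \<omega> = walk X (gap_time g a) \<omega>"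
  using assms(2,1)
proof (induction b rule: dec_induct)
  case (step b)
  then show ?case
    using block_sum_gap_block[of "Suc b" g \<omega>] by force
qed simp

lemma level_event_interval:
  "level_event (gap_time g ` {a..<b}) = {\<omega>\<in>space M. \<forall>i\<in>{a<..<b}. block_sum (gap_block g i) \<omega> = 0}"
proof (intro subset_antisym subsetI)
  fix \<omega> assume "\<omega> \<in> level_event (gap_time g ` {a..<b})"
  then have \<omega>: "\<omega> \<in> space M" "\<And>i j. i \<in> {a..<b} \<Longrightarrow> j \<in> {a..<b} \<Longrightarrow> walk X (gap_time g i) \<omega> = walk X (gap_time g j) \<omega>"
    unfolding level_event_def by blast+
  have "block_sum (gap_block g i) \<omega> = 0" if "i \<in> {a<..<b}" for i
  proof -
    have "walk X (gap_time g i) \<omega> = walk X (gap_time g (i - 1)) \<omega>"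
      using that by (intro \<omega>(2)) auto
    then show ?thesis
      using that by (simp add: block_sum_gap_block)
  qed
  then show "\<omega> \<in> {\<omega>\<in>space M. \<forall>i\<in>{a<..<b}. block_sum (gap_block g i) \<omega> = 0}"
    using \<omega> by auto
next
  fix \<omega> assume \<omega>: "\<omega> \<in> {\<omega>\<in>space M. \<forall>i\<in>{a<..<b}. block_sum (gap_block g i) \<omega> = 0}"
  have "walk X (gap_time g i) \<omega> = walk X (gap_time g a) \<omega>" if "i \<in> {a..<b}" for i
    by (rule walk_gap_time_const) (use \<omega> that in auto)
  then show "\<omega> \<in> level_event (gap_time g ` {a..<b})"
    using \<omega> by (intro level_eventI[where v="walk X (gap_time g a) \<omega>"]) blast+
qed

lemma prob_level_event_interval:
  "prob (level_event (gap_time g ` {a..<b})) = (\<Prod>i\<in>{a<..<b}. hit (g i) 0)"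
  unfolding level_event_interval by (rule prob_gap_blocks) auto

text \<open>The first event reads the blocks strictly below a, the second those strictly above a;
  block a, which joins the two groups, is read by neither.\<close>

lemma covariance_separated:
  assumes "0 < a"
  shows "prob (level_event (gap_time g ` {..<a}) \<inter> level_event (gap_time g ` {a..<u}))
    = prob (level_event (gap_time g ` {..<a})) * prob (level_event (gap_time g ` {a..<u}))"
proof -
  have "level_event (gap_time g ` {..<a}) \<inter> level_event (gap_time g ` {a..<u})
      = {\<omega>\<in>space M. \<forall>i\<in>{0<..<a} \<union> {a<..<u}. block_sum (gap_block g i) \<omega> = 0}"
    unfolding lessThan_atLeast0 level_event_interval by auto
  also have "prob \<dots> = (\<Prod>i\<in>{0<..<a} \<union> {a<..<u}. hit (g i) 0)"
    by (rule prob_gap_blocks) auto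
  also have "\<dots> = (\<Prod>i\<in>{0<..<a}. hit (g i) 0) * (\<Prod>i\<in>{a<..<u}. hit (g i) 0)"
    by (rule prod.union_disjoint) auto
  finally show ?thesis
    by (simp add: lessThan_atLeast0 prob_level_event_interval)
qed

text \<open>Jointly, the displacement made by block a must be undone by block c while all other
  blocks vanish, a return in g a + g c steps. For the outer set alone it is enough that the whole
  stretch from a to c returns. An upper bound for the joint probability and a lower bound for the
  outer one are the directions that an upper bound on the covariance calls for.\<close>

lemma covariance_nested:
  fixes g :: "nat \<Rightarrow> nat"
  assumes ac: "0 < a" "a < c" "c < u"
  defines "J \<equiv> gap_time g ` ({..<a} \<union> {c..<u})" and "J' \<equiv> gap_time g ` {a..<c}"
  shows "prob (level_event J \<inter> level_event J') - prob (level_event J) * prob (level_event J')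
    \<le> (\<Prod>i\<in>{1..<u} - {a, c}. hit (g i) 0) * (hit (g a + g c) 0 - hit (\<Sum>i=a..c. g i) 0)"
proof -
  let ?R = "{1..<u} - {a, c}"
  let ?I = "{a<..<c}"
  let ?O = "{0<..<a} \<union> {c<..<u}"
  have R: "?R = ?O \<union> ?I"
    using ac by auto
  have joint: "prob (level_event J \<inter> level_event J') \<le> (\<Prod>i\<in>?R. hit (g i) 0) * hit (g a + g c) 0"
  proof -
    \<comment> \<open>Index 0 is vacant in \<open>?R\<close> and here carries the union of blocks a
      and c, whose total must vanish.\<close>
    define B where "B i = (if i = 0 then gap_block g a \<union> gap_block g c else gap_block g i)" for i
    have "level_event J \<inter> level_event J' \<subseteq> {\<omega>\<in>space M. \<forall>i\<in>insert 0 ?R. block_sum (B i) \<omega> = 0}"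
    proof
      fix \<omega> assume \<omega>: "\<omega> \<in> level_event J \<inter> level_event J'"
      have J: "walk X (gap_time g i) \<omega> = walk X (gap_time g j) \<omega>" if "i \<in> {..<a} \<union> {c..<u}" "j \<in> {..<a} \<union> {c..<u}" for i j
        using \<omega> that unfolding J_def level_event_def by blast
      have J': "walk X (gap_time g i) \<omega> = walk X (gap_time g j) \<omega>" if "i \<in> {a..<c}" "j \<in> {a..<c}" for i j
        using \<omega> that unfolding J'_def level_event_def by blast
      have "block_sum (B i) \<omega> = 0" if i: "i \<in> ?R" for i
      proof -
        have "walk X (gap_time g i) \<omega> = walk X (gap_time g (i - 1)) \<omega>"
        proof (cases "i \<in> ?I")
          case True
          then show ?thesis by (intro J') auto
        next
          case False
          then show ?thesis using i by (intro J) auto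
        qed
        then show ?thesis
          using i by (simp add: B_def block_sum_gap_block)
      qed
      moreover have "block_sum (B 0) \<omega> = 0"
      proof -
        have "block_sum (B 0) \<omega> = block_sum (gap_block g a) \<omega> + block_sum (gap_block g c) \<omega>"
          using disjoint_gap_block[of a c g] ac by (simp add: B_def block_sum_def sum.union_disjoint)
        also have "\<dots> = (walk X (gap_time g a) \<omega> - walk X (gap_time g (a - 1)) \<omega>)
            + (walk X (gap_time g c) \<omega> - walk X (gap_time g (c - 1)) \<omega>)"
          using ac by (simp add: block_sum_gap_block)
        also have "walk X (gap_time g c) \<omega> = walk X (gap_time g (a - 1)) \<omega>"
          using ac by (intro J) auto
        also have "walk X (gap_time g (c - 1)) \<omega> = walk X (gap_time g a) \<omega>"
          using ac by (intro J') auto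
        finally show ?thesis by simp
      qed
      ultimately show "\<omega> \<in> {\<omega>\<in>space M. \<forall>i\<in>insert 0 ?R. block_sum (B i) \<omega> = 0}"
        using \<omega> by (auto simp: level_event_def)
    qed
    then have "prob (level_event J \<inter> level_event J') \<le> prob {\<omega>\<in>space M. \<forall>i\<in>insert 0 ?R. block_sum (B i) \<omega> = 0}"
      by (rule finite_measure_mono) measurable
    also have "\<dots> = (\<Prod>i\<in>insert 0 ?R. hit (card (B i)) 0)"
    proof (rule prob_blocks_hit)
      have "B i \<inter> B j = {}" if "i \<in> insert 0 ?R" "j \<in> insert 0 ?R" "i < j" for i j
        using that disjoint_gap_block[of i j g] disjoint_gap_block[of a j g] disjoint_gap_block[of j a g]
           disjoint_gap_block[of c j g] disjoint_gap_block[of j c g] ac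
        by (cases "i = 0"; cases "j < a"; cases "j < c") (auto simp: B_def)
      then show "disjoint_family_on B (insert 0 ?R)"
        unfolding disjoint_family_on_def by (metis inf_commute linorder_neqE_nat)
    qed (auto simp: B_def)
    also have "\<dots> = (\<Prod>i\<in>?R. hit (card (B i)) 0) * hit (g a + g c) 0"
      using ac disjoint_gap_block[of a c g] by (simp add: B_def card_Un_disjoint)
    also have "(\<Prod>i\<in>?R. hit (card (B i)) 0) = (\<Prod>i\<in>?R. hit (g i) 0)"
      by (intro prod.cong) (auto simp: B_def)
    finally show ?thesis .
  qed
  have outer: "(\<Prod>i\<in>?O. hit (g i) 0) * hit (\<Sum>i=a..c. g i) 0 \<le> prob (level_event J)"
  proof -
    \<comment> \<open>Index a now carries the whole stretch between the times of index a - 1 and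
      index c, bridging the inner set.\<close>
    define B where "B i = (if i = a then {gap_time g (a - 1)<..gap_time g c} else gap_block g i)" for i
    have "(\<Prod>i\<in>insert a ?O. hit (card (B i)) 0) = prob {\<omega>\<in>space M. \<forall>i\<in>insert a ?O. block_sum (B i) \<omega> = 0}"
    proof (rule prob_blocks_hit[symmetric])
      have "B i \<inter> B j = {}" if ij: "i \<in> insert a ?O" "j \<in> insert a ?O" "i < j" for i j
      proof -
        consider "i = a" "c < j" | "i < a" "j = a" "0 < i" | "i \<noteq> a" "j \<noteq> a" "0 < i"
          using ij ac by fastforce
        then show ?thesis
        proof cases
          case 1
          then show ?thesis using gap_time_le_pred[of c j g] ac by (auto simp: B_def gap_block_def)
        next
          case 2
          then show ?thesis using gap_time_le_pred[of i a g] by (auto simp: B_def gap_block_def)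
        next
          case 3
          then show ?thesis using disjoint_gap_block[of i j g] ij by (simp add: B_def)
        qed
      qed
      then show "disjoint_family_on B (insert a ?O)"
        unfolding disjoint_family_on_def by (metis inf_commute linorder_neqE_nat)
    qed (auto simp: B_def)
    also have "\<dots> \<le> prob (level_event J)"
    proof (rule finite_measure_mono)
      show "{\<omega>\<in>space M. \<forall>i\<in>insert a ?O. block_sum (B i) \<omega> = 0} \<subseteq> level_event J"
      proof
        fix \<omega> assume \<omega>: "\<omega> \<in> {\<omega>\<in>space M. \<forall>i\<in>insert a ?O. block_sum (B i) \<omega> = 0}"
        have z: "block_sum (gap_block g i) \<omega> = 0" if "i \<in> ?O" for i
        proof -
          have "block_sum (B i) \<omega> = 0" "i \<noteq> a"
            using \<omega> that ac by auto
          then show ?thesis by (simp add: B_def)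
        qed
        have low: "walk X (gap_time g i) \<omega> = walk X (gap_time g 0) \<omega>" if "i < a" for i
          by (rule walk_gap_time_const) (use that z in auto)
        have "block_sum (B a) \<omega> = 0"
          using \<omega> by auto
        then have mid: "walk X (gap_time g c) \<omega> = walk X (gap_time g (a - 1)) \<omega>"
          using ac by (simp add: B_def block_sum_walk gap_time_mono)
        have high: "walk X (gap_time g i) \<omega> = walk X (gap_time g c) \<omega>" if "i \<in> {c..<u}" for i
          by (rule walk_gap_time_const) (use that z in auto)
        have "walk X (gap_time g i) \<omega> = walk X (gap_time g 0) \<omega>" if "i \<in> {..<a} \<union> {c..<u}" for i
        proof (cases "i < a")
          case False
          then show ?thesis
            using that high[of i] mid low[of "a - 1"] ac by simp
        qed (rule low)
        then show "\<omega> \<in> level_event J"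
          using \<omega> unfolding J_def by (intro level_eventI[where v="walk X (gap_time g 0) \<omega>"]) blast+
      qed
    qed (simp add: J_def)
    also have "(\<Prod>i\<in>insert a ?O. hit (card (B i)) 0) = (\<Prod>i\<in>?O. hit (card (B i)) 0) * hit (gap_time g c - gap_time g (a - 1)) 0"
      using ac by (simp add: B_def)
    also have "(\<Prod>i\<in>?O. hit (card (B i)) 0) = (\<Prod>i\<in>?O. hit (g i) 0)"
      using ac by (intro prod.cong) (auto simp: B_def)
    also have "gap_time g c - gap_time g (a - 1) = (\<Sum>i=a..c. g i)"
    proof -
      have "{..c} = {..a - 1} \<union> {a..c}"
        using ac by auto
      then have "gap_time g c = gap_time g (a - 1) + (\<Sum>i=a..c. g i)"
        unfolding gap_time_def by (subst sum.union_disjoint[symmetric]) (use ac in auto)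
      then show ?thesis by simp
    qed
    finally show ?thesis .
  qed
  have "prob (level_event J') = (\<Prod>i\<in>?I. hit (g i) 0)"
    unfolding J'_def by (rule prob_level_event_interval)
  then have "((\<Prod>i\<in>?O. hit (g i) 0) * hit (\<Sum>i=a..c. g i) 0) * (\<Prod>i\<in>?I. hit (g i) 0)
      \<le> prob (level_event J) * prob (level_event J')"
    using mult_right_mono[OF outer measure_nonneg[of M "level_event J'"]] by simp
  moreover have "(\<Prod>i\<in>?R. hit (g i) 0) = (\<Prod>i\<in>?O. hit (g i) 0) * (\<Prod>i\<in>?I. hit (g i) 0)"
    unfolding R by (rule prod.union_disjoint) (use ac in auto)
  ultimately show ?thesis
    using joint by (simp add: algebra_simps)
qed

text \<open>On both level events one displacement x determines every block sum: 0 without a label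
  change, otherwise x or -x according to direction. Factors away from a, b, c are bounded by q. Of
  the two factors at x one is bounded by q, and the other convolves with the factor at -x into a
  return probability; either choice is allowed, whence the min.\<close>

lemma prob_interlaced:
  assumes q: "\<And>m z. 1 \<le> m \<Longrightarrow> hit m z \<le> q m"
    and g: "g \<in> gap_vectors u n"
    and W: "W \<subseteq> {..<u}"
    and abc: "a \<in> alternations u W" "c \<in> alternations u W" "b \<in> alternations u W"
      "a < c" "c < b" "c \<in> W \<longleftrightarrow> a \<notin> W" "b \<in> W \<longleftrightarrow> a \<in> W"
  shows "prob (level_event (gap_time g ` W) \<inter> level_event (gap_time g ` ({..<u} - W)))
    \<le> (\<Prod>i\<in>{1..<u} - {a, b, c}. q (g i)) * min (q (g b) * hit (g a + g c) 0) (q (g a) * hit (g b + g c) 0)"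
    (is "prob ?E \<le> _")
proof -
  define R where "R = {1..<u} - {a, b, c}"
  define e where "e i x = (if i \<notin> alternations u W then 0 else if (i \<in> W) = (a \<in> W) then x else - x)" for i and x :: "int ^ 'd"
  have u: "{1..<u} = insert a (insert b (insert c R))" and abc_pos: "0 < a" "a < u" "b < u" "c < u"
    using abc by (auto simp: R_def alternations_def)
  have R: "finite R" "a \<notin> R" "b \<notin> R" "c \<notin> R" "0 \<notin> R"
    by (auto simp: R_def)
  have e: "e a x = x" "e b x = x" "e c x = - x" for x
    using abc by (auto simp: e_def)
  have q': "hit (g i) z \<le> q (g i)" if "i < u" for i z
    using that g by (intro q) (force simp: gap_vectors_def PiE_def Pi_def)
  have "?E \<subseteq> (\<Union>x\<in>UNIV. {\<omega>\<in>space M. \<forall>i\<in>{1..<u}. block_sum (gap_block g i) \<omega> = e i x})"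
  proof
    fix \<omega> assume \<omega>: "\<omega> \<in> ?E"
    \<comment> \<open>An empty index set has a trivial level event, and any v serves.\<close>
    have "\<exists>v. \<forall>i\<in>V. walk X (gap_time g i) \<omega> = v" if "\<omega> \<in> level_event (gap_time g ` V)" for V
    proof (cases "V = {}")
      case False
      then obtain j where "j \<in> V" by blast
      then show ?thesis
        using that unfolding level_event_def by (intro exI[of _ "walk X (gap_time g j) \<omega>"]) blast
    qed simp
    then obtain v v' where v: "\<And>i. i \<in> W \<Longrightarrow> walk X (gap_time g i) \<omega> = v"
        "\<And>i. i \<in> {..<u} - W \<Longrightarrow> walk X (gap_time g i) \<omega> = v'"
      using \<omega> by (metis Int_iff)
    then have w: "walk X (gap_time g i) \<omega> = (if i \<in> W then v else v')" if "i < u" for i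
      using that by auto
    \<comment> \<open>The witness for x is the jump across position a, from the level of a - 1 to
      the level of a.\<close>
    have "block_sum (gap_block g i) \<omega> = e i (if a \<in> W then v - v' else v' - v)" if "i \<in> {1..<u}" for i
    proof -
      have "block_sum (gap_block g i) \<omega> = (if i \<in> W then v else v') - (if i - 1 \<in> W then v else v')"
        using that w[of i] w[of "i - 1"] by (subst block_sum_gap_block) auto
      then show ?thesis
        using that by (auto simp: e_def alternations_def)
    qed
    then show "\<omega> \<in> (\<Union>x\<in>UNIV. {\<omega>\<in>space M. \<forall>i\<in>{1..<u}. block_sum (gap_block g i) \<omega> = e i x})"
      using \<omega> by (auto simp: level_event_def)
  qed
  then have "emeasure M ?E \<le> emeasure M (\<Union>x\<in>UNIV. {\<omega>\<in>space M. \<forall>i\<in>{1..<u}. block_sum (gap_block g i) \<omega> = e i x})"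
    by (rule emeasure_mono) measurable
  also have "\<dots> = (\<integral>\<^sup>+x. emeasure M {\<omega>\<in>space M. \<forall>i\<in>{1..<u}. block_sum (gap_block g i) \<omega> = e i x} \<partial>count_space UNIV)"
  \<comment> \<open>Distinct x give disjoint events because the block at a has sum exactly
    x.\<close>
  proof (rule emeasure_UN_countable)
    show "disjoint_family_on (\<lambda>x. {\<omega>\<in>space M. \<forall>i\<in>{1..<u}. block_sum (gap_block g i) \<omega> = e i x}) UNIV"
      unfolding disjoint_family_on_def u by (auto simp: e)
  qed auto
  also have "\<dots> = (\<integral>\<^sup>+x. ennreal (\<Prod>i\<in>{1..<u}. hit (g i) (e i x)) \<partial>count_space UNIV)"
    unfolding emeasure_eq_measure by (subst prob_gap_blocks) auto
  also have "\<dots> = (\<integral>\<^sup>+x. ennreal (hit (g a) x * (hit (g b) x * (hit (g c) (- x) * (\<Prod>i\<in>R. hit (g i) (e i x))))) \<partial>count_space UNIV)"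
    unfolding u using R abc by (simp add: e)
  also have "\<dots> \<le> (\<integral>\<^sup>+x. ennreal (hit (g a) x * (hit (g b) x * (hit (g c) (- x) * (\<Prod>i\<in>R. q (g i))))) \<partial>count_space UNIV)"
    by (intro nn_integral_mono ennreal_leI mult_left_mono prod_mono conjI q') (auto simp: R_def)
  finally have main: "ennreal (prob ?E) \<le> \<dots>"
    by (simp add: emeasure_eq_measure)
  let ?Q = "\<Prod>i\<in>R. q (g i)"
  have Q: "0 \<le> ?Q"
  proof (intro prod_nonneg ballI)
    fix i assume "i \<in> R"
    then show "0 \<le> q (g i)"
      by (intro order_trans[OF hit_nonneg q'[of i 0]]) (auto simp: R_def)
  qed
  \<comment> \<open>Position s is sacrificed to q; position t is kept for the convolution with
    c.\<close>
  have bound: "prob ?E \<le> ?Q * (q (g s) * hit (g t + g c) 0)" if st: "(s, t) = (a, b) \<or> (s, t) = (b, a)" for s t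
  proof -
    have qs: "0 \<le> q (g s)"
      by (rule order_trans[OF hit_nonneg q'[of s 0]]) (use st abc_pos in auto)
    note main
    also have "(\<integral>\<^sup>+x. ennreal (hit (g a) x * (hit (g b) x * (hit (g c) (- x) * ?Q))) \<partial>count_space UNIV)
        \<le> (\<integral>\<^sup>+x. ennreal (q (g s) * ?Q) * ennreal (hit (g t) x * hit (g c) (- x)) \<partial>count_space UNIV)"
    proof (rule nn_integral_mono)
      fix x
      have "hit (g a) x * (hit (g b) x * (hit (g c) (- x) * ?Q)) = hit (g s) x * (?Q * (hit (g t) x * hit (g c) (- x)))"
        using st by (elim disjE) (simp_all add: mult_ac)
      also have "\<dots> \<le> q (g s) * (?Q * (hit (g t) x * hit (g c) (- x)))"
        by (intro mult_right_mono q' mult_nonneg_nonneg Q hit_nonneg) (use st abc_pos in auto)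
      finally show "ennreal (hit (g a) x * (hit (g b) x * (hit (g c) (- x) * ?Q)))
          \<le> ennreal (q (g s) * ?Q) * ennreal (hit (g t) x * hit (g c) (- x))"
        using qs Q by (simp add: ennreal_mult[symmetric] ennreal_leI mult.assoc)
    qed
    also have "\<dots> = ennreal (q (g s) * ?Q) * ennreal (hit (g t + g c) 0)"
      by (subst nn_integral_cmult) (simp_all add: hit_convolution_zero)
    also have "\<dots> = ennreal (?Q * (q (g s) * hit (g t + g c) 0))"
      using qs Q by (simp add: ennreal_mult[symmetric] algebra_simps)
    finally show ?thesis
      using qs Q by (simp add: ennreal_le_iff)
  qed
  show ?thesis
    unfolding R_def[symmetric] using bound[of b a] bound[of a b] by (simp add: min_def)
qed

section \<open>Variance of the level counts\<close>

definition level_sets :: "nat \<Rightarrow> nat \<Rightarrow> nat set set" where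
  "level_sets k n = {J. J \<subseteq> {1..n} \<and> card J = k}"

text \<open>This is the sum over visited sites of \<open>local_time choose k\<close>, written
  through time sets so that its variance becomes a double sum of covariances of events.\<close>

definition level_count :: "nat \<Rightarrow> nat \<Rightarrow> 'a \<Rightarrow> real" where
  "level_count k n \<omega> = (\<Sum>J\<in>level_sets k n. indicator (level_event J) \<omega>)"

lemma finite_level_sets [simp]: "finite (level_sets k n)"
  unfolding level_sets_def by (rule finite_subset[of _ "Pow {1..n}"]) auto

lemma level_sets_finite: "J \<in> level_sets k n \<Longrightarrow> finite J"
  by (auto simp: level_sets_def intro: finite_subset)

lemma level_count_measurable [measurable]: "level_count k n \<in> borel_measurable M"
  unfolding level_count_def
  by (intro borel_measurable_sum borel_measurable_indicator) (auto intro: level_event_sets level_sets_finite)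

lemma level_count_bound: "\<bar>level_count k n \<omega>\<bar> \<le> real (card (level_sets k n))"
proof -
  have "\<bar>level_count k n \<omega>\<bar> \<le> (\<Sum>J\<in>level_sets k n. \<bar>indicator (level_event J) \<omega>\<bar>)"
    unfolding level_count_def by (rule sum_abs)
  also have "\<dots> \<le> (\<Sum>J\<in>level_sets k n. 1)"
    by (rule sum_mono) (simp add: indicator_def)
  finally show ?thesis by simp
qed

text \<open>Double counting: a nonempty time set on which the walk is constant belongs to exactly
  one visited site. Nonemptiness is where 0 < k enters.\<close>

lemma sum_choose_local_time:
  assumes "\<omega> \<in> space M" "0 < k"
  shows "(\<Sum>x\<in>(\<lambda>j. walk X j \<omega>) ` {1..n}. real (local_time X n x \<omega> choose k)) = level_count k n \<omega>"
proof -
  let ?I = "(\<lambda>j. walk X j \<omega>) ` {1..n}"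
  let ?L = "\<lambda>x. {j \<in> {1..n}. walk X j \<omega> = x}"
  let ?S = "\<lambda>x. {J. J \<subseteq> ?L x \<and> card J = k}"
  have "(\<Sum>x\<in>?I. real (local_time X n x \<omega> choose k)) = real (\<Sum>x\<in>?I. card (?S x))"
    by (simp add: local_time_def n_subsets)
  also have "(\<Sum>x\<in>?I. card (?S x)) = card (\<Union>x\<in>?I. ?S x)"
  proof (rule card_UN_disjoint[symmetric])
    show "\<forall>x\<in>?I. finite (?S x)"
      by (intro ballI finite_subset[of "?S _" "Pow {1..n}"]) auto
    show "\<forall>x\<in>?I. \<forall>y\<in>?I. x \<noteq> y \<longrightarrow> ?S x \<inter> ?S y = {}"
    proof (intro ballI impI equals0I)
      fix x y J assume "x \<noteq> y" and J: "J \<in> ?S x \<inter> ?S y"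
      then have "card J = k" by simp
      then have "J \<noteq> {}"
        using \<open>0 < k\<close> by auto
      then obtain j where "j \<in> J" by blast
      then show False
        using J \<open>x \<noteq> y\<close> by auto
    qed
  qed auto
  also have "(\<Union>x\<in>?I. ?S x) = {J \<in> level_sets k n. \<omega> \<in> level_event J}"
  proof (intro subset_antisym subsetI)
    fix J assume "J \<in> (\<Union>x\<in>?I. ?S x)"
    then obtain x where x: "J \<subseteq> ?L x" "card J = k" by blast
    moreover have "\<omega> \<in> level_event J"
      using x assms by (intro level_eventI[where v=x]) auto
    ultimately show "J \<in> {J \<in> level_sets k n. \<omega> \<in> level_event J}"
      by (auto simp: level_sets_def)
  next
    fix J assume J: "J \<in> {J \<in> level_sets k n. \<omega> \<in> level_event J}"
    then obtain j where j: "j \<in> J"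
      using \<open>0 < k\<close> by (force simp: level_sets_def)
    have "J \<subseteq> ?L (walk X j \<omega>)"
      using J j unfolding level_sets_def level_event_def by blast
    moreover have "walk X j \<omega> \<in> ?I"
      using J j by (auto simp: level_sets_def)
    ultimately show "J \<in> (\<Union>x\<in>?I. ?S x)"
      using J by (intro UN_I[of "walk X j \<omega>"]) (simp_all add: level_sets_def)
  qed
  also have "real (card {J \<in> level_sets k n. \<omega> \<in> level_event J}) = level_count k n \<omega>"
    unfolding level_count_def by (simp add: indicator_def sum.If_cases Int_def)
  finally show ?thesis .
qed

lemma self_int_lt_level_count:
  assumes "0 < \<alpha>"
  obtains c where "\<And>n \<omega>. \<omega> \<in> space M \<Longrightarrow> self_int_lt X \<alpha> n \<omega> = (\<Sum>k\<in>{1..\<alpha>}. c k * level_count k n \<omega>)"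
proof -
  obtain c :: "nat \<Rightarrow> real" where c: "\<And>l. real l ^ \<alpha> = (\<Sum>k\<in>{1..\<alpha>}. c k * real (l choose k))"
    using power_binomial_basis[OF assms] by blast
  have "self_int_lt X \<alpha> n \<omega> = (\<Sum>k\<in>{1..\<alpha>}. c k * level_count k n \<omega>)" if "\<omega> \<in> space M" for n \<omega>
  proof -
    have "self_int_lt X \<alpha> n \<omega> = (\<Sum>k\<in>{1..\<alpha>}. \<Sum>x\<in>(\<lambda>j. walk X j \<omega>) ` {1..n}. c k * real (local_time X n x \<omega> choose k))"
      unfolding self_int_lt_def c by (rule sum.swap)
    also have "\<dots> = (\<Sum>k\<in>{1..\<alpha>}. c k * level_count k n \<omega>)"
      unfolding sum_distrib_left[symmetric]
      by (intro sum.cong refl arg_cong2[where f="(*)"] sum_choose_local_time that) auto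
    finally show ?thesis .
  qed
  then show thesis by (rule that)
qed

text \<open>Singletons are always level, so this component is deterministic and the variance
  estimates may start at k = 2.\<close>

lemma level_count_1: "\<omega> \<in> space M \<Longrightarrow> level_count 1 n \<omega> = real n"
proof -
  assume \<omega>: "\<omega> \<in> space M"
  have "level_count 1 n \<omega> = (\<Sum>J\<in>level_sets 1 n. 1)"
    unfolding level_count_def using \<omega>
    by (intro sum.cong) (auto simp: level_sets_def level_event_def indicator_def card_1_singleton_iff)
  also have "\<dots> = real (card {1..n} choose 1)"
    unfolding level_sets_def by (subst n_subsets[symmetric]) auto
  finally show ?thesis by simp
qed

definition level_cov :: "nat set \<Rightarrow> nat set \<Rightarrow> real" where
  "level_cov J J' = prob (level_event J \<inter> level_event J') - prob (level_event J) * prob (level_event J')"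

lemma level_cov_commute: "level_cov J J' = level_cov J' J"
  by (simp add: level_cov_def Int_commute mult.commute)

lemma level_cov_le: "level_cov J J' \<le> prob (level_event J \<inter> level_event J')"
  by (simp add: level_cov_def)

lemma variance_level_count:
  "variance (level_count k n) = (\<Sum>(J, J')\<in>level_sets k n \<times> level_sets k n. level_cov J J')"
proof -
  let ?S = "level_sets k n"
  have sets: "level_event J \<in> sets M" if "J \<in> ?S" for J
    using that by (intro level_event_sets level_sets_finite)
  have int: "integrable M (indicator (level_event J) :: 'a \<Rightarrow> real)" if "J \<in> ?S" for J
    using sets[OF that] by (intro integrable_real_indicator) (auto simp: emeasure_eq_measure)
  have int2: "integrable M (level_count k n)" "integrable M (\<lambda>\<omega>. (level_count k n \<omega>)\<^sup>2)"
  proof -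
    show "integrable M (level_count k n)"
      by (rule integrable_const_bound[where B="real (card ?S)"]) (use level_count_bound in auto)
    show "integrable M (\<lambda>\<omega>. (level_count k n \<omega>)\<^sup>2)"
    proof (rule integrable_const_bound[where B="(real (card ?S))\<^sup>2"])
      show "AE \<omega> in M. norm ((level_count k n \<omega>)\<^sup>2) \<le> (real (card ?S))\<^sup>2"
        using level_count_bound[of k n] by (intro AE_I2) (simp add: abs_le_square_iff[symmetric])
    qed measurable
  qed
  have E: "expectation (level_count k n) = (\<Sum>J\<in>?S. prob (level_event J))"
    unfolding level_count_def using int sets by (subst Bochner_Integration.integral_sum) auto
  have "expectation (\<lambda>\<omega>. (level_count k n \<omega>)\<^sup>2)
      = expectation (\<lambda>\<omega>. \<Sum>(J, J')\<in>?S \<times> ?S. indicator (level_event J \<inter> level_event J') \<omega>)"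
    unfolding level_count_def power2_eq_square sum_product sum.cartesian_product indicator_inter_arith ..
  also have "\<dots> = (\<Sum>(J, J')\<in>?S \<times> ?S. prob (level_event J \<inter> level_event J'))"
  proof -
    have "expectation (\<lambda>\<omega>. \<Sum>z\<in>?S \<times> ?S. indicator (level_event (fst z) \<inter> level_event (snd z)) \<omega>)
       = (\<Sum>z\<in>?S \<times> ?S. expectation (indicator (level_event (fst z) \<inter> level_event (snd z)) :: 'a \<Rightarrow> real))"
      by (rule Bochner_Integration.integral_sum)
        (use sets in \<open>auto intro!: integrable_real_indicator simp: emeasure_eq_measure\<close>)
    also have "\<dots> = (\<Sum>z\<in>?S \<times> ?S. prob (level_event (fst z) \<inter> level_event (snd z)))"
      by (intro sum.cong refl) (use sets in auto)
    finally show ?thesis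
      by (simp add: case_prod_unfold)
  qed
  finally have E2: "expectation (\<lambda>\<omega>. (level_count k n \<omega>)\<^sup>2) = \<dots>" .
  have "(\<Sum>J\<in>?S. prob (level_event J))\<^sup>2 = (\<Sum>(J, J')\<in>?S \<times> ?S. prob (level_event J) * prob (level_event J'))"
    by (simp add: power2_eq_square sum_product sum.cartesian_product)
  then show ?thesis
    using variance_eq[OF int2] by (simp add: E E2 level_cov_def sum_subtractf case_prod_unfold)
qed

lemma prob_level_event_gap_vector:
  assumes "0 < u"
  shows "prob (level_event (gap_time g ` {..<u})) = (\<Prod>i\<in>{1..<u}. hit (g i) 0)"
proof -
  have "{0<..<u} = {1..<u}" by auto
  then show ?thesis
    using prob_level_event_interval[of g 0 u] by (simp add: lessThan_atLeast0)
qed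

lemma sum_prob_level_event:
  assumes q: "\<And>m z. 1 \<le> m \<Longrightarrow> hit m z \<le> q m" and "0 < u"
  shows "(\<Sum>J\<in>level_sets u n. prob (level_event J)) \<le> real n * (\<Sum>m=1..n. q m) ^ (u - 1)"
proof -
  have q0: "0 \<le> q m" if "1 \<le> m" for m
    using order_trans[OF hit_nonneg q[OF that]] .
  have "(\<Sum>J\<in>level_sets u n. prob (level_event J)) = (\<Sum>g\<in>gap_vectors u n. \<Prod>i\<in>{1..<u}. hit (g i) 0)"
    unfolding level_sets_def sum_subsets_gap_vectors using \<open>0 < u\<close> by (simp add: prob_level_event_gap_vector)
  also have "\<dots> \<le> (\<Sum>g\<in>gap_vectors u n. \<Prod>i\<in>{1..<u}. q (g i))"
    by (intro sum_mono prod_mono conjI q) (force simp: gap_vectors_def PiE_def Pi_def)+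
  also have "\<dots> \<le> real n * (\<Sum>m=1..n. q m) ^ (u - 1)"
    by (rule sum_gap_vectors_prod) (use q0 assms in auto)
  finally show ?thesis .
qed

text \<open>A common time merges both conditions into levelness of the union U, which has at most
  2*k - 1 elements. Each U arises from at most 2^(2*k) * 2^(2*k) = 16^k pairs of its subsets, and
  the maximum with 1 lets the largest exponent dominate for all sizes of U.\<close>

lemma sum_level_cov_meeting:
  assumes q: "\<And>m z. 1 \<le> m \<Longrightarrow> hit m z \<le> q m" and "0 < k"
  shows "(\<Sum>(J, J') | J \<in> level_sets k n \<and> J' \<in> level_sets k n \<and> J \<inter> J' \<noteq> {}. level_cov J J')
    \<le> 2 * real k * 16 ^ k * real n * max 1 (\<Sum>m=1..n. q m) ^ (2 * k - 2)"
proof -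
  let ?P = "{(J, J'). J \<in> level_sets k n \<and> J' \<in> level_sets k n \<and> J \<inter> J' \<noteq> {}}"
  let ?Q = "max 1 (\<Sum>m=1..n. q m)"
  let ?V = "\<Union>u\<in>{1..2*k-1}. level_sets u n"
  have finP: "finite ?P"
    by (rule finite_subset[of _ "level_sets k n \<times> level_sets k n"]) auto
  have le: "level_cov J J' \<le> prob (level_event (J \<union> J'))" if "(J, J') \<in> ?P" for J J'
  proof -
    obtain i where "i \<in> J" "i \<in> J'"
      using \<open>(J, J') \<in> ?P\<close> by blast
    moreover have "finite (J \<union> J')"
      using \<open>(J, J') \<in> ?P\<close> level_sets_finite by blast
    ultimately show ?thesis
      using level_event_Un[of i J J'] by (intro order_trans[OF level_cov_le] finite_measure_mono level_event_sets)
  qed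
  have un: "J \<union> J' \<in> ?V" if "(J, J') \<in> ?P" for J J'
  proof -
    have fin: "finite J" "finite J'"
      using that level_sets_finite by auto
    have "card (J \<union> J') + card (J \<inter> J') = 2 * k"
      using card_Un_Int[OF fin] that by (auto simp: level_sets_def)
    moreover have "card (J \<inter> J') > 0"
      using that fin by (auto simp: card_gt_0_iff)
    moreover have "card (J \<union> J') > 0"
      using that fin by (auto simp: card_gt_0_iff)
    ultimately have "card (J \<union> J') \<in> {1..2*k-1}"
      by auto
    moreover have "J \<union> J' \<in> level_sets (card (J \<union> J')) n"
      using that by (auto simp: level_sets_def)
    ultimately show ?thesis by blast
  qed
  have "(\<Sum>(J, J')\<in>?P. level_cov J J') \<le> (\<Sum>z\<in>?P. prob (level_event (fst z \<union> snd z)))"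
  proof (rule sum_mono)
    fix z assume "z \<in> ?P"
    then have "(fst z, snd z) \<in> ?P" by simp
    from le[OF this] show "(case z of (J, J') \<Rightarrow> level_cov J J') \<le> prob (level_event (fst z \<union> snd z))"
      by (simp add: case_prod_unfold)
  qed
  also have "\<dots> = (\<Sum>(U, z)\<in>(\<lambda>z. (fst z \<union> snd z, z)) ` ?P. prob (level_event U))"
    by (subst sum.reindex) (auto simp: inj_on_def)
  also have "\<dots> \<le> (\<Sum>(U, z)\<in>Sigma ?V (\<lambda>U. Pow U \<times> Pow U). prob (level_event U))"
  proof (rule sum_mono2)
    show "finite (Sigma ?V (\<lambda>U. Pow U \<times> Pow U))"
      using level_sets_finite by (intro finite_SigmaI) auto
    show "(\<lambda>z. (fst z \<union> snd z, z)) ` ?P \<subseteq> Sigma ?V (\<lambda>U. Pow U \<times> Pow U)"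
    proof
      fix y assume "y \<in> (\<lambda>z. (fst z \<union> snd z, z)) ` ?P"
      then obtain z where z: "z \<in> ?P" "y = (fst z \<union> snd z, z)" by blast
      obtain J J' where y: "y = (J \<union> J', (J, J'))" "(J, J') \<in> ?P"
        using z by (cases z) simp
      show "y \<in> Sigma ?V (\<lambda>U. Pow U \<times> Pow U)"
        unfolding y(1) using un[OF y(2)] by simp
    qed
  qed auto
  also have "\<dots> = (\<Sum>U\<in>?V. \<Sum>z\<in>Pow U \<times> Pow U. prob (level_event U))"
    by (rule sum.Sigma[symmetric]) (use level_sets_finite in auto)
  also have "\<dots> \<le> (\<Sum>U\<in>?V. 16 ^ k * prob (level_event U))"
  proof (rule sum_mono)
    fix U assume U: "U \<in> ?V"
    then obtain u where u: "u \<in> {1..2*k-1}" "U \<in> level_sets u n" by blast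
    have fU: "finite U"
      by (rule level_sets_finite[OF u(2)])
    have cU: "card U \<le> 2 * k"
      using u by (auto simp: level_sets_def)
    have "real (card (Pow U \<times> Pow U)) = 2 ^ card U * 2 ^ card U"
      using fU by (simp add: card_Pow)
    also have "\<dots> \<le> 2 ^ (2 * k) * 2 ^ (2 * k)"
      using cU by (intro mult_mono power_increasing) auto
    also have "\<dots> = 16 ^ k"
      by (simp add: power_mult power_mult_distrib[symmetric])
    finally show "(\<Sum>z\<in>Pow U \<times> Pow U. prob (level_event U)) \<le> 16 ^ k * prob (level_event U)"
      by (simp add: mult_right_mono)
  qed
  also have "\<dots> = 16 ^ k * (\<Sum>u=1..2*k-1. \<Sum>J\<in>level_sets u n. prob (level_event J))"
    by (subst sum.UNION_disjoint) (auto simp: level_sets_def sum_distrib_left finite_level_sets[unfolded level_sets_def])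
  also have "\<dots> \<le> 16 ^ k * (\<Sum>u=1..2*k-1. real n * ?Q ^ (2 * k - 2))"
  proof (intro mult_left_mono sum_mono)
    fix u assume u: "u \<in> {1..2*k-1}"
    have "0 \<le> (\<Sum>m=1..n. q m)"
      using order_trans[OF hit_nonneg q] by (intro sum_nonneg) auto
    then have "(\<Sum>m=1..n. q m) ^ (u - 1) \<le> ?Q ^ (u - 1)"
      by (intro power_mono) auto
    also have "\<dots> \<le> ?Q ^ (2 * k - 2)"
      using u by (intro power_increasing) auto
    finally have "real n * (\<Sum>m=1..n. q m) ^ (u - 1) \<le> real n * ?Q ^ (2 * k - 2)"
      by (rule mult_left_mono) simp
    then show "(\<Sum>J\<in>level_sets u n. prob (level_event J)) \<le> real n * ?Q ^ (2 * k - 2)"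
      using sum_prob_level_event[OF q, of u n] u by auto
  qed simp
  also have "\<dots> = real (2 * k - 1) * (16 ^ k * (real n * ?Q ^ (2 * k - 2)))"
    by simp
  also have "\<dots> \<le> (2 * real k) * (16 ^ k * (real n * ?Q ^ (2 * k - 2)))"
    by (intro mult_right_mono) auto
  finally show ?thesis
    by (simp add: algebra_simps)
qed

lemma sum_level_cov_word:
  assumes q: "\<And>m z. 1 \<le> m \<Longrightarrow> hit m z \<le> q m" and k: "2 \<le> k"
    and W: "W \<subseteq> {..<2*k}" "card W = k"
  shows "(\<Sum>g\<in>gap_vectors (2*k) n. level_cov (gap_time g ` W) (gap_time g ` ({..<2*k} - W)))
    \<le> 2 * real k * (real n * (\<Sum>m=1..n. q m) ^ (2 * k - 4) * overlap_sum q (\<lambda>m. hit m 0) n)"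
    (is "?L \<le> 2 * real k * ?B")
proof -
  have q0: "0 \<le> q m" if "1 \<le> m" for m
    using order_trans[OF hit_nonneg q[OF that]] .
  have B: "0 \<le> ?B"
    using q0 by (intro mult_nonneg_nonneg overlap_sum_nonneg zero_le_power sum_nonneg) auto
  have W': "W \<noteq> {}" "W \<noteq> {..<2*k}"
  proof -
    have "card {..<2*k} = 2 * k" by simp
    then show "W \<noteq> {}" "W \<noteq> {..<2*k}"
      using W(2) k by fastforce+
  qed
  \<comment> \<open>Covariance is symmetric, so knowing the pair of position sets up to order is
    enough.\<close>
  have cov_eq: "level_cov (gap_time g ` W) (gap_time g ` ({..<2*k} - W)) = level_cov (gap_time g ` A) (gap_time g ` B)"
    if "{W, {..<2*k} - W} = {A, B}" for A B g
    using that level_cov_commute by (auto simp: doubleton_eq_iff)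
  from W(1) W' show ?thesis
  proof (cases rule: alternations_cases)
    case (one a)
    have "level_cov (gap_time g ` W) (gap_time g ` ({..<2*k} - W)) = 0" for g
      unfolding cov_eq[OF one(3)] unfolding level_cov_def using covariance_separated[OF one(1)] by simp
    then show ?thesis
      using B by simp
  next
    case (two a c)
    have "level_cov (gap_time g ` W) (gap_time g ` ({..<2*k} - W))
       \<le> (\<Prod>i\<in>{1..<2*k} - {a, c}. hit (g i) 0) * (hit (g a + g c) 0 - hit (\<Sum>i=a..c. g i) 0)" for g
      unfolding cov_eq[OF two(4)] level_cov_commute[of "gap_time g ` {a..<c}"] unfolding level_cov_def
      by (rule covariance_nested[OF two(1-3)])
    then have "?L \<le> (\<Sum>g\<in>gap_vectors (2*k) n. (\<Prod>i\<in>{1..<2*k} - {a, c}. hit (g i) 0) * (hit (g a + g c) 0 - hit (\<Sum>i=a..c. g i) 0))"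
      by (rule sum_mono)
    also have "\<dots> \<le> real (2 * k) * real n * (\<Sum>m=1..n. q m) ^ (2 * k - 4) * overlap_sum q (\<lambda>m. hit m 0) n"
      by (rule sum_gap_vectors_nested) (use q two in auto)
    finally show ?thesis
      by (simp add: mult.assoc)
  next
    case (three a c b)
    have "?L \<le> (\<Sum>g\<in>gap_vectors (2*k) n. (\<Prod>i\<in>{1..<2*k} - {a, b, c}. q (g i))
            * min (q (g b) * hit (g a + g c) 0) (q (g a) * hit (g b + g c) 0))"
      by (intro sum_mono order_trans[OF level_cov_le] prob_interlaced[where n=n] q W three)
    also have "\<dots> \<le> 2 * real n * (\<Sum>m=1..n. q m) ^ (2 * k - 4) * overlap_sum q (\<lambda>m. hit m 0) n"
      by (rule sum_gap_vectors_interlaced) (use q0 three in \<open>auto simp: alternations_def\<close>)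
    also have "\<dots> = 2 * ?B"
      by (simp add: mult.assoc)
    also have "\<dots> \<le> 2 * real k * ?B"
      using B k by (intro mult_right_mono) auto
    finally show ?thesis .
  qed
qed

lemma variance_level_count_le:
  assumes q: "\<And>m z. 1 \<le> m \<Longrightarrow> hit m z \<le> q m" and k: "2 \<le> k"
  shows "variance (level_count k n) \<le> 2 * real k * 16 ^ k * real n *
    ((\<Sum>m=1..n. q m) ^ (2 * k - 4) * overlap_sum q (\<lambda>m. hit m 0) n + max 1 (\<Sum>m=1..n. q m) ^ (2 * k - 2))"
proof -
  let ?S = "level_sets k n"
  let ?D = "{(J, J'). J \<in> ?S \<and> J' \<in> ?S \<and> J \<inter> J' = {}}"
  let ?P = "{(J, J'). J \<in> ?S \<and> J' \<in> ?S \<and> J \<inter> J' \<noteq> {}}"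
  let ?B = "real n * (\<Sum>m=1..n. q m) ^ (2 * k - 4) * overlap_sum q (\<lambda>m. hit m 0) n"
  let ?WW = "{W. W \<subseteq> {..<2*k} \<and> card W = k}"
  have q0: "0 \<le> q m" if "1 \<le> m" for m
    using order_trans[OF hit_nonneg q[OF that]] .
  have B: "0 \<le> ?B"
    using q0 by (intro mult_nonneg_nonneg overlap_sum_nonneg zero_le_power sum_nonneg) auto
  have fin: "finite ?D" "finite ?P"
    by (rule finite_subset[of _ "?S \<times> ?S"]; auto)+
  have var: "variance (level_count k n) = (\<Sum>(J, J')\<in>?D. level_cov J J') + (\<Sum>(J, J')\<in>?P. level_cov J J')"
    unfolding variance_level_count
    by (subst sum.union_disjoint[symmetric]) (use fin in \<open>auto intro!: sum.cong\<close>)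
  have "(\<Sum>(J, J')\<in>?D. level_cov J J') = (\<Sum>W\<in>?WW. \<Sum>g\<in>gap_vectors (2*k) n.
      level_cov (gap_time g ` W) (gap_time g ` ({..<2*k} - W)))"
    using sum_disjoint_pairs_gap_vectors[of level_cov n k] by (simp add: level_sets_def conj_assoc)
  also have "\<dots> \<le> (\<Sum>W\<in>?WW. 2 * real k * ?B)"
    by (intro sum_mono sum_level_cov_word[OF q k]) auto
  also have "\<dots> = real (card ?WW) * (2 * real k * ?B)"
    by (rule sum_constant)
  \<comment> \<open>There are at most 4^k words; the larger 16^k is taken to share the constant with
    the meeting pairs.\<close>
  also have "\<dots> \<le> 16 ^ k * (2 * real k * ?B)"
  proof (rule mult_right_mono)
    show "0 \<le> 2 * real k * ?B"
      by (rule mult_nonneg_nonneg[OF _ B]) simp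
    have "card ?WW \<le> card (Pow {..<2*k})"
      by (intro card_mono) auto
    also have "\<dots> = 4 ^ k"
      by (simp add: card_Pow power_mult)
    also have "(4::nat) ^ k \<le> 16 ^ k"
      by (rule power_mono) auto
    finally have "real (card ?WW) \<le> real (16 ^ k)"
      by (rule of_nat_mono)
    then show "real (card ?WW) \<le> 16 ^ k" by simp
  qed
  finally have "(\<Sum>(J, J')\<in>?D. level_cov J J') \<le> 16 ^ k * (2 * real k * ?B)" .
  moreover have "(\<Sum>(J, J')\<in>?P. level_cov J J') \<le> 2 * real k * 16 ^ k * real n * max 1 (\<Sum>m=1..n. q m) ^ (2 * k - 2)"
    by (rule sum_level_cov_meeting[OF q]) (use k in auto)
  ultimately have "variance (level_count k n) \<le> 16 ^ k * (2 * real k * ?B)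
      + 2 * real k * 16 ^ k * real n * max 1 (\<Sum>m=1..n. q m) ^ (2 * k - 2)"
    unfolding var by (rule add_mono)
  then show ?thesis
    by (simp only: distrib_left mult_ac)
qed

text \<open>Cauchy-Schwarz over the at most alpha components removes the covariances between level
  counts of different k at the price of a factor alpha. K is the sum of the constants of the single
  components.\<close>

lemma variance_self_int_lt_le:
  assumes q: "\<And>m z. 1 \<le> m \<Longrightarrow> hit m z \<le> q m" and "0 < \<alpha>"
  obtains K where "0 \<le> K" "\<And>n. variance (self_int_lt X \<alpha> n) \<le> (\<Sum>k=2..\<alpha>. K * real n *
    ((\<Sum>m=1..n. q m) ^ (2 * k - 4) * overlap_sum q (\<lambda>m. hit m 0) n + max 1 (\<Sum>m=1..n. q m) ^ (2 * k - 2)))"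
proof -
  obtain c where c: "\<And>n \<omega>. \<omega> \<in> space M \<Longrightarrow> self_int_lt X \<alpha> n \<omega> = (\<Sum>k\<in>{1..\<alpha>}. c k * level_count k n \<omega>)"
    using self_int_lt_level_count[OF \<open>0 < \<alpha>\<close>] by blast
  define G where "G k n = (\<Sum>m=1..n. q m) ^ (2 * k - 4) * overlap_sum q (\<lambda>m. hit m 0) n + max 1 (\<Sum>m=1..n. q m) ^ (2 * k - 2)" for k n
  have q0: "0 \<le> q m" if "1 \<le> m" for m
    using order_trans[OF hit_nonneg q[OF that]] .
  have G: "0 \<le> G k n" for k n
    unfolding G_def using q0 by (intro add_nonneg_nonneg mult_nonneg_nonneg overlap_sum_nonneg zero_le_power sum_nonneg) auto
  define b where "b k = real \<alpha> * (c k)\<^sup>2 * (2 * real k * 16 ^ k)" for k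
  have b: "0 \<le> b k" for k
    by (simp add: b_def)
  have int: "integrable M (level_count k n)" for k n
    by (rule integrable_const_bound[where B="real (card (level_sets k n))"]) (use level_count_bound in auto)
  have var_le: "variance (self_int_lt X \<alpha> n) \<le> real \<alpha> * (\<Sum>k\<in>{1..\<alpha>}. (c k)\<^sup>2 * variance (level_count k n))" for n
  proof -
    let ?e = "\<lambda>k. expectation (level_count k n)"
    have E: "expectation (self_int_lt X \<alpha> n) = (\<Sum>k\<in>{1..\<alpha>}. c k * ?e k)"
    proof -
      have "expectation (self_int_lt X \<alpha> n) = expectation (\<lambda>\<omega>. \<Sum>k\<in>{1..\<alpha>}. c k * level_count k n \<omega>)"
        by (intro Bochner_Integration.integral_cong refl c)
      also have "\<dots> = (\<Sum>k\<in>{1..\<alpha>}. c k * ?e k)"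
        using int by (subst Bochner_Integration.integral_sum) auto
      finally show ?thesis .
    qed
    have isq: "integrable M (\<lambda>\<omega>. (level_count k n \<omega> - ?e k)\<^sup>2)" for k
    proof (rule integrable_const_bound[where B="(real (card (level_sets k n)) + \<bar>?e k\<bar>)\<^sup>2"])
      have "\<bar>level_count k n \<omega> - ?e k\<bar> \<le> real (card (level_sets k n)) + \<bar>?e k\<bar>" for \<omega>
        using level_count_bound[of k n \<omega>] by linarith
      then show "AE \<omega> in M. norm ((level_count k n \<omega> - ?e k)\<^sup>2) \<le> (real (card (level_sets k n)) + \<bar>?e k\<bar>)\<^sup>2"
        by (intro AE_I2) (simp add: abs_le_square_iff[symmetric])
    qed measurable
    have "variance (self_int_lt X \<alpha> n) = expectation (\<lambda>\<omega>. (\<Sum>k\<in>{1..\<alpha>}. c k * (level_count k n \<omega> - ?e k))\<^sup>2)"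
      by (intro Bochner_Integration.integral_cong refl) (simp add: c E right_diff_distrib sum_subtractf)
    also have "\<dots> \<le> expectation (\<lambda>\<omega>. \<Sum>k\<in>{1..\<alpha>}. real \<alpha> * (c k)\<^sup>2 * (level_count k n \<omega> - ?e k)\<^sup>2)"
    proof (rule integral_mono')
      show "integrable M (\<lambda>\<omega>. \<Sum>k\<in>{1..\<alpha>}. real \<alpha> * (c k)\<^sup>2 * (level_count k n \<omega> - ?e k)\<^sup>2)"
        using isq by auto
      fix \<omega>
      show "(\<Sum>k\<in>{1..\<alpha>}. c k * (level_count k n \<omega> - ?e k))\<^sup>2 \<le> (\<Sum>k\<in>{1..\<alpha>}. real \<alpha> * (c k)\<^sup>2 * (level_count k n \<omega> - ?e k)\<^sup>2)"
        using sum_squared_le_sum_of_squares[of "\<lambda>k. c k * (level_count k n \<omega> - ?e k)" "{1..\<alpha>}"]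
        by (simp add: power_mult_distrib sum_distrib_left sum_distrib_right mult_ac)
    qed (auto intro!: sum_nonneg)
    also have "\<dots> = (\<Sum>k\<in>{1..\<alpha>}. real \<alpha> * (c k)\<^sup>2 * variance (level_count k n))"
      using isq by (subst Bochner_Integration.integral_sum) auto
    finally show ?thesis
      by (simp add: sum_distrib_left algebra_simps)
  qed
  have var1: "variance (level_count 1 n) = 0" for n
  proof -
    have "expectation (level_count 1 n) = expectation (\<lambda>_. real n)"
      by (intro Bochner_Integration.integral_cong refl level_count_1)
    then have "variance (level_count 1 n) = expectation (\<lambda>_. 0)"
      by (intro Bochner_Integration.integral_cong refl) (use level_count_1 in \<open>auto simp: prob_space\<close>)
    then show ?thesis by simp
  qed
  show thesis
  proof (rule that)
    show "0 \<le> (\<Sum>k=2..\<alpha>. b k)"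
      by (intro sum_nonneg b)
    fix n
    have "real \<alpha> * (\<Sum>k\<in>{1..\<alpha>}. (c k)\<^sup>2 * variance (level_count k n))
        = real \<alpha> * (\<Sum>k\<in>{2..\<alpha>}. (c k)\<^sup>2 * variance (level_count k n))"
    proof -
      have "{1..\<alpha>} = insert 1 {2..\<alpha>}"
        using \<open>0 < \<alpha>\<close> by auto
      then show ?thesis using var1 by simp
    qed
    also have "\<dots> \<le> real \<alpha> * (\<Sum>k\<in>{2..\<alpha>}. (c k)\<^sup>2 * (2 * real k * 16 ^ k * real n * G k n))"
      unfolding G_def by (intro mult_left_mono sum_mono variance_level_count_le[OF q]) auto
    also have "\<dots> = (\<Sum>k=2..\<alpha>. b k * (real n * G k n))"
      by (simp add: b_def sum_distrib_left algebra_simps)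
    also have "\<dots> \<le> (\<Sum>k=2..\<alpha>. (\<Sum>k=2..\<alpha>. b k) * (real n * G k n))"
      using G b by (intro sum_mono mult_right_mono member_le_sum) auto
    finally have "real \<alpha> * (\<Sum>k\<in>{1..\<alpha>}. (c k)\<^sup>2 * variance (level_count k n)) \<le> (\<Sum>k=2..\<alpha>. (\<Sum>k=2..\<alpha>. b k) * real n * G k n)"
      by (simp add: mult.assoc)
    then show "variance (self_int_lt X \<alpha> n) \<le> (\<Sum>k=2..\<alpha>. (\<Sum>k=2..\<alpha>. b k) * real n *
      ((\<Sum>m=1..n. q m) ^ (2 * k - 4) * overlap_sum q (\<lambda>m. hit m 0) n + max 1 (\<Sum>m=1..n. q m) ^ (2 * k - 2)))"
      unfolding G_def by (rule order_trans[OF var_le])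
  qed
qed

end

section \<open>Concentration via characteristic functions\<close>

lemma cball_sets_borel [measurable]: "cball x r \<in> sets borel"
  by (rule borel_closed) simp

text \<open>Two integrations of cos >= 1/2 on [0, 1], an interval contained in [0, pi/3].\<close>

lemma one_minus_cos_ge:
  fixes u :: real
  assumes "\<bar>u\<bar> \<le> 1"
  shows "u\<^sup>2 / 4 \<le> 1 - cos u"
proof -
  have "u\<^sup>2 / 4 \<le> 1 - cos u" if u: "0 \<le> u" "u \<le> 1" for u :: real
  proof -
    have cos: "1 / 2 \<le> cos x" if "0 \<le> x" "x \<le> 1" for x :: real
    proof -
      have "cos (pi / 3) \<le> cos x"
        using that pi_gt3 by (subst cos_mono_le_eq) auto
      then show ?thesis by (simp add: cos_60)
    qed
    have sin: "x / 2 \<le> sin x" if x: "0 \<le> x" "x \<le> 1" for x :: real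
    proof -
      have "sin 0 - 0 / 2 \<le> sin x - x / 2"
      proof (rule DERIV_nonneg_imp_nondecreasing[OF x(1)])
        fix y assume "0 \<le> y" "y \<le> x"
        then show "\<exists>D. ((\<lambda>x. sin x - x / 2) has_real_derivative D) (at y) \<and> 0 \<le> D"
          using cos[of y] x by (intro exI[of _ "cos y - 1 / 2"]) (auto intro!: derivative_eq_intros)
      qed
      then show ?thesis by simp
    qed
    have "1 - cos 0 - 0\<^sup>2 / 4 \<le> 1 - cos u - u\<^sup>2 / 4"
    proof (rule DERIV_nonneg_imp_nondecreasing[OF u(1)])
      fix y assume "0 \<le> y" "y \<le> u"
      then show "\<exists>D. ((\<lambda>u. 1 - cos u - u\<^sup>2 / 4) has_real_derivative D) (at y) \<and> 0 \<le> D"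
        using sin[of y] u by (intro exI[of _ "sin y - y / 2"]) (auto intro!: derivative_eq_intros)
    qed
    then show ?thesis by simp
  qed
  from this[of "\<bar>u\<bar>"] assms show ?thesis
    by simp
qed

lemma cball_volume:
  assumes "0 < r"
  shows "emeasure lborel (cball (0::'b::euclidean_space) r) \<noteq> 0" "emeasure lborel (cball (0::'b) r) \<noteq> \<infinity>"
proof -
  have "unit_ball_vol (real DIM('b)) \<noteq> 0"
    by (metis less_irrefl of_nat_0_le_iff unit_ball_vol_pos)
  then show "emeasure lborel (cball (0::'b) r) \<noteq> 0" "emeasure lborel (cball (0::'b) r) \<noteq> \<infinity>"
    using assms by (simp_all add: emeasure_cball)
qed

text \<open>Averaging \<open>exp (i u \<bullet> (Z - z))\<close> over \<open>u\<close> uniform in a small ball and taking the squared modulus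
  gives a nonnegative function of \<open>Z\<close> equal to 1 at \<open>z\<close>. Only arguments near the origin enter, so
  periodicity of the characteristic function is irrelevant.\<close>

lemma (in prob_space) concentration_le_char:
  fixes Z :: "'a \<Rightarrow> 'b::euclidean_space"
  assumes [measurable]: "Z \<in> borel_measurable M" and r: "0 < r"
  shows "ennreal (prob {\<omega>\<in>space M. Z \<omega> = z}) \<le>
    (\<integral>\<^sup>+t. ennreal (norm (expectation (\<lambda>\<omega>. iexp (t \<bullet> Z \<omega>)))) * indicator (cball 0 (2 * r)) t \<partial>lborel)
      / emeasure lborel (cball (0::'b) r)"
proof -
  let ?B = "cball (0::'b) r"
  define N where "N = uniform_measure lborel ?B"
  have vol: "emeasure lborel ?B \<noteq> 0" "emeasure lborel ?B \<noteq> \<infinity>"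
    using cball_volume[OF r] by auto
  interpret N: prob_space N
    unfolding N_def by (rule prob_space_uniform_measure[OF vol])
  have [measurable_cong, simp]: "sets N = sets borel"
    by (simp add: N_def)
  interpret NN: pair_prob_space N N ..
  interpret MN: pair_sigma_finite M "N \<Otimes>\<^sub>M N" ..
  interpret MNp: pair_prob_space M "N \<Otimes>\<^sub>M N" ..
  define h where "h \<omega> w = cos ((fst w - snd w) \<bullet> (Z \<omega> - z))" for \<omega> w
  have h_meas [measurable]: "(\<lambda>(\<omega>, w). h \<omega> w) \<in> borel_measurable (M \<Otimes>\<^sub>M (N \<Otimes>\<^sub>M N))"
    unfolding h_def by measurable
  have h_int: "integrable (M \<Otimes>\<^sub>M (N \<Otimes>\<^sub>M N)) (\<lambda>(\<omega>, w). h \<omega> w)"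
    by (rule MNp.integrable_const_bound[where B=1]) (auto simp: h_def)
  define \<phi> where "\<phi> t = expectation (\<lambda>\<omega>. iexp (t \<bullet> Z \<omega>))" for t
  have \<phi>_meas [measurable]: "\<phi> \<in> borel_measurable borel"
    unfolding \<phi>_def by measurable
  have iexp_int: "integrable M (\<lambda>\<omega>. iexp (t \<bullet> Z \<omega>))" for t
    by (rule integrable_const_bound[where B=1]) auto
  have int_phi: "integrable (N \<Otimes>\<^sub>M N) (\<lambda>w. norm (\<phi> (fst w - snd w)))"
  proof -
    have "norm (\<phi> t) \<le> 1" for t
    proof -
      have "norm (\<phi> t) \<le> expectation (\<lambda>\<omega>. norm (iexp (t \<bullet> Z \<omega>)))"
        unfolding \<phi>_def by (rule integral_norm_bound)
      then show ?thesis by (simp add: prob_space)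
    qed
    then show ?thesis
      by (intro NN.integrable_const_bound[where B=1]) auto
  qed
  \<comment> \<open>The squared modulus of an average is a double average over u and v; in this form
    Fubini makes the characteristic function enter linearly, at u - v.\<close>
  have sq: "(\<integral>w. h \<omega> w \<partial>(N \<Otimes>\<^sub>M N)) = (\<integral>u. cos (u \<bullet> (Z \<omega> - z)) \<partial>N)\<^sup>2 + (\<integral>u. sin (u \<bullet> (Z \<omega> - z)) \<partial>N)\<^sup>2" for \<omega>
  proof -
    let ?c = "\<integral>u. cos (u \<bullet> (Z \<omega> - z)) \<partial>N" and ?s = "\<integral>u. sin (u \<bullet> (Z \<omega> - z)) \<partial>N"
    have ic: "integrable N (\<lambda>u. cos (u \<bullet> (Z \<omega> - z)))" "integrable N (\<lambda>u. sin (u \<bullet> (Z \<omega> - z)))"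
      by (rule N.integrable_const_bound[where B=1]; auto)+
    have "integrable (N \<Otimes>\<^sub>M N) (\<lambda>w. h \<omega> w)"
      unfolding h_def by (rule NN.integrable_const_bound[where B=1]) auto
    then have "(\<integral>w. h \<omega> w \<partial>(N \<Otimes>\<^sub>M N)) = (\<integral>u. (\<integral>v. h \<omega> (u, v) \<partial>N) \<partial>N)"
      by (rule NN.integral_fst'[symmetric])
    also have "\<dots> = (\<integral>u. cos (u \<bullet> (Z \<omega> - z)) * ?c + sin (u \<bullet> (Z \<omega> - z)) * ?s \<partial>N)"
      unfolding h_def fst_conv snd_conv inner_diff_left cos_diff using ic by simp
    also have "\<dots> = ?c\<^sup>2 + ?s\<^sup>2"
      using ic by (simp add: power2_eq_square)
    finally show ?thesis .
  qed
  have "prob {\<omega>\<in>space M. Z \<omega> = z} = expectation (indicator {\<omega>\<in>space M. Z \<omega> = z})"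
    by simp
  also have "\<dots> \<le> expectation (\<lambda>\<omega>. \<integral>w. h \<omega> w \<partial>(N \<Otimes>\<^sub>M N))"
  proof (rule integral_mono)
    show "integrable M (\<lambda>\<omega>. \<integral>w. h \<omega> w \<partial>(N \<Otimes>\<^sub>M N))"
      using MN.integrable_fst'[OF h_int] by simp
    fix \<omega> assume "\<omega> \<in> space M"
    show "indicator {\<omega>\<in>space M. Z \<omega> = z} \<omega> \<le> (\<integral>w. h \<omega> w \<partial>(N \<Otimes>\<^sub>M N))"
      unfolding sq by (cases "Z \<omega> = z") (auto simp: N.prob_space)
  qed (auto intro!: integrable_real_indicator simp: emeasure_eq_measure)
  also have "\<dots> = (\<integral>w. expectation (\<lambda>\<omega>. h \<omega> w) \<partial>(N \<Otimes>\<^sub>M N))"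
    by (rule MN.Fubini_integral[OF h_int, symmetric])
  also have "\<dots> \<le> (\<integral>w. norm (\<phi> (fst w - snd w)) \<partial>(N \<Otimes>\<^sub>M N))"
  proof (rule integral_mono)
    show "integrable (N \<Otimes>\<^sub>M N) (\<lambda>w. expectation (\<lambda>\<omega>. h \<omega> w))"
      by (rule MN.integrable_snd[OF h_int])
    show "integrable (N \<Otimes>\<^sub>M N) (\<lambda>w. norm (\<phi> (fst w - snd w)))"
      by (rule int_phi)
    fix w :: "'b \<times> 'b"
    let ?t = "fst w - snd w"
    have "expectation (\<lambda>\<omega>. h \<omega> w) = expectation (\<lambda>\<omega>. Re (iexp (- (?t \<bullet> z)) * iexp (?t \<bullet> Z \<omega>)))"
      unfolding h_def by (simp add: exp_add[symmetric] Re_exp algebra_simps inner_diff_right)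
    also have "\<dots> = Re (iexp (- (?t \<bullet> z)) * \<phi> ?t)"
      unfolding \<phi>_def using iexp_int by (subst integral_Re) auto
    also have "\<dots> \<le> norm (iexp (- (?t \<bullet> z)) * \<phi> ?t)"
      by (rule complex_Re_le_cmod)
    also have "\<dots> = norm (\<phi> ?t)"
      by (simp add: norm_mult)
    finally show "expectation (\<lambda>\<omega>. h \<omega> w) \<le> norm (\<phi> ?t)" .
  qed
  finally have "ennreal (prob {\<omega>\<in>space M. Z \<omega> = z}) \<le> ennreal (\<integral>w. norm (\<phi> (fst w - snd w)) \<partial>(N \<Otimes>\<^sub>M N))"
    by (rule ennreal_leI)
  also have "\<dots> = (\<integral>\<^sup>+w. norm (\<phi> (fst w - snd w)) \<partial>(N \<Otimes>\<^sub>M N))"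
    by (rule nn_integral_eq_integral[symmetric, OF int_phi]) auto
  also have "\<dots> = (\<integral>\<^sup>+v. (\<integral>\<^sup>+u. norm (\<phi> (u - v)) \<partial>N) \<partial>N)"
    using NN.nn_integral_snd[of "\<lambda>w. ennreal (norm (\<phi> (fst w - snd w)))"] by simp
  \<comment> \<open>For v in the ball, u - v stays in the ball of twice the radius, and translation
    invariance removes v. The bound on the inner integral is thus independent of v.\<close>
  also have "\<dots> \<le> (\<integral>\<^sup>+v. (\<integral>\<^sup>+t. ennreal (norm (\<phi> t)) * indicator (cball 0 (2 * r)) t \<partial>lborel) / emeasure lborel ?B \<partial>N)"
  proof (rule nn_integral_mono_AE)
    have "AE v in N. v \<in> ?B"
      unfolding N_def by (rule AE_uniform_measureI) auto
    then show "AE v in N. (\<integral>\<^sup>+u. norm (\<phi> (u - v)) \<partial>N)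
      \<le> (\<integral>\<^sup>+t. ennreal (norm (\<phi> t)) * indicator (cball 0 (2 * r)) t \<partial>lborel) / emeasure lborel ?B"
    proof eventually_elim
      fix v assume v: "v \<in> ?B"
      have "(\<integral>\<^sup>+u. norm (\<phi> (u - v)) \<partial>N) = (\<integral>\<^sup>+u. ennreal (norm (\<phi> (u - v))) * indicator ?B u \<partial>lborel) / emeasure lborel ?B"
        unfolding N_def by (rule nn_integral_uniform_measure) auto
      also have "\<dots> \<le> (\<integral>\<^sup>+u. ennreal (norm (\<phi> (u - v))) * indicator (cball 0 (2 * r)) (u - v) \<partial>lborel) / emeasure lborel ?B"
      proof (intro divide_right_mono_ennreal nn_integral_mono mult_left_mono)
        fix u
        show "indicator ?B u \<le> (indicator (cball 0 (2 * r)) (u - v) :: ennreal)"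
          using v norm_triangle_ineq4[of u v] by (auto simp: indicator_def)
      qed auto
      also have "(\<integral>\<^sup>+u. ennreal (norm (\<phi> (u - v))) * indicator (cball 0 (2 * r)) (u - v) \<partial>lborel)
          = (\<integral>\<^sup>+u. ennreal (norm (\<phi> (- v + u))) * indicator (cball 0 (2 * r)) (- v + u) \<partial>lborel)"
        by (simp only: uminus_add_conv_diff)
      also have "\<dots> = (\<integral>\<^sup>+t. ennreal (norm (\<phi> t)) * indicator (cball 0 (2 * r)) t \<partial>distr lborel borel (\<lambda>u. - v + u))"
        by (rule nn_integral_distr[symmetric]) measurable
      also have "distr lborel borel (\<lambda>u. - v + u) = (lborel :: 'b measure)"
        by (rule lborel_distr_plus)
      finally show "(\<integral>\<^sup>+u. norm (\<phi> (u - v)) \<partial>N)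
        \<le> (\<integral>\<^sup>+t. ennreal (norm (\<phi> t)) * indicator (cball 0 (2 * r)) t \<partial>lborel) / emeasure lborel ?B" .
    qed
  qed
  also have "\<dots> = (\<integral>\<^sup>+t. ennreal (norm (\<phi> t)) * indicator (cball 0 (2 * r)) t \<partial>lborel) / emeasure lborel ?B"
    by (simp add: N.emeasure_space_1)
  finally show ?thesis
    unfolding \<phi>_def .
qed

lemma nn_integral_lborel_scale:
  fixes f :: "'b::euclidean_space \<Rightarrow> ennreal"
  assumes [measurable]: "f \<in> borel_measurable borel" and c: "0 < c"
  shows "(\<integral>\<^sup>+t. f t \<partial>lborel) = ennreal (c ^ DIM('b)) * (\<integral>\<^sup>+s. f (c *\<^sub>R s) \<partial>lborel)"
proof -
  have "(\<integral>\<^sup>+t. f t \<partial>lborel) = (\<integral>\<^sup>+t. f t \<partial>density (distr lborel borel (\<lambda>x. 0 + c *\<^sub>R x)) (\<lambda>_. ennreal (\<bar>c\<bar> ^ DIM('b))))"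
    using lborel_affine[of c "0::'b"] c by simp
  also have "\<dots> = (\<integral>\<^sup>+s. ennreal (\<bar>c\<bar> ^ DIM('b)) * f (c *\<^sub>R s) \<partial>lborel)"
    by (simp add: nn_integral_density nn_integral_distr)
  also have "\<dots> = ennreal (c ^ DIM('b)) * (\<integral>\<^sup>+s. f (c *\<^sub>R s) \<partial>lborel)"
    using c by (simp add: nn_integral_cmult)
  finally show ?thesis .
qed

lemma nn_integral_gaussian_finite:
  fixes \<kappa> :: real
  assumes "0 < \<kappa>"
  shows "(\<integral>\<^sup>+s. ennreal (exp (- \<kappa> * (norm (s::'b::euclidean_space))\<^sup>2)) \<partial>lborel) < \<infinity>"
proof -
  have "(\<integral>\<^sup>+s. ennreal (exp (- \<kappa> * (norm (s::'b))\<^sup>2)) \<partial>lborel)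
      = (\<integral>\<^sup>+s. (\<Prod>b\<in>Basis. ennreal (exp (- \<kappa> * ((s::'b) \<bullet> b)\<^sup>2))) \<partial>lborel)"
  proof (intro nn_integral_cong)
    fix s :: 'b
    have "(norm s)\<^sup>2 = (\<Sum>b\<in>Basis. (s \<bullet> b)\<^sup>2)"
      unfolding power2_norm_eq_inner by (subst euclidean_inner) (simp add: power2_eq_square)
    then show "ennreal (exp (- \<kappa> * (norm s)\<^sup>2)) = (\<Prod>b\<in>Basis. ennreal (exp (- \<kappa> * (s \<bullet> b)\<^sup>2)))"
      by (simp add: prod_ennreal exp_sum[symmetric] sum_distrib_left sum_negf)
  qed
  also have "\<dots> = (\<Prod>b\<in>(Basis::'b set). \<integral>\<^sup>+x. ennreal (exp (- \<kappa> * x\<^sup>2)) \<partial>lborel)"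
    by (rule nn_integral_lborel_prod) auto
  also have "\<dots> < \<infinity>"
  proof -
    \<comment> \<open>Chosen so that the normal density has the exponent -kappa * x^2.\<close>
    define \<sigma> where "\<sigma> = sqrt (1 / (2 * \<kappa>))"
    have \<sigma>: "0 < \<sigma>" "\<sigma>\<^sup>2 = 1 / (2 * \<kappa>)"
      using assms by (auto simp: \<sigma>_def)
    have "integrable lborel (\<lambda>x. sqrt (2 * pi * \<sigma>\<^sup>2) * normal_density 0 \<sigma> x)"
      using \<sigma> by auto
    also have "(\<lambda>x. sqrt (2 * pi * \<sigma>\<^sup>2) * normal_density 0 \<sigma> x) = (\<lambda>x. exp (- \<kappa> * x\<^sup>2))"
      using assms \<sigma> by (auto simp: normal_density_def fun_eq_iff field_simps)
    finally have "(\<integral>\<^sup>+x. ennreal (exp (- \<kappa> * x\<^sup>2)) \<partial>lborel) < \<infinity>"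
      by (simp add: integrable_iff_bounded)
    then show ?thesis
      by (simp add: power_less_top_ennreal)
  qed
  finally show ?thesis .
qed

lemma to_real_vec_diff: "to_real_vec (a - b) = to_real_vec a - to_real_vec b"
  by (simp add: to_real_vec_def vec_eq_iff)

lemma to_real_vec_sum: "to_real_vec (\<Sum>j\<in>B. f j) = (\<Sum>j\<in>B. to_real_vec (f j))"
  by (simp add: to_real_vec_def vec_eq_iff)

lemma inj_to_real_vec: "to_real_vec a = to_real_vec b \<longleftrightarrow> a = b"
  by (simp add: to_real_vec_def vec_eq_iff)

context iid_walk
begin

lemma borel_measurable_X [measurable]: "(\<lambda>\<omega>. f (X i \<omega>)) \<in> borel_measurable M"
  by (rule measurable_compose[OF X_measurable]) simp

lemma expectation_X:
  fixes f :: "int ^ 'd \<Rightarrow> 'b::{banach, second_countable_topology}"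
  shows "expectation (\<lambda>\<omega>. f (X i \<omega>)) = expectation (\<lambda>\<omega>. f (X 0 \<omega>))"
proof -
  have "(\<integral>x. f x \<partial>distr M (count_space UNIV) (X i)) = (\<integral>x. f x \<partial>distr M (count_space UNIV) (X 0))"
    by (simp only: X_distr[of i])
  then show ?thesis
    by (simp add: integral_distr)
qed

lemma integrable_X_iff:
  fixes f :: "int ^ 'd \<Rightarrow> 'b::{banach, second_countable_topology}"
  shows "integrable M (\<lambda>\<omega>. f (X i \<omega>)) \<longleftrightarrow> integrable M (\<lambda>\<omega>. f (X 0 \<omega>))"
proof -
  have "integrable (distr M (count_space UNIV) (X i)) f \<longleftrightarrow> integrable (distr M (count_space UNIV) (X 0)) f"
    by (simp only: X_distr[of i])
  then show ?thesis
    by (simp add: integrable_distr_eq)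
qed

lemma indep_vars_X_borel:
  fixes f :: "nat \<Rightarrow> int ^ 'd \<Rightarrow> 'b::topological_space"
  shows "indep_vars (\<lambda>_. borel) (\<lambda>j \<omega>. f j (X j \<omega>)) I"
proof -
  have "indep_vars (\<lambda>_. count_space UNIV) X I"
    by (rule indep_vars_subset[OF X_indep]) auto
  then show ?thesis
    by (rule indep_vars_compose2) simp
qed

definition char_X :: "real ^ 'd \<Rightarrow> complex" where
  "char_X t = expectation (\<lambda>\<omega>. iexp (t \<bullet> to_real_vec (X 0 \<omega>)))"

text \<open>By \<open>norm_char_X_sq\<close> this is 1 - |char_X t|^2. Passing to X 1 - X 2 makes
  the quantity real and nonnegative, removes any drift, and matches the vectors whose span expresses
  genuine d-dimensionality.\<close>

definition char_defect :: "real ^ 'd \<Rightarrow> real" where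
  "char_defect t = expectation (\<lambda>\<omega>. 1 - cos (t \<bullet> to_real_vec (X 1 \<omega> - X 2 \<omega>)))"

lemma borel_measurable_X12 [measurable]: "(\<lambda>\<omega>. f (X 1 \<omega> - X 2 \<omega>)) \<in> borel_measurable M"
proof -
  have "(\<lambda>\<omega>. X 1 \<omega> - X 2 \<omega>) \<in> measurable M (count_space UNIV)"
    by (rule measurable_compose_countable[where g="X 2" and f="\<lambda>b \<omega>. X 1 \<omega> - b"]) auto
  from measurable_compose[OF this, of f borel] show ?thesis by simp
qed

lemma integrable_iexp_X: "integrable M (\<lambda>\<omega>. iexp (f (X i \<omega>)))"
  by (rule integrable_const_bound[where B=1]) auto

lemma char_walk: "expectation (\<lambda>\<omega>. iexp (t \<bullet> to_real_vec (walk X m \<omega>))) = char_X t ^ m"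
proof -
  have "expectation (\<lambda>\<omega>. iexp (t \<bullet> to_real_vec (walk X m \<omega>)))
      = expectation (\<lambda>\<omega>. \<Prod>j\<in>{1..m}. iexp (t \<bullet> to_real_vec (X j \<omega>)))"
    by (simp add: walk_def to_real_vec_sum inner_sum_right exp_sum[symmetric] sum_distrib_left of_real_sum)
  also have "\<dots> = (\<Prod>j\<in>{1..m}. expectation (\<lambda>\<omega>. iexp (t \<bullet> to_real_vec (X j \<omega>))))"
    by (rule indep_vars_lebesgue_integral)
      (auto intro!: indep_vars_X_borel[where f="\<lambda>_ x. iexp (t \<bullet> to_real_vec x)"] integrable_iexp_X[where f="\<lambda>x. t \<bullet> to_real_vec x"])
  also have "\<dots> = (\<Prod>j\<in>{1..m}. char_X t)"
    unfolding char_X_def by (intro prod.cong refl) (rule expectation_X[where f="\<lambda>x. iexp (t \<bullet> to_real_vec x)"])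
  finally show ?thesis by simp
qed

text \<open>The conjugate of \<open>char_X t\<close> is the characteristic function of -X 2, and
  independence turns the product into the characteristic function of X 1 - X 2, whose real part is a
  mean of cosines.\<close>

lemma norm_char_X_sq: "(norm (char_X t))\<^sup>2 = 1 - char_defect t"
proof -
  let ?f = "\<lambda>j x. if j = (1::nat) then iexp (t \<bullet> to_real_vec x) else iexp (- (t \<bullet> to_real_vec x))"
  have cos_int: "integrable M (\<lambda>\<omega>. cos (t \<bullet> to_real_vec (X 1 \<omega> - X 2 \<omega>)))"
    by (rule integrable_const_bound[where B=1]) auto
  have conj: "expectation (\<lambda>\<omega>. iexp (- (t \<bullet> to_real_vec (X 2 \<omega>)))) = cnj (char_X t)"
  proof -
    have "cnj (char_X t) = expectation (\<lambda>\<omega>. cnj (iexp (t \<bullet> to_real_vec (X 0 \<omega>))))"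
      unfolding char_X_def by (simp del: exp_cnj complex_cnj_mult)
    also have "\<dots> = expectation (\<lambda>\<omega>. iexp (- (t \<bullet> to_real_vec (X 0 \<omega>))))"
      by (simp add: exp_cnj)
    also have "\<dots> = expectation (\<lambda>\<omega>. iexp (- (t \<bullet> to_real_vec (X 2 \<omega>))))"
      by (rule expectation_X[symmetric, where f="\<lambda>x. iexp (- (t \<bullet> to_real_vec x))"])
    finally show ?thesis ..
  qed
  have "complex_of_real ((norm (char_X t))\<^sup>2) = char_X t * cnj (char_X t)"
    by (rule complex_norm_square)
  also have "\<dots> = expectation (\<lambda>\<omega>. iexp (t \<bullet> to_real_vec (X 1 \<omega>))) * expectation (\<lambda>\<omega>. iexp (- (t \<bullet> to_real_vec (X 2 \<omega>))))"
    unfolding conj char_X_def by (simp only: expectation_X[where f="\<lambda>x. iexp (t \<bullet> to_real_vec x)" and i=1])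
  also have "\<dots> = (\<Prod>j\<in>{1,2}. expectation (\<lambda>\<omega>. ?f j (X j \<omega>)))"
    by simp
  also have "\<dots> = expectation (\<lambda>\<omega>. \<Prod>j\<in>{1,2}. ?f j (X j \<omega>))"
  proof (rule indep_vars_lebesgue_integral[symmetric])
    show "integrable M (\<lambda>\<omega>. ?f j (X j \<omega>))" for j
      by (rule integrable_const_bound[where B=1]) auto
  qed (auto intro: indep_vars_X_borel)
  also have "\<dots> = expectation (\<lambda>\<omega>. iexp (t \<bullet> to_real_vec (X 1 \<omega> - X 2 \<omega>)))"
    by (simp add: exp_add[symmetric] to_real_vec_diff algebra_simps)
  finally have "(norm (char_X t))\<^sup>2 = Re (expectation (\<lambda>\<omega>. iexp (t \<bullet> to_real_vec (X 1 \<omega> - X 2 \<omega>))))"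
    by (metis Re_complex_of_real)
  also have "\<dots> = expectation (\<lambda>\<omega>. Re (iexp (t \<bullet> to_real_vec (X 1 \<omega> - X 2 \<omega>))))"
    by (rule integral_Re[symmetric]) (rule integrable_const_bound[where B=1], auto)
  also have "\<dots> = expectation (\<lambda>\<omega>. cos (t \<bullet> to_real_vec (X 1 \<omega> - X 2 \<omega>)))"
    by (simp add: Re_exp)
  also have "\<dots> = 1 - char_defect t"
    unfolding char_defect_def using cos_int by (simp add: prob_space)
  finally show ?thesis .
qed

lemma norm_char_X_power_le: "norm (char_X t ^ m) \<le> exp (- (real m / 2) * char_defect t)"
proof -
  have "(norm (char_X t))\<^sup>2 \<le> exp (- char_defect t)"
    using exp_ge_add_one_self[of "- char_defect t"] by (simp add: norm_char_X_sq)
  also have "\<dots> = (exp (- char_defect t / 2))\<^sup>2"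
    by (simp add: power2_eq_square exp_add[symmetric])
  finally have "norm (char_X t) \<le> exp (- char_defect t / 2)"
    by (rule power2_le_imp_le) simp
  then have "norm (char_X t) ^ m \<le> exp (- char_defect t / 2) ^ m"
    by (rule power_mono) simp
  also have "\<dots> = exp (- (real m / 2) * char_defect t)"
    by (simp add: exp_of_nat_mult[symmetric])
  finally show ?thesis
    by (simp add: norm_power)
qed

lemma char_defect_measurable [measurable]: "char_defect \<in> borel_measurable borel"
proof -
  have [measurable]: "(\<lambda>x. fst x \<bullet> to_real_vec (X 1 (snd x) - X 2 (snd x))) \<in> borel_measurable (borel \<Otimes>\<^sub>M M)"
    by measurable
  have "(\<lambda>(t, \<omega>). 1 - cos (t \<bullet> to_real_vec (X 1 \<omega> - X 2 \<omega>))) \<in> borel_measurable (borel \<Otimes>\<^sub>M M)"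
    by (simp add: case_prod_unfold)
  then show ?thesis
    unfolding char_defect_def by (rule borel_measurable_lebesgue_integral)
qed

text \<open>The bound for the integrand of \<open>concentration_le_char\<close> in the variable s =
  sqrt m * t. On this scale it has a Gaussian majorant independent of m.\<close>

definition gauss_profile :: "real \<Rightarrow> nat \<Rightarrow> real ^ 'd \<Rightarrow> real" where
  "gauss_profile \<rho> m s = exp (- (real m / 2) * char_defect (s /\<^sub>R sqrt m)) * indicator (cball 0 \<rho>) (s /\<^sub>R sqrt m)"

lemma gauss_profile_measurable [measurable]: "gauss_profile \<rho> m \<in> borel_measurable borel"
  unfolding gauss_profile_def by measurable

text \<open>Averaging over radius rho / 2 involves arguments of norm up to rho only. The
  substitution t = s / sqrt m has the Jacobian m^(-d/2), which is the rate sought.\<close>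

lemma hit_le_gauss_profile:
  assumes "0 < \<rho>" "0 < m"
  shows "ennreal (hit m z) \<le> ennreal (real m powr (- real CARD('d) / 2)) * (\<integral>\<^sup>+s. ennreal (gauss_profile \<rho> m s) \<partial>lborel)
    / emeasure lborel (cball (0 :: real ^ 'd) (\<rho> / 2))"
proof -
  have "{\<omega>\<in>space M. walk X m \<omega> = z} = {\<omega>\<in>space M. to_real_vec (walk X m \<omega>) = to_real_vec z}"
    by (simp add: inj_to_real_vec)
  then have "ennreal (hit m z) = ennreal (prob {\<omega>\<in>space M. to_real_vec (walk X m \<omega>) = to_real_vec z})"
    by (simp add: hit_def)
  also have "\<dots> \<le> (\<integral>\<^sup>+t. ennreal (norm (expectation (\<lambda>\<omega>. iexp (t \<bullet> to_real_vec (walk X m \<omega>))))) * indicator (cball 0 (2 * (\<rho> / 2))) t \<partial>lborel)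
      / emeasure lborel (cball (0 :: real ^ 'd) (\<rho> / 2))"
    by (rule concentration_le_char) (use assms measurable_compose[OF walk_measurable, of to_real_vec borel] in auto)
  also have "\<dots> \<le> (\<integral>\<^sup>+t. ennreal (exp (- (real m / 2) * char_defect t) * indicator (cball 0 \<rho>) t) \<partial>lborel)
      / emeasure lborel (cball (0 :: real ^ 'd) (\<rho> / 2))"
    unfolding char_walk using norm_char_X_power_le
    by (intro divide_right_mono_ennreal nn_integral_mono) (auto simp: indicator_def intro!: ennreal_leI)
  finally have bound: "ennreal (hit m z) \<le> (\<integral>\<^sup>+t. ennreal (exp (- (real m / 2) * char_defect t) * indicator (cball 0 \<rho>) t) \<partial>lborel)
      / emeasure lborel (cball (0 :: real ^ 'd) (\<rho> / 2))" .
  have scale: "(\<integral>\<^sup>+t. ennreal (exp (- (real m / 2) * char_defect t) * indicator (cball 0 \<rho>) t) \<partial>lborel)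
      = ennreal ((1 / sqrt m) ^ DIM(real ^ 'd)) * (\<integral>\<^sup>+s. ennreal (exp (- (real m / 2) * char_defect ((1 / sqrt m) *\<^sub>R s)) * indicator (cball 0 \<rho>) ((1 / sqrt m) *\<^sub>R s)) \<partial>lborel)"
  proof (rule nn_integral_lborel_scale[where c="1 / sqrt m" and
          f="\<lambda>t. ennreal (exp (- (real m / 2) * char_defect t) * indicator (cball 0 \<rho>) t)"])
    show "(\<lambda>t. ennreal (exp (- (real m / 2) * char_defect t) * indicator (cball 0 \<rho>) t)) \<in> borel_measurable borel"
      by measurable
  qed (use assms in simp)
  have "1 / sqrt m = real m powr (- 1 / 2)"
    using assms by (simp add: powr_minus_divide powr_half_sqrt)
  then have "(1 / sqrt m) ^ CARD('d) = (real m powr (- 1 / 2)) powr real CARD('d)"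
    using assms by (simp add: powr_realpow)
  then have pow: "(1 / sqrt m) ^ DIM(real ^ 'd) = real m powr (- real CARD('d) / 2)"
    by (simp add: powr_powr)
  show ?thesis
    using bound unfolding scale pow by (simp add: gauss_profile_def[abs_def] inverse_eq_divide)
qed

text \<open>Finitely many atoms of X 1 - X 2 already span the space. Their share of the defect is,
  near 0, at least a positive definite quadratic form, so heavy tails of the step do no
  harm.\<close>

lemma char_defect_ge:
  assumes "genuinely_d_dim M X"
  obtains \<kappa> \<rho> where "0 < \<kappa>" "0 < \<rho>" "\<And>t. norm t \<le> \<rho> \<Longrightarrow> \<kappa> * (norm t)\<^sup>2 \<le> char_defect t"
proof -
  let ?P = "\<lambda>z. prob {\<omega>\<in>space M. X 1 \<omega> - X 2 \<omega> = z}"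
  let ?V = "to_real_vec ` {z. ?P z > 0}"
  obtain B where B: "B \<subseteq> ?V" "independent B" "?V \<subseteq> span B"
    using maximal_independent_subset[of ?V] by blast
  have finB: "finite B"
    by (rule finiteI_independent[OF B(2)])
  have span: "span B = UNIV"
    using assms B(3) span_mono[OF B(3)] by (auto simp: genuinely_d_dim_def span_span)
  define f where "f t = (\<Sum>b\<in>B. (t \<bullet> b)\<^sup>2)" for t :: "real ^ 'd"
  have f_pos: "0 < f t" if "t \<noteq> 0" for t
  proof (rule ccontr)
    assume "\<not> 0 < f t"
    then have "f t = 0"
      unfolding f_def using sum_nonneg[of B "\<lambda>b. (t \<bullet> b)\<^sup>2"] by fastforce
    then have "\<forall>b\<in>B. orthogonal t b"
      using finB by (simp add: f_def sum_nonneg_eq_0_iff orthogonal_def)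
    then have "orthogonal t t"
      using orthogonal_to_span[of t B t] span by auto
    then show False using that by (simp add: orthogonal_self)
  qed
  have "continuous_on (sphere 0 1) f"
    unfolding f_def by (intro continuous_intros)
  moreover have "compact (sphere (0 :: real ^ 'd) 1)" "sphere (0 :: real ^ 'd) 1 \<noteq> {}"
    by auto
  ultimately obtain t0 where t0: "t0 \<in> sphere 0 1" "\<And>t. t \<in> sphere 0 1 \<Longrightarrow> f t0 \<le> f t"
    using continuous_attains_inf[of "sphere (0 :: real ^ 'd) 1" f] by metis
  \<comment> \<open>The minimum of the form on the unit sphere, that is, its smallest
    eigenvalue.\<close>
  define \<mu> where "\<mu> = f t0"
  have \<mu>: "0 < \<mu>"
    unfolding \<mu>_def using t0(1) by (intro f_pos) auto
  have f_ge: "\<mu> * (norm t)\<^sup>2 \<le> f t" for t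
  proof (cases "t = 0")
    case False
    have "f t = (norm t)\<^sup>2 * f (t /\<^sub>R norm t)"
      using False by (simp add: f_def sum_distrib_left power_mult_distrib field_simps)
    moreover have "\<mu> \<le> f (t /\<^sub>R norm t)"
      unfolding \<mu>_def using False by (intro t0(2)) simp
    ultimately show ?thesis
      by (metis mult.commute mult_left_mono zero_le_power2)
  qed (simp add: f_def)
  have B_ne: "B \<noteq> {}"
    using \<mu> by (auto simp: \<mu>_def f_def)
  define pr where "pr b = prob {\<omega>\<in>space M. to_real_vec (X 1 \<omega> - X 2 \<omega>) = b}" for b
  define \<delta> where "\<delta> = Min (pr ` B)"
  have pr_pos: "0 < pr b" if b: "b \<in> B" for b
  proof -
    obtain z where "b = to_real_vec z" "?P z > 0"
      using subsetD[OF B(1) b] by auto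
    then show ?thesis by (simp add: pr_def inj_to_real_vec)
  qed
  have \<delta>: "0 < \<delta>" "\<And>b. b \<in> B \<Longrightarrow> \<delta> \<le> pr b"
    using pr_pos finB B_ne by (auto simp: \<delta>_def)
  \<comment> \<open>Small enough that |t . b| <= 1 for every b in B, the range of
    \<open>one_minus_cos_ge\<close>.\<close>
  define \<rho> where "\<rho> = 1 / (1 + (\<Sum>b\<in>B. norm b))"
  have \<rho>: "0 < \<rho>"
    unfolding \<rho>_def by (intro divide_pos_pos add_pos_nonneg sum_nonneg) auto
  show thesis
  proof (rule that)
    show "0 < \<delta> / 4 * \<mu>" "0 < \<rho>"
      using \<delta> \<mu> \<rho> by auto
    fix t :: "real ^ 'd" assume t: "norm t \<le> \<rho>"
    have tb: "\<bar>t \<bullet> b\<bar> \<le> 1" if "b \<in> B" for b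
    proof -
      have "norm b \<le> (\<Sum>b\<in>B. norm b)"
        by (rule member_le_sum) (use that finB in auto)
      then have "norm t * norm b \<le> \<rho> * (1 + (\<Sum>b\<in>B. norm b))"
        using t \<rho> by (intro mult_mono) auto
      also have "\<dots> = 1"
        using \<rho> by (auto simp: \<rho>_def)
      finally show ?thesis
        using Cauchy_Schwarz_ineq2[of t b] by linarith
    qed
    let ?Y = "\<lambda>\<omega>. to_real_vec (X 1 \<omega> - X 2 \<omega>)"
    have "\<delta> / 4 * \<mu> * (norm t)\<^sup>2 \<le> \<delta> / 4 * f t"
      using f_ge[of t] \<delta> by (simp add: mult.assoc)
    also have "\<dots> = (\<Sum>b\<in>B. \<delta> * ((t \<bullet> b)\<^sup>2 / 4))"
      by (simp add: f_def sum_distrib_left)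
    also have "\<dots> \<le> (\<Sum>b\<in>B. pr b * (1 - cos (t \<bullet> b)))"
      using \<delta> tb by (intro sum_mono mult_mono one_minus_cos_ge) (auto simp: pr_def)
    also have "\<dots> = expectation (\<lambda>\<omega>. \<Sum>b\<in>B. indicator {\<omega>\<in>space M. ?Y \<omega> = b} \<omega> * (1 - cos (t \<bullet> b)))"
      by (subst Bochner_Integration.integral_sum)
        (auto simp: pr_def intro!: integrable_mult_left integrable_real_indicator simp: emeasure_eq_measure)
    also have "\<dots> \<le> expectation (\<lambda>\<omega>. 1 - cos (t \<bullet> ?Y \<omega>))"
    proof (rule integral_mono)
      show "integrable M (\<lambda>\<omega>. \<Sum>b\<in>B. indicator {\<omega>\<in>space M. ?Y \<omega> = b} \<omega> * (1 - cos (t \<bullet> b)))"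
        by (auto intro!: integrable_mult_left integrable_real_indicator simp: emeasure_eq_measure)
      show "integrable M (\<lambda>\<omega>. 1 - cos (t \<bullet> ?Y \<omega>))"
      proof (rule integrable_const_bound[where B=2])
        have "\<bar>1 - cos x\<bar> \<le> 2" for x :: real
          using cos_ge_minus_one[of x] cos_le_one[of x] by linarith
        then show "AE \<omega> in M. norm (1 - cos (t \<bullet> ?Y \<omega>)) \<le> 2"
          by simp
      qed measurable
      fix \<omega> assume "\<omega> \<in> space M"
      then have "(\<Sum>b\<in>B. indicator {\<omega>\<in>space M. ?Y \<omega> = b} \<omega> * (1 - cos (t \<bullet> b))) = (\<Sum>b\<in>B. if b = ?Y \<omega> then 1 - cos (t \<bullet> ?Y \<omega>) else 0)"
        by (intro sum.cong) (auto simp: indicator_def)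
      also have "\<dots> \<le> 1 - cos (t \<bullet> ?Y \<omega>)"
        using finB by (simp add: sum.delta)
      finally show "(\<Sum>b\<in>B. indicator {\<omega>\<in>space M. ?Y \<omega> = b} \<omega> * (1 - cos (t \<bullet> b))) \<le> 1 - cos (t \<bullet> ?Y \<omega>)" .
    qed
    finally show "\<delta> / 4 * \<mu> * (norm t)\<^sup>2 \<le> char_defect t"
      by (simp add: char_defect_def)
  qed
qed

text \<open>The rescaling cancels m against the quadratic lower bound. The resulting majorant gives
  the order m^(-d/2) in general and the domination needed for heavy tails.\<close>

lemma gauss_profile_le:
  assumes \<kappa>: "\<And>t. norm t \<le> \<rho> \<Longrightarrow> \<kappa> * (norm t)\<^sup>2 \<le> char_defect t" and "0 < m"
  shows "gauss_profile \<rho> m s \<le> exp (- (\<kappa> / 2) * (norm s)\<^sup>2)"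
proof (cases "s /\<^sub>R sqrt m \<in> cball 0 \<rho>")
  case True
  then have "\<kappa> * (norm (s /\<^sub>R sqrt m))\<^sup>2 \<le> char_defect (s /\<^sub>R sqrt m)"
    by (intro \<kappa>) simp
  moreover have "(norm (s /\<^sub>R sqrt m))\<^sup>2 = (norm s)\<^sup>2 / real m"
    using \<open>0 < m\<close> by (simp add: power_mult_distrib power_inverse field_simps)
  ultimately have "\<kappa> * ((norm s)\<^sup>2 / real m) \<le> char_defect (s /\<^sub>R sqrt m)"
    by simp
  then have "(real m / 2) * (\<kappa> * ((norm s)\<^sup>2 / real m)) \<le> (real m / 2) * char_defect (s /\<^sub>R sqrt m)"
    by (rule mult_left_mono) simp
  moreover have "(real m / 2) * (\<kappa> * ((norm s)\<^sup>2 / real m)) = (\<kappa> / 2) * (norm s)\<^sup>2"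
    using \<open>0 < m\<close> by simp
  ultimately show ?thesis
    using True by (simp add: gauss_profile_def)
qed (simp add: gauss_profile_def)

lemma hit_le_powr:
  assumes "genuinely_d_dim M X"
  obtains C where "0 < C" "\<And>m z. 1 \<le> m \<Longrightarrow> hit m z \<le> C * real m powr (- real CARD('d) / 2)"
proof -
  obtain \<kappa> \<rho> where \<kappa>: "0 < \<kappa>" "0 < \<rho>" "\<And>t. norm t \<le> \<rho> \<Longrightarrow> \<kappa> * (norm t)\<^sup>2 \<le> char_defect t"
    using char_defect_ge[OF assms] by blast
  define G where "G = (\<integral>\<^sup>+s. ennreal (exp (- (\<kappa> / 2) * (norm (s :: real ^ 'd))\<^sup>2)) \<partial>lborel)"
  define v where "v = emeasure lborel (cball (0 :: real ^ 'd) (\<rho> / 2))"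
  have "G < \<infinity>"
    unfolding G_def by (rule nn_integral_gaussian_finite) (use \<kappa> in simp)
  moreover have "v \<noteq> 0"
    unfolding v_def by (rule cball_volume) (use \<kappa> in simp)
  ultimately have fin: "G / v < \<infinity>"
    by (auto simp: ennreal_divide_eq_top_iff less_top[symmetric])
  show thesis
  proof (rule that)
    \<comment> \<open>The added 1 makes the constant strictly positive, since \<open>G / v\<close>
      enters only through its finiteness.\<close>
    show "0 < enn2real (G / v) + 1"
      by (simp add: add_nonneg_pos)
    fix m :: nat and z assume m: "1 \<le> m"
    let ?p = "real m powr (- real CARD('d) / 2)"
    have "ennreal (hit m z) \<le> ennreal ?p * (\<integral>\<^sup>+s. ennreal (gauss_profile \<rho> m s) \<partial>lborel) / v"
      unfolding v_def by (rule hit_le_gauss_profile) (use \<kappa> m in auto)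
    also have "\<dots> \<le> ennreal ?p * G / v"
      unfolding G_def using m
      by (intro divide_right_mono_ennreal mult_left_mono nn_integral_mono ennreal_leI gauss_profile_le \<kappa>) auto
    also have "\<dots> = ennreal ?p * (G / v)"
      by (simp add: ennreal_times_divide)
    also have "\<dots> = ennreal (?p * enn2real (G / v))"
      using fin by (simp add: ennreal_mult'')
    finally have "hit m z \<le> ?p * enn2real (G / v)"
      by (simp add: ennreal_le_iff)
    also have "\<dots> \<le> ?p * (enn2real (G / v) + 1)"
      by (intro mult_left_mono) auto
    finally show "hit m z \<le> (enn2real (G / v) + 1) * ?p"
      by (simp add: mult.commute)
  qed
qed

section \<open>Steps with infinite second moment\<close>

lemma char_defect_truncated:
  assumes "0 < m"
  shows "expectation (\<lambda>\<omega>. (s \<bullet> to_real_vec (X 1 \<omega> - X 2 \<omega>))\<^sup>2 * indicator {x. \<bar>x\<bar> \<le> sqrt m} (s \<bullet> to_real_vec (X 1 \<omega> - X 2 \<omega>))) / 4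
    \<le> real m * char_defect (s /\<^sub>R sqrt m)"
proof -
  let ?Y = "\<lambda>\<omega>. s \<bullet> to_real_vec (X 1 \<omega> - X 2 \<omega>)"
  have "expectation (\<lambda>\<omega>. (?Y \<omega>)\<^sup>2 * indicator {x. \<bar>x\<bar> \<le> sqrt m} (?Y \<omega>)) / 4
      = expectation (\<lambda>\<omega>. (?Y \<omega>)\<^sup>2 * indicator {x. \<bar>x\<bar> \<le> sqrt m} (?Y \<omega>) / 4)"
    by simp
  also have "\<dots> \<le> expectation (\<lambda>\<omega>. real m * (1 - cos ((s /\<^sub>R sqrt m) \<bullet> to_real_vec (X 1 \<omega> - X 2 \<omega>))))"
  proof (rule integral_mono')
    show "integrable M (\<lambda>\<omega>. real m * (1 - cos ((s /\<^sub>R sqrt m) \<bullet> to_real_vec (X 1 \<omega> - X 2 \<omega>))))"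
    proof (intro integrable_mult_right integrable_const_bound[where B=2])
      have "\<bar>1 - cos x\<bar> \<le> 2" for x :: real
        using cos_ge_minus_one[of x] cos_le_one[of x] by linarith
      then show "AE \<omega> in M. norm (1 - cos ((s /\<^sub>R sqrt m) \<bullet> to_real_vec (X 1 \<omega> - X 2 \<omega>))) \<le> 2"
        by simp
    qed measurable
    fix \<omega>
    show "0 \<le> real m * (1 - cos ((s /\<^sub>R sqrt m) \<bullet> to_real_vec (X 1 \<omega> - X 2 \<omega>)))"
      by simp
    show "(?Y \<omega>)\<^sup>2 * indicator {x. \<bar>x\<bar> \<le> sqrt m} (?Y \<omega>) / 4 \<le> real m * (1 - cos ((s /\<^sub>R sqrt m) \<bullet> to_real_vec (X 1 \<omega> - X 2 \<omega>)))"
    \<comment> \<open>Where |y| <= sqrt m, the quadratic bound for 1 - cos applies to y / sqrt m;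
      elsewhere the truncated left side is 0.\<close>
    proof (cases "\<bar>?Y \<omega>\<bar> \<le> sqrt m")
      case True
      then have "(?Y \<omega> / sqrt m)\<^sup>2 / 4 \<le> 1 - cos (?Y \<omega> / sqrt m)"
        using assms by (intro one_minus_cos_ge) (simp add: abs_divide)
      then have "real m * ((?Y \<omega> / sqrt m)\<^sup>2 / 4) \<le> real m * (1 - cos (?Y \<omega> / sqrt m))"
        by (rule mult_left_mono) simp
      moreover have "real m * ((?Y \<omega> / sqrt m)\<^sup>2 / 4) = (?Y \<omega>)\<^sup>2 / 4"
        using assms by (simp add: power_divide)
      moreover have "(s /\<^sub>R sqrt m) \<bullet> to_real_vec (X 1 \<omega> - X 2 \<omega>) = ?Y \<omega> / sqrt m"
        by (simp add: divide_inverse_commute)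
      ultimately show ?thesis
        using True by (simp only: indicator_simps mem_Collect_eq if_True mult_1_right simp_thms)
    qed simp
  qed
  also have "\<dots> = real m * char_defect (s /\<^sub>R sqrt m)"
    by (simp add: char_defect_def)
  finally show ?thesis .
qed

lemma truncated_second_moment_at_top:
  fixes f :: "'a \<Rightarrow> real"
  assumes [measurable]: "f \<in> borel_measurable M" and "\<not> integrable M (\<lambda>\<omega>. (f \<omega>)\<^sup>2)"
  shows "filterlim (\<lambda>m. expectation (\<lambda>\<omega>. (f \<omega>)\<^sup>2 * indicator {x. \<bar>x\<bar> \<le> sqrt (real m)} (f \<omega>))) at_top sequentially"
proof -
  define h where "h m \<omega> = (f \<omega>)\<^sup>2 * indicator {x. \<bar>x\<bar> \<le> sqrt (real m)} (f \<omega>)" for m :: nat and \<omega>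
  have h_meas [measurable]: "h m \<in> borel_measurable M" for m
    unfolding h_def by measurable
  have h_mono: "h m \<omega> \<le> h n \<omega>" if "m \<le> n" for m n \<omega>
    using that order_trans[of "\<bar>f \<omega>\<bar>" "sqrt (real m)" "sqrt (real n)"] by (auto simp: h_def indicator_def)
  have h_nonneg: "0 \<le> h m \<omega>" for m \<omega>
    by (simp add: h_def)
  have h_int: "integrable M (h m)" for m
  proof (rule integrable_const_bound[where B="real m"])
    have "h m \<omega> \<le> real m" for \<omega>
    proof (cases "\<bar>f \<omega>\<bar> \<le> sqrt (real m)")
      case True
      then have "\<bar>f \<omega>\<bar>\<^sup>2 \<le> (sqrt (real m))\<^sup>2"
        by (rule power_mono) simp
      then show ?thesis using True by (simp add: h_def)
    qed (simp add: h_def)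
    then show "AE \<omega> in M. norm (h m \<omega>) \<le> real m"
      using h_nonneg by simp
  qed measurable
  have sup: "(SUP m. ennreal (h m \<omega>)) = ennreal ((f \<omega>)\<^sup>2)" for \<omega>
  proof (rule antisym)
    show "(SUP m. ennreal (h m \<omega>)) \<le> ennreal ((f \<omega>)\<^sup>2)"
      by (intro SUP_least ennreal_leI) (auto simp: h_def indicator_def)
    obtain m :: nat where "(f \<omega>)\<^sup>2 \<le> real m"
      using real_arch_simple by blast
    then have "sqrt ((f \<omega>)\<^sup>2) \<le> sqrt (real m)"
      by (rule real_sqrt_le_mono)
    then have "ennreal ((f \<omega>)\<^sup>2) = ennreal (h m \<omega>)"
      by (simp add: h_def)
    also have "\<dots> \<le> (SUP m. ennreal (h m \<omega>))"
      by (rule SUP_upper) simp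
    finally show "ennreal ((f \<omega>)\<^sup>2) \<le> (SUP m. ennreal (h m \<omega>))" .
  qed
  have "(\<integral>\<^sup>+\<omega>. ennreal ((f \<omega>)\<^sup>2) \<partial>M) = \<infinity>"
    using assms by (auto simp: integrable_iff_bounded less_top[symmetric])
  also have "(\<integral>\<^sup>+\<omega>. ennreal ((f \<omega>)\<^sup>2) \<partial>M) = (SUP m. \<integral>\<^sup>+\<omega>. ennreal (h m \<omega>) \<partial>M)"
    unfolding sup[symmetric]
    by (rule nn_integral_monotone_convergence_SUP) (auto intro!: incseq_SucI le_funI ennreal_leI h_mono)
  finally have top: "(SUP m. \<integral>\<^sup>+\<omega>. ennreal (h m \<omega>) \<partial>M) = \<infinity>" .
  show ?thesis
    unfolding filterlim_at_top h_def[symmetric]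
  proof
    fix Z :: real
    have "ennreal Z < (SUP m. \<integral>\<^sup>+\<omega>. ennreal (h m \<omega>) \<partial>M)"
      unfolding top by simp
    then obtain m where "ennreal Z < (\<integral>\<^sup>+\<omega>. ennreal (h m \<omega>) \<partial>M)"
      by (auto simp: less_SUP_iff)
    also have "\<dots> = ennreal (expectation (h m))"
      using h_nonneg by (intro nn_integral_eq_integral h_int) auto
    finally have "ennreal Z < ennreal (expectation (h m))" .
    have m: "Z \<le> expectation (h m)"
    proof (cases "0 \<le> Z")
      case True
      with \<open>ennreal Z < ennreal (expectation (h m))\<close> show ?thesis
        by (simp add: ennreal_less_iff)
    next
      case False
      moreover have "0 \<le> expectation (h m)"
        by (simp add: h_nonneg)
      ultimately show ?thesis by linarith
    qed
    show "\<forall>\<^sub>F m in sequentially. Z \<le> expectation (h m)"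
      using eventually_ge_at_top[of m]
    proof eventually_elim
      case (elim n)
      then have "expectation (h m) \<le> expectation (h n)"
        by (intro integral_mono h_int h_mono)
      then show ?case using m by simp
    qed
  qed
qed

text \<open>Some atom z of X 2 has positive probability. On that event X 1 - X 2 is X 1 - z, and
  independence transfers square integrability from the difference to X 1 - z.\<close>

lemma integrable_of_projections:
  assumes "\<And>s. integrable M (\<lambda>\<omega>. (s \<bullet> to_real_vec (X 1 \<omega> - X 2 \<omega>))\<^sup>2)"
  shows "integrable M (\<lambda>\<omega>. (norm (to_real_vec (X 0 \<omega>)))\<^sup>2)"
proof -
  let ?Y = "\<lambda>\<omega>. to_real_vec (X 1 \<omega> - X 2 \<omega>)"
  have "integrable M (\<lambda>\<omega>. \<Sum>b\<in>Basis. (b \<bullet> ?Y \<omega>)\<^sup>2)"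
    using assms by simp
  moreover have "(\<Sum>b\<in>Basis. (b \<bullet> y)\<^sup>2) = (norm y)\<^sup>2" for y :: "real ^ 'd"
    unfolding power2_norm_eq_inner euclidean_inner[of y y] by (simp add: power2_eq_square inner_commute)
  ultimately have "integrable M (\<lambda>\<omega>. (norm (?Y \<omega>))\<^sup>2)"
    by simp
  then have finY: "(\<integral>\<^sup>+\<omega>. ennreal ((norm (?Y \<omega>))\<^sup>2) \<partial>M) < \<infinity>"
    by (simp add: integrable_iff_bounded)
  obtain z where z: "0 < prob {\<omega>\<in>space M. X 2 \<omega> = z}"
  proof (rule ccontr)
    assume "\<not> thesis"
    then have "prob {\<omega>\<in>space M. X 2 \<omega> = z} = 0" for z
      using that measure_nonneg[of M "{\<omega>\<in>space M. X 2 \<omega> = z}"] by (metis less_eq_real_def)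
    then have "emeasure M (\<Union>z\<in>UNIV. {\<omega>\<in>space M. X 2 \<omega> = z}) = 0"
      by (subst emeasure_UN_countable) (auto simp: disjoint_family_on_def emeasure_eq_measure)
    moreover have "(\<Union>z\<in>UNIV. {\<omega>\<in>space M. X 2 \<omega> = z}) = space M"
      by auto
    ultimately show False
      by (simp add: emeasure_space_1)
  qed
  let ?f = "\<lambda>j x. if j = (1::nat) then ennreal ((norm (to_real_vec x - to_real_vec z))\<^sup>2) else indicator {z} x"
  have "(\<integral>\<^sup>+\<omega>. (\<Prod>j\<in>{1, 2}. ?f j (X j \<omega>)) \<partial>M) = (\<Prod>j\<in>{1, 2}. \<integral>\<^sup>+\<omega>. ?f j (X j \<omega>) \<partial>M)"
    by (rule indep_vars_nn_integral) (auto intro: indep_vars_X_borel)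
  also have "\<dots> = (\<integral>\<^sup>+\<omega>. ennreal ((norm (to_real_vec (X 1 \<omega>) - to_real_vec z))\<^sup>2) \<partial>M) * (\<integral>\<^sup>+\<omega>. indicator {z} (X 2 \<omega>) \<partial>M)"
    by simp
  also have "(\<integral>\<^sup>+\<omega>. indicator {z} (X 2 \<omega>) \<partial>M) = (\<integral>\<^sup>+\<omega>. indicator {\<omega>\<in>space M. X 2 \<omega> = z} \<omega> \<partial>M)"
    by (intro nn_integral_cong) (auto simp: indicator_def)
  also have "\<dots> = ennreal (prob {\<omega>\<in>space M. X 2 \<omega> = z})"
    by (simp add: emeasure_eq_measure)
  finally have eq: "(\<integral>\<^sup>+\<omega>. (\<Prod>j\<in>{1, 2}. ?f j (X j \<omega>)) \<partial>M)
    = (\<integral>\<^sup>+\<omega>. ennreal ((norm (to_real_vec (X 1 \<omega>) - to_real_vec z))\<^sup>2) \<partial>M) * ennreal (prob {\<omega>\<in>space M. X 2 \<omega> = z})" .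
  have "(\<integral>\<^sup>+\<omega>. (\<Prod>j\<in>{1, 2}. ?f j (X j \<omega>)) \<partial>M) \<le> (\<integral>\<^sup>+\<omega>. ennreal ((norm (?Y \<omega>))\<^sup>2) \<partial>M)"
    by (intro nn_integral_mono) (auto simp: to_real_vec_diff indicator_def)
  also note finY
  finally have "(\<integral>\<^sup>+\<omega>. ennreal ((norm (to_real_vec (X 1 \<omega>) - to_real_vec z))\<^sup>2) \<partial>M) < \<infinity>"
    using z unfolding eq by (auto simp: ennreal_mult_less_top)
  then have int: "integrable M (\<lambda>\<omega>. (norm (to_real_vec (X 1 \<omega>) - to_real_vec z))\<^sup>2)"
    using borel_measurable_X[of "\<lambda>x. (norm (to_real_vec x - to_real_vec z))\<^sup>2" 1] by (intro integrableI_bounded) auto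
  have "integrable M (\<lambda>\<omega>. (norm (to_real_vec (X 1 \<omega>)))\<^sup>2)"
  proof (rule Bochner_Integration.integrable_bound)
    show "integrable M (\<lambda>\<omega>. 2 * (norm (to_real_vec (X 1 \<omega>) - to_real_vec z))\<^sup>2 + 2 * (norm (to_real_vec z))\<^sup>2)"
      using int by simp
    have "(norm x)\<^sup>2 \<le> 2 * (norm (x - y))\<^sup>2 + 2 * (norm y)\<^sup>2" for x y :: "real ^ 'd"
    proof -
      have "norm x \<le> norm (x - y) + norm y"
        using norm_triangle_ineq[of "x - y" y] by simp
      then have "(norm x)\<^sup>2 \<le> (norm (x - y) + norm y)\<^sup>2"
        by (rule power_mono) simp
      also have "\<dots> \<le> 2 * (norm (x - y))\<^sup>2 + 2 * (norm y)\<^sup>2"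
        using sum_squares_bound[of "norm (x - y)" "norm y"] by (simp add: power2_sum)
      finally show ?thesis .
    qed
    then show "AE \<omega> in M. norm ((norm (to_real_vec (X 1 \<omega>)))\<^sup>2)
      \<le> norm (2 * (norm (to_real_vec (X 1 \<omega>) - to_real_vec z))\<^sup>2 + 2 * (norm (to_real_vec z))\<^sup>2)"
      by (simp add: abs_of_nonneg)
  qed (rule borel_measurable_X)
  then show ?thesis
    by (simp only: integrable_X_iff[where f="\<lambda>x. (norm (to_real_vec x))\<^sup>2" and i=1])
qed

text \<open>The second moment may diverge in some directions only. Directions with a finite second
  moment form a subspace, proper by \<open>integrable_of_projections\<close> and therefore Lebesgue
  null; dominated convergence asks for no more.\<close>

lemma AE_projection_not_integrable:
  assumes "\<not> integrable M (\<lambda>\<omega>. (norm (to_real_vec (X 0 \<omega>)))\<^sup>2)"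
  shows "AE s in lborel. \<not> integrable M (\<lambda>\<omega>. (s \<bullet> to_real_vec (X 1 \<omega> - X 2 \<omega>))\<^sup>2)"
proof -
  let ?Y = "\<lambda>\<omega>. to_real_vec (X 1 \<omega> - X 2 \<omega>)"
  define V where "V = {s. integrable M (\<lambda>\<omega>. (s \<bullet> ?Y \<omega>)\<^sup>2)}"
  have sub: "subspace V"
  proof (rule subspaceI)
    show "0 \<in> V" by (simp add: V_def)
    show "x + y \<in> V" if "x \<in> V" "y \<in> V" for x y
    proof -
      have "integrable M (\<lambda>\<omega>. 2 * (x \<bullet> ?Y \<omega>)\<^sup>2 + 2 * (y \<bullet> ?Y \<omega>)\<^sup>2)"
        using that by (simp add: V_def)
      moreover have "(\<lambda>\<omega>. ((x + y) \<bullet> ?Y \<omega>)\<^sup>2) \<in> borel_measurable M"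
        by measurable
      moreover have "norm (((x + y) \<bullet> ?Y \<omega>)\<^sup>2) \<le> norm (2 * (x \<bullet> ?Y \<omega>)\<^sup>2 + 2 * (y \<bullet> ?Y \<omega>)\<^sup>2)" for \<omega>
      proof -
        have "(a + b)\<^sup>2 \<le> 2 * a\<^sup>2 + 2 * b\<^sup>2" for a b :: real
          using sum_squares_bound[of a b] by (simp add: power2_sum)
        from this[of "x \<bullet> ?Y \<omega>" "y \<bullet> ?Y \<omega>"] show ?thesis
          by (simp add: inner_add_left)
      qed
      ultimately show ?thesis
        unfolding V_def by (auto intro: Bochner_Integration.integrable_bound)
    qed
    show "c *\<^sub>R x \<in> V" if "x \<in> V" for c x
      using that by (simp add: V_def power_mult_distrib)
  qed
  have "V \<noteq> UNIV"
    using integrable_of_projections assms by (auto simp: V_def)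
  then have "dim V \<noteq> DIM(real ^ 'd)"
    using sub by (metis dim_eq_full span_eq_iff)
  then have "dim V < DIM(real ^ 'd)"
    using dim_subset_UNIV[of V] by linarith
  then have "V \<in> null_sets lebesgue"
    by (simp add: negligible_lowdim negligible_iff_null_sets[symmetric])
  moreover have "V \<in> sets lborel"
    using closed_subspace[OF sub] by simp
  ultimately have "V \<in> null_sets lborel"
    by (simp add: null_sets_completion_iff)
  then have "AE s in lborel. s \<notin> V"
    by (rule AE_not_in)
  then show ?thesis
    by (simp add: V_def)
qed

text \<open>Dominated convergence in the rescaled Fourier integral: for almost every s the exponent
  diverges with the truncated second moment of the projection on s, and the Gaussian majorant does
  not depend on m.\<close>

lemma hit_zero_small_heavy_tail:
  assumes gen: "genuinely_d_dim M X" and ninf: "\<not> integrable M (\<lambda>\<omega>. (norm (to_real_vec (X 0 \<omega>)))\<^sup>2)"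
  shows "(\<lambda>m. real m powr (real CARD('d) / 2) * hit m 0) \<longlonglongrightarrow> 0"
proof -
  obtain \<kappa> \<rho> where \<kappa>: "0 < \<kappa>" "0 < \<rho>" "\<And>t. norm t \<le> \<rho> \<Longrightarrow> \<kappa> * (norm t)\<^sup>2 \<le> char_defect t"
    using char_defect_ge[OF gen] by blast
  define \<Gamma> where "\<Gamma> m = (\<integral>\<^sup>+s. ennreal (gauss_profile \<rho> m s) \<partial>lborel)" for m
  define v where "v = emeasure lborel (cball (0 :: real ^ 'd) (\<rho> / 2))"
  have v: "v \<noteq> 0"
    unfolding v_def by (rule cball_volume) (use \<kappa> in simp)
  \<comment> \<open>The shift to \<open>Suc m\<close> keeps the scale sqrt m positive, as the
    majorant requires.\<close>
  have pointwise: "AE s in lborel. (\<lambda>m. ennreal (gauss_profile \<rho> (Suc m) s)) \<longlonglongrightarrow> 0"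
    using AE_projection_not_integrable[OF ninf]
  proof eventually_elim
    fix s :: "real ^ 'd"
    assume s: "\<not> integrable M (\<lambda>\<omega>. (s \<bullet> to_real_vec (X 1 \<omega> - X 2 \<omega>))\<^sup>2)"
    let ?A = "\<lambda>m. expectation (\<lambda>\<omega>. (s \<bullet> to_real_vec (X 1 \<omega> - X 2 \<omega>))\<^sup>2 * indicator {x. \<bar>x\<bar> \<le> sqrt (real m)} (s \<bullet> to_real_vec (X 1 \<omega> - X 2 \<omega>)))"
    have "filterlim ?A at_top sequentially"
      by (rule truncated_second_moment_at_top[OF borel_measurable_X12[where f="\<lambda>y. s \<bullet> to_real_vec y"] s])
    \<comment> \<open>1/8 is the 1/2 in the exponent of the profile times the 1/4 of
      \<open>char_defect_truncated\<close>.\<close>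
    then have "filterlim (\<lambda>m. 1 / 8 * ?A m) at_top sequentially"
      by (intro filterlim_tendsto_pos_mult_at_top[OF tendsto_const]) auto
    then have "((\<lambda>m. exp (- (1 / 8 * ?A m))) \<longlongrightarrow> 0) sequentially"
      by (intro filterlim_compose[OF exp_at_bot] filterlim_compose[OF filterlim_uminus_at_bot_at_top])
    then have lim: "(\<lambda>m. exp (- (1 / 8 * ?A (Suc m)))) \<longlonglongrightarrow> 0"
      by (rule LIMSEQ_Suc)
    have "(\<lambda>m. gauss_profile \<rho> (Suc m) s) \<longlonglongrightarrow> 0"
    proof (rule tendsto_sandwich[OF _ _ tendsto_const lim])
      show "\<forall>\<^sub>F m in sequentially. 0 \<le> gauss_profile \<rho> (Suc m) s"
        by (simp add: gauss_profile_def)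
      have "gauss_profile \<rho> (Suc m) s \<le> exp (- (1 / 8 * ?A (Suc m)))" for m
      proof -
        have "gauss_profile \<rho> (Suc m) s \<le> exp (- (real (Suc m) / 2) * char_defect (s /\<^sub>R sqrt (Suc m)))"
          by (simp add: gauss_profile_def indicator_def)
        also have "\<dots> \<le> exp (- (1 / 8 * ?A (Suc m)))"
          using char_defect_truncated[of "Suc m" s] by simp
        finally show ?thesis .
      qed
      then show "\<forall>\<^sub>F m in sequentially. gauss_profile \<rho> (Suc m) s \<le> exp (- (1 / 8 * ?A (Suc m)))"
        by simp
    qed
    then show "(\<lambda>m. ennreal (gauss_profile \<rho> (Suc m) s)) \<longlonglongrightarrow> 0"
      by (subst ennreal_tendsto_0_iff) (auto simp: gauss_profile_def)
  qed
  have "(\<lambda>m. \<Gamma> (Suc m)) \<longlonglongrightarrow> (\<integral>\<^sup>+(s::real ^ 'd). 0 \<partial>lborel)"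
    unfolding \<Gamma>_def
  proof (rule nn_integral_dominated_convergence[where w="\<lambda>s. ennreal (exp (- (\<kappa> / 2) * (norm s)\<^sup>2))"])
    show "AE s in lborel. ennreal (gauss_profile \<rho> (Suc m) s) \<le> ennreal (exp (- (\<kappa> / 2) * (norm s)\<^sup>2))" for m
      by (intro AE_I2 ennreal_leI gauss_profile_le \<kappa>) auto
    show "(\<integral>\<^sup>+(s::real ^ 'd). ennreal (exp (- (\<kappa> / 2) * (norm s)\<^sup>2)) \<partial>lborel) < \<infinity>"
      by (rule nn_integral_gaussian_finite) (use \<kappa> in simp)
  qed (use pointwise in auto)
  then have "(\<lambda>m. inverse v * \<Gamma> (Suc m)) \<longlonglongrightarrow> inverse v * 0"
    using v by (intro ennreal_tendsto_cmult) (auto simp: less_top[symmetric])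
  then have lim: "(\<lambda>m. \<Gamma> (Suc m) / v) \<longlonglongrightarrow> 0"
    by (simp add: divide_ennreal_def mult.commute)
  have "(\<lambda>m. ennreal (real (Suc m) powr (real CARD('d) / 2) * hit (Suc m) 0)) \<longlonglongrightarrow> 0"
  proof (rule tendsto_sandwich[OF _ _ tendsto_const lim])
    have "ennreal (real (Suc m) powr (real CARD('d) / 2) * hit (Suc m) 0) \<le> \<Gamma> (Suc m) / v" for m
    proof -
      let ?p = "real (Suc m) powr (real CARD('d) / 2)" and ?p' = "real (Suc m) powr (- real CARD('d) / 2)"
      have "ennreal (?p * hit (Suc m) 0) = ennreal ?p * ennreal (hit (Suc m) 0)"
        by (simp add: ennreal_mult'')
      also have "\<dots> \<le> ennreal ?p * (ennreal ?p' * \<Gamma> (Suc m) / v)"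
        unfolding \<Gamma>_def v_def by (intro mult_left_mono hit_le_gauss_profile) (use \<kappa> in auto)
      also have "\<dots> = ennreal (?p * ?p') * (\<Gamma> (Suc m) / v)"
        by (simp add: ennreal_mult ennreal_times_divide mult.assoc)
      also have "?p * ?p' = 1"
        by (simp add: powr_add[symmetric])
      finally show ?thesis by simp
    qed
    then show "\<forall>\<^sub>F m in sequentially. ennreal (real (Suc m) powr (real CARD('d) / 2) * hit (Suc m) 0) \<le> \<Gamma> (Suc m) / v"
      by simp
  qed auto
  then have "(\<lambda>m. real (Suc m) powr (real CARD('d) / 2) * hit (Suc m) 0) \<longlonglongrightarrow> 0"
    by (subst (asm) ennreal_tendsto_0_iff) auto
  then show ?thesis
    by (rule LIMSEQ_imp_Suc)
qed

end

section \<open>Walks with drift\<close>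

context iid_walk
begin

text \<open>Once the first block sum is given, the second block must hit one prescribed point, with
  probability at most q.\<close>

lemma prob_split_concentration:
  assumes "finite B" "finite C" "B \<inter> C = {}" and q: "\<And>x. hit (card C) x \<le> q"
  shows "prob {\<omega>\<in>space M. block_sum (B \<union> C) \<omega> = z \<and> block_sum B \<omega> \<in> A} \<le> q * prob {\<omega>\<in>space M. block_sum B \<omega> \<in> A}"
proof -
  have q0: "0 \<le> q"
    using order_trans[OF hit_nonneg q] .
  have total: "(\<integral>\<^sup>+x. ennreal (prob {\<omega>\<in>space M. block_sum B \<omega> = x}) * indicator A x \<partial>count_space UNIV)
      = emeasure M {\<omega>\<in>space M. block_sum B \<omega> \<in> A}"
  proof -
    have "{\<omega>\<in>space M. block_sum B \<omega> \<in> A} = (\<Union>x\<in>A. {\<omega>\<in>space M. block_sum B \<omega> = x})"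
      by auto
    also have "emeasure M \<dots> = (\<integral>\<^sup>+x. emeasure M {\<omega>\<in>space M. block_sum B \<omega> = x} \<partial>count_space A)"
      by (rule emeasure_UN_countable) (auto simp: disjoint_family_on_def)
    finally show ?thesis
      by (simp add: nn_integral_count_space_indicator emeasure_eq_measure)
  qed
  have "emeasure M {\<omega>\<in>space M. block_sum (B \<union> C) \<omega> = z \<and> block_sum B \<omega> \<in> A}
      = (\<integral>\<^sup>+x. ennreal (prob {\<omega>\<in>space M. block_sum B \<omega> = x} * hit (card C) (z - x)) * indicator A x \<partial>count_space UNIV)"
    using emeasure_two_blocks_eq[OF assms(1-3), of z A] assms(2) by (simp add: prob_block_sum)
  also have "\<dots> \<le> (\<integral>\<^sup>+x. ennreal q * (ennreal (prob {\<omega>\<in>space M. block_sum B \<omega> = x}) * indicator A x) \<partial>count_space UNIV)"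
  proof (rule nn_integral_mono)
    fix x
    have "prob {\<omega>\<in>space M. block_sum B \<omega> = x} * hit (card C) (z - x) \<le> prob {\<omega>\<in>space M. block_sum B \<omega> = x} * q"
      by (intro mult_left_mono q) simp
    then have "ennreal (prob {\<omega>\<in>space M. block_sum B \<omega> = x} * hit (card C) (z - x)) \<le> ennreal q * ennreal (prob {\<omega>\<in>space M. block_sum B \<omega> = x})"
      using q0 by (simp add: ennreal_mult[symmetric] ennreal_leI mult.commute)
    then show "ennreal (prob {\<omega>\<in>space M. block_sum B \<omega> = x} * hit (card C) (z - x)) * indicator A x
      \<le> ennreal q * (ennreal (prob {\<omega>\<in>space M. block_sum B \<omega> = x}) * indicator A x)"
      by (auto simp: indicator_def)
  qed
  also have "\<dots> = ennreal q * emeasure M {\<omega>\<in>space M. block_sum B \<omega> \<in> A}"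
    by (subst nn_integral_cmult) (simp_all add: total)
  finally show ?thesis
    using q0 by (simp add: emeasure_eq_measure ennreal_mult[symmetric])
qed

text \<open>One coordinate is enough, because a nonzero mean has a nonzero coordinate. Centred steps
  are uncorrelated, so the variances sigma of that coordinate add up.\<close>

lemma chebyshev_block_sum:
  fixes i :: 'd
  assumes int2: "integrable M (\<lambda>\<omega>. (norm (to_real_vec (X 0 \<omega>)))\<^sup>2)" and "finite B" and "0 < a"
  defines "\<mu> \<equiv> expectation (\<lambda>\<omega>. to_real_vec (X 0 \<omega>) $ i)"
  defines "\<sigma> \<equiv> expectation (\<lambda>\<omega>. (to_real_vec (X 0 \<omega>) $ i - \<mu>)\<^sup>2)"
  shows "prob {\<omega>\<in>space M. a \<le> \<bar>to_real_vec (block_sum B \<omega>) $ i - real (card B) * \<mu>\<bar>} \<le> real (card B) * \<sigma> / a\<^sup>2"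
proof -
  define \<xi> where "\<xi> x = to_real_vec x $ i - \<mu>" for x :: "int ^ 'd"
  have comp2: "integrable M (\<lambda>\<omega>. (to_real_vec (X 0 \<omega>) $ i)\<^sup>2)"
  proof (rule Bochner_Integration.integrable_bound[OF int2])
    have "(x $ i)\<^sup>2 \<le> (norm x)\<^sup>2" for x :: "real ^ 'd"
      using power_mono[OF component_le_norm_cart[of x i], of 2] by simp
    then show "AE \<omega> in M. norm ((to_real_vec (X 0 \<omega>) $ i)\<^sup>2) \<le> norm ((norm (to_real_vec (X 0 \<omega>)))\<^sup>2)"
      by simp
  qed (rule borel_measurable_X)
  have comp1: "integrable M (\<lambda>\<omega>. to_real_vec (X 0 \<omega>) $ i)"
    by (rule square_integrable_imp_integrable[OF borel_measurable_X comp2])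
  have \<xi>1: "integrable M (\<lambda>\<omega>. \<xi> (X j \<omega>))" for j
    unfolding integrable_X_iff[of \<xi> j] using comp1 by (simp add: \<xi>_def)
  have \<xi>2: "integrable M (\<lambda>\<omega>. (\<xi> (X j \<omega>))\<^sup>2)" for j
    unfolding integrable_X_iff[of "\<lambda>x. (\<xi> x)\<^sup>2" j] using comp1 comp2 by (simp add: \<xi>_def power2_diff)
  have E\<xi>: "expectation (\<lambda>\<omega>. \<xi> (X j \<omega>)) = 0" for j
    unfolding expectation_X[of \<xi> j] using comp1 by (simp add: \<xi>_def \<mu>_def prob_space)
  have cross: "integrable M (\<lambda>\<omega>. \<xi> (X j \<omega>) * \<xi> (X l \<omega>)) \<and>
      expectation (\<lambda>\<omega>. \<xi> (X j \<omega>) * \<xi> (X l \<omega>)) = (if j = l then \<sigma> else 0)" for j l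
  proof (cases "j = l")
    case True
    then show ?thesis
      using \<xi>2[of j] expectation_X[of "\<lambda>x. (\<xi> x)\<^sup>2" j] by (simp add: power2_eq_square \<sigma>_def \<xi>_def)
  next
    case False
    have ind: "indep_vars (\<lambda>_. borel) (\<lambda>j \<omega>. \<xi> (X j \<omega>)) {j, l}"
      by (rule indep_vars_X_borel)
    show ?thesis
      using indep_vars_integrable[OF _ ind \<xi>1] indep_vars_lebesgue_integral[OF _ ind \<xi>1] False E\<xi> by simp
  qed
  define T where "T \<omega> = (\<Sum>j\<in>B. \<xi> (X j \<omega>))" for \<omega>
  have T: "T \<omega> = to_real_vec (block_sum B \<omega>) $ i - real (card B) * \<mu>" for \<omega>
    by (simp add: T_def \<xi>_def block_sum_def to_real_vec_sum sum_subtractf)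
  have T2: "(T \<omega>)\<^sup>2 = (\<Sum>j\<in>B. \<Sum>l\<in>B. \<xi> (X j \<omega>) * \<xi> (X l \<omega>))" for \<omega>
    by (simp add: T_def power2_eq_square sum_product)
  have ET: "expectation T = 0"
    unfolding T_def using \<xi>1 E\<xi> by simp
  have T_meas: "T \<in> borel_measurable M"
    unfolding T_def by (intro borel_measurable_sum borel_measurable_X)
  have T2_int: "integrable M (\<lambda>\<omega>. (T \<omega>)\<^sup>2)"
    unfolding T2 using cross by simp
  have "expectation (\<lambda>\<omega>. (T \<omega>)\<^sup>2) = (\<Sum>j\<in>B. \<Sum>l\<in>B. if j = l then \<sigma> else 0)"
    unfolding T2 using cross by simp
  also have "\<dots> = real (card B) * \<sigma>"
    using \<open>finite B\<close> by simp
  finally have "expectation (\<lambda>\<omega>. (T \<omega>)\<^sup>2) = real (card B) * \<sigma>" .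
  then show ?thesis
    using Chebyshev_inequality[OF T_meas T2_int \<open>0 < a\<close>] unfolding ET by (simp add: T)
qed

text \<open>If S_m = 0, the deviations of the two halves from their means add up to -m * mu in
  coordinate i, so one half deviates by at least m * |mu| / 2. Chebyshev gives this a probability
  O(1/m), and the other half must still hit a single point, which costs m^(-d/2).\<close>

lemma hit_zero_small_drift:
  assumes gen: "genuinely_d_dim M X"
    and int2: "integrable M (\<lambda>\<omega>. (norm (to_real_vec (X 0 \<omega>)))\<^sup>2)"
    and drift: "expectation (\<lambda>\<omega>. to_real_vec (X 0 \<omega>)) \<noteq> 0"
  shows "(\<lambda>m. real m powr (real CARD('d) / 2) * hit m 0) \<longlonglongrightarrow> 0"
proof -
  let ?d = "real CARD('d) / 2"
  obtain C where C: "0 < C" "\<And>m z. 1 \<le> m \<Longrightarrow> hit m z \<le> C * real m powr (- real CARD('d) / 2)"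
    using hit_le_powr[OF gen] by blast
  have int1: "integrable M (\<lambda>\<omega>. to_real_vec (X 0 \<omega>))"
  proof -
    have "integrable M (\<lambda>\<omega>. norm (to_real_vec (X 0 \<omega>)))"
      by (rule square_integrable_imp_integrable[OF borel_measurable_X int2])
    then show ?thesis
      by (simp add: integrable_norm_iff borel_measurable_X)
  qed
  obtain i where "expectation (\<lambda>\<omega>. to_real_vec (X 0 \<omega>)) $ i \<noteq> 0"
    using drift by (auto simp: vec_eq_iff)
  define \<mu> where "\<mu> = expectation (\<lambda>\<omega>. to_real_vec (X 0 \<omega>) $ i)"
  define \<sigma> where "\<sigma> = expectation (\<lambda>\<omega>. (to_real_vec (X 0 \<omega>) $ i - \<mu>)\<^sup>2)"
  have "\<mu> = expectation (\<lambda>\<omega>. to_real_vec (X 0 \<omega>)) $ i"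
    unfolding \<mu>_def by (rule integral_bounded_linear[OF bounded_linear_vec_nth int1])
  with \<open>expectation _ $ i \<noteq> 0\<close> have \<mu>: "\<mu> \<noteq> 0" by simp
  have \<sigma>: "0 \<le> \<sigma>"
    by (simp add: \<sigma>_def)
  \<comment> \<open>The factor 2 counts the halves, C * 3^(d/2) is the concentration constant of one
    half, and the last factor comes from Chebyshev at level m * |mu| / 2.\<close>
  define K where "K = 2 * (C * 3 powr ?d) * (4 * \<sigma> / \<mu>\<^sup>2)"
  have bound: "hit m 0 \<le> K * real m powr (- ?d) / real m" if m: "2 \<le> m" for m
  proof -
    define B where "B = {1..m div 2}"
    define B' where "B' = {m div 2 + 1..m}"
    define a where "a = real m * \<bar>\<mu>\<bar> / 2"
    have B: "finite B" "finite B'" "B \<inter> B' = {}" "B \<union> B' = {1..m}" "card B = m div 2" "card B' = m - m div 2"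
      by (auto simp: B_def B'_def)
    have a: "0 < a"
      using m \<mu> by (simp add: a_def)
    \<comment> \<open>For m >= 2 each half has at least m div 2 >= m / 3 steps, whence the factor
      3^(d/2).\<close>
    have conc: "hit j x \<le> C * 3 powr ?d * real m powr (- ?d)" if "m div 2 \<le> j" for j x
    proof -
      have "m \<le> 3 * (m div 2)"
        using m by presburger
      then have "real m / 3 \<le> real j"
        using that by linarith
      have "1 \<le> j"
        using that m by linarith
      then have "hit j x \<le> C * real j powr (- ?d)"
        using C(2)[of j x] by simp
      also have "real j powr (- ?d) \<le> (real m / 3) powr (- ?d)"
        using \<open>real m / 3 \<le> real j\<close> m by (intro powr_mono2') auto
      also have "(real m / 3) powr (- ?d) = 3 powr ?d * real m powr (- ?d)"
        by (simp add: powr_divide powr_minus field_simps)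
      finally show ?thesis
        using C(1) by (simp add: mult_ac)
    qed
    define Bad where "Bad E = {x. a \<le> \<bar>to_real_vec x $ i - real (card E) * \<mu>\<bar>}" for E :: "nat set"
    have bad: "prob {\<omega>\<in>space M. block_sum E \<omega> \<in> Bad E} \<le> 4 * \<sigma> / \<mu>\<^sup>2 / real m" if "finite E" "card E \<le> m" for E
    proof -
      have "prob {\<omega>\<in>space M. block_sum E \<omega> \<in> Bad E} \<le> real (card E) * \<sigma> / a\<^sup>2"
        using chebyshev_block_sum[OF int2 that(1) a, of i] by (simp add: Bad_def \<mu>_def \<sigma>_def)
      also have "\<dots> \<le> real m * \<sigma> / a\<^sup>2"
        using that \<sigma> by (intro divide_right_mono mult_right_mono) auto
      also have "\<dots> = 4 * \<sigma> / \<mu>\<^sup>2 / real m"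
        using m \<mu> by (simp add: a_def power2_eq_square field_simps)
      finally show ?thesis .
    qed
    have half: "prob {\<omega>\<in>space M. block_sum (E \<union> F) \<omega> = 0 \<and> block_sum E \<omega> \<in> Bad E}
        \<le> (C * 3 powr ?d * real m powr (- ?d)) * (4 * \<sigma> / \<mu>\<^sup>2 / real m)"
      if "finite E" "finite F" "E \<inter> F = {}" "card E \<le> m" "m div 2 \<le> card F" for E F
    proof -
      have "prob {\<omega>\<in>space M. block_sum (E \<union> F) \<omega> = 0 \<and> block_sum E \<omega> \<in> Bad E}
          \<le> (C * 3 powr ?d * real m powr (- ?d)) * prob {\<omega>\<in>space M. block_sum E \<omega> \<in> Bad E}"
        by (rule prob_split_concentration[OF that(1-3) conc[OF that(5)]])
      also have "\<dots> \<le> (C * 3 powr ?d * real m powr (- ?d)) * (4 * \<sigma> / \<mu>\<^sup>2 / real m)"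
        using C(1) by (intro mult_left_mono bad that) auto
      finally show ?thesis .
    qed
    have "{\<omega>\<in>space M. walk X m \<omega> = 0} \<subseteq> {\<omega>\<in>space M. block_sum (B \<union> B') \<omega> = 0 \<and> block_sum B \<omega> \<in> Bad B}
        \<union> {\<omega>\<in>space M. block_sum (B' \<union> B) \<omega> = 0 \<and> block_sum B' \<omega> \<in> Bad B'}"
    proof
      fix \<omega> assume \<omega>: "\<omega> \<in> {\<omega>\<in>space M. walk X m \<omega> = 0}"
      have w: "block_sum (B \<union> B') \<omega> = 0"
        using \<omega> by (simp add: B walk_eq_block_sum)
      have "block_sum (B \<union> B') \<omega> = block_sum B \<omega> + block_sum B' \<omega>"
        unfolding block_sum_def by (rule sum.union_disjoint[OF B(1-3)])
      then have "to_real_vec (block_sum B \<omega>) $ i + to_real_vec (block_sum B' \<omega>) $ i = 0"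
        using w by (simp add: to_real_vec_def vec_eq_iff flip: of_int_add)
      moreover have "real (card B) * \<mu> + real (card B') * \<mu> = real m * \<mu>"
        unfolding B by (simp add: distrib_right[symmetric] flip: of_nat_add)
      moreover have "2 * a = \<bar>real m * \<mu>\<bar>"
        by (simp add: a_def abs_mult)
      ultimately have "a \<le> \<bar>to_real_vec (block_sum B \<omega>) $ i - real (card B) * \<mu>\<bar>
          \<or> a \<le> \<bar>to_real_vec (block_sum B' \<omega>) $ i - real (card B') * \<mu>\<bar>"
        by linarith
      then show "\<omega> \<in> {\<omega>\<in>space M. block_sum (B \<union> B') \<omega> = 0 \<and> block_sum B \<omega> \<in> Bad B}
        \<union> {\<omega>\<in>space M. block_sum (B' \<union> B) \<omega> = 0 \<and> block_sum B' \<omega> \<in> Bad B'}"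
        using \<omega> w by (auto simp: Bad_def Un_commute)
    qed
    then have "hit m 0 \<le> prob ({\<omega>\<in>space M. block_sum (B \<union> B') \<omega> = 0 \<and> block_sum B \<omega> \<in> Bad B}
        \<union> {\<omega>\<in>space M. block_sum (B' \<union> B) \<omega> = 0 \<and> block_sum B' \<omega> \<in> Bad B'})"
      unfolding hit_def by (rule finite_measure_mono) measurable
    also have "\<dots> \<le> prob {\<omega>\<in>space M. block_sum (B \<union> B') \<omega> = 0 \<and> block_sum B \<omega> \<in> Bad B}
        + prob {\<omega>\<in>space M. block_sum (B' \<union> B) \<omega> = 0 \<and> block_sum B' \<omega> \<in> Bad B'}"
      by (rule measure_Un_le) measurable
    also have "\<dots> \<le> (C * 3 powr ?d * real m powr (- ?d)) * (4 * \<sigma> / \<mu>\<^sup>2 / real m)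
        + (C * 3 powr ?d * real m powr (- ?d)) * (4 * \<sigma> / \<mu>\<^sup>2 / real m)"
      using B by (intro add_mono half) auto
    also have "\<dots> = K * real m powr (- ?d) / real m"
      by (simp add: K_def field_simps)
    finally show ?thesis .
  qed
  have lim: "(\<lambda>m. K / real m) \<longlonglongrightarrow> 0"
    by (rule lim_const_over_n)
  show ?thesis
  proof (rule tendsto_sandwich[OF _ _ tendsto_const lim])
    show "\<forall>\<^sub>F m in sequentially. 0 \<le> real m powr ?d * hit m 0"
      by simp
    show "\<forall>\<^sub>F m in sequentially. real m powr ?d * hit m 0 \<le> K / real m"
      using eventually_ge_at_top[of 2]
    proof eventually_elim
      case (elim m)
      have "real m powr ?d * hit m 0 \<le> real m powr ?d * (K * real m powr (- ?d) / real m)"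
        by (intro mult_left_mono bound elim) simp
      also have "\<dots> = (real m powr ?d * real m powr (- ?d)) * (K / real m)"
        by simp
      also have "real m powr ?d * real m powr (- ?d) = 1"
        using elim by (simp add: powr_add[symmetric])
      finally show ?case by simp
    qed
  qed
qed

end

section \<open>Asymptotics\<close>

text \<open>Toeplitz averaging: the first N terms contribute a bounded amount P, swamped by y, and
  the others carry a factor below delta. The horizon h is left open because the sums in question run
  to 2*n.\<close>

lemma weighted_average_tendsto_0:
  fixes \<epsilon> w y :: "nat \<Rightarrow> real"
  assumes \<epsilon>: "\<epsilon> \<longlonglongrightarrow> 0" and w: "\<And>m. 0 \<le> w m"
    and y: "filterlim y at_top sequentially"
    and le: "\<forall>\<^sub>F n in sequentially. (\<Sum>m=1..h n. w m) \<le> a * y n"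
  shows "(\<lambda>n. (\<Sum>m=1..h n. \<epsilon> m * w m) / y n) \<longlonglongrightarrow> 0"
proof (rule tendstoI)
  fix e :: real assume e: "0 < e"
  \<comment> \<open>Yields delta * |a| <= e / 2; the summand 1 keeps the denominator positive when a
    = 0.\<close>
  define \<delta> where "\<delta> = e / (2 * (\<bar>a\<bar> + 1))"
  have \<delta>: "0 < \<delta>"
    using e by (simp add: \<delta>_def)
  obtain N where N: "\<And>m. N \<le> m \<Longrightarrow> \<bar>\<epsilon> m\<bar> < \<delta>"
    using LIMSEQ_D[OF \<epsilon> \<delta>] by auto
  define P where "P = (\<Sum>m=1..N. \<bar>\<epsilon> m\<bar> * w m)"
  have P: "0 \<le> P"
    unfolding P_def using w by (intro sum_nonneg) auto
  have "\<forall>\<^sub>F n in sequentially. max 1 (2 * P / e + 1) \<le> y n"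
    using y unfolding filterlim_at_top by blast
  then show "\<forall>\<^sub>F n in sequentially. dist ((\<Sum>m=1..h n. \<epsilon> m * w m) / y n) 0 < e"
    using le
  proof eventually_elim
    case (elim n)
    have yn: "1 \<le> y n" "2 * P / e + 1 \<le> y n"
      using elim by auto
    have "\<bar>\<Sum>m=1..h n. \<epsilon> m * w m\<bar> \<le> (\<Sum>m=1..h n. \<bar>\<epsilon> m\<bar> * w m)"
      using w by (intro order_trans[OF sum_abs]) (simp add: abs_mult)
    also have "\<dots> \<le> (\<Sum>m=1..h n. (if m \<le> N then \<bar>\<epsilon> m\<bar> * w m else 0) + \<delta> * w m)"
    proof (rule sum_mono)
      fix m
      show "\<bar>\<epsilon> m\<bar> * w m \<le> (if m \<le> N then \<bar>\<epsilon> m\<bar> * w m else 0) + \<delta> * w m"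
      proof (cases "m \<le> N")
        case True
        then show ?thesis using w[of m] \<delta> by simp
      next
        case False
        then have "\<bar>\<epsilon> m\<bar> * w m \<le> \<delta> * w m"
          using N[of m] w[of m] by (intro mult_right_mono) auto
        then show ?thesis using False by simp
      qed
    qed
    also have "\<dots> = (\<Sum>m=1..h n. if m \<le> N then \<bar>\<epsilon> m\<bar> * w m else 0) + \<delta> * (\<Sum>m=1..h n. w m)"
      by (simp add: sum.distrib sum_distrib_left)
    also have "(\<Sum>m=1..h n. if m \<le> N then \<bar>\<epsilon> m\<bar> * w m else 0) = (\<Sum>m\<in>{1..h n} \<inter> {..N}. \<bar>\<epsilon> m\<bar> * w m)"
      by (subst sum.inter_restrict) simp_all
    also have "\<dots> \<le> P"
      unfolding P_def using w by (intro sum_mono2) auto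
    finally have "\<bar>\<Sum>m=1..h n. \<epsilon> m * w m\<bar> \<le> P + \<delta> * (\<Sum>m=1..h n. w m)"
      by simp
    also have "\<dots> \<le> P + \<delta> * (\<bar>a\<bar> * y n)"
    proof -
      have "(\<Sum>m=1..h n. w m) \<le> \<bar>a\<bar> * y n"
        using elim(2) yn by (intro order_trans[OF elim(2)] mult_right_mono) auto
      then show ?thesis
        using \<delta> by (intro add_left_mono mult_left_mono) auto
    qed
    also have "\<delta> * (\<bar>a\<bar> * y n) \<le> e / 2 * y n"
    proof -
      have "\<delta> * \<bar>a\<bar> \<le> e / 2"
        using e by (simp add: \<delta>_def field_simps)
      then have "\<delta> * \<bar>a\<bar> * y n \<le> e / 2 * y n"
        using yn by (intro mult_right_mono) auto
      then show ?thesis by (simp add: mult.assoc)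
    qed
    also have "P + e / 2 * y n < e * y n"
    proof -
      have "e / 2 * (2 * P / e + 1) \<le> e / 2 * y n"
        using yn e by (intro mult_left_mono) auto
      moreover have "e / 2 * (2 * P / e + 1) = P + e / 2"
        using e by (simp add: field_simps)
      ultimately show ?thesis
        using e by linarith
    qed
    finally have "\<bar>\<Sum>m=1..h n. \<epsilon> m * w m\<bar> < e * y n"
      by simp
    then show ?case
      using yn by (simp add: dist_real_def divide_less_eq)
  qed
qed

section \<open>Elementary power sums\<close>

lemma sum_powr_neg_half_le: "(\<Sum>m=1..n. real m powr (- 1 / 2)) \<le> 2 * sqrt n"
proof (induction n)
  case (Suc n)
  have "real (Suc n) powr (- 1 / 2) = 1 / sqrt (Suc n)"
    by (simp add: powr_minus_divide powr_half_sqrt)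
  also have "\<dots> \<le> 2 * sqrt (Suc n) - 2 * sqrt n"
  proof -
    have "2 * sqrt (Suc n) * sqrt n \<le> (sqrt (Suc n))\<^sup>2 + (sqrt n)\<^sup>2"
      by (rule sum_squares_bound)
    then have "1 \<le> (2 * sqrt (Suc n) - 2 * sqrt n) * sqrt (Suc n)"
      by (simp add: algebra_simps)
    then show ?thesis
      by (simp add: divide_le_eq)
  qed
  finally show ?case
    using Suc by simp
qed simp

lemma sum_inverse_le_ln: "0 < n \<Longrightarrow> (\<Sum>m=1..n. 1 / real m) \<le> 1 + ln n"
proof (induction n rule: nat_induct_non_zero)
  case (Suc n)
  have "ln (real n / real (Suc n)) \<le> real n / real (Suc n) - 1"
    using Suc.hyps by (intro ln_le_minus_one) simp
  also have "\<dots> = - (1 / real (Suc n))"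
    by (simp add: field_simps)
  finally have "1 / real (Suc n) \<le> ln (Suc n) - ln n"
    using Suc.hyps by (simp add: ln_div)
  then show ?case
    using Suc by simp
qed simp

text \<open>For the roots x <= y of m - 1 and m, the relation y^2 - x^2 = 1 turns 2/x - 2/y into 2 /
  (x * y * (x + y)), which is at least 1 / y^3. The right side telescopes.\<close>

lemma powr_neg_three_halves_le:
  assumes "2 \<le> m"
  shows "real m powr (- 3 / 2) \<le> 2 / sqrt (real m - 1) - 2 / sqrt m"
proof -
  define x y where "x = sqrt (real m - 1)" and "y = sqrt m"
  have xy: "0 < x" "x \<le> y" "y\<^sup>2 - x\<^sup>2 = 1"
    using assms by (auto simp: x_def y_def)
  have "real m powr (- 3 / 2) = 1 / (y * y\<^sup>2)"
  proof -
    have "real m powr (- 3 / 2) = 1 / (real m powr (1 / 2) * real m powr 1)"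
      unfolding powr_add[symmetric] by (simp add: powr_minus_divide)
    then show ?thesis
      using assms by (simp add: y_def powr_half_sqrt)
  qed
  also have "\<dots> \<le> 2 / (x * y * (x + y))"
  proof -
    have "x * y * (x + y) \<le> y * y * (y + y)"
      using xy by (intro mult_mono) auto
    then have "2 / (y * y * (y + y)) \<le> 2 / (x * y * (x + y))"
      using xy by (intro divide_left_mono) auto
    moreover have "2 / (y * y * (y + y)) = 1 / (y * y\<^sup>2)"
      by (simp add: power2_eq_square mult.assoc)
    ultimately show ?thesis by (simp only:)
  qed
  also have "\<dots> = 2 / x - 2 / y"
  proof -
    have "(y - x) * (x + y) = 1"
      using xy(3) by (simp add: algebra_simps power2_eq_square)
    then have "2 / (x * y * (x + y)) = 2 * ((y - x) * (x + y)) / (x * y * (x + y))"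
      by simp
    also have "\<dots> = 2 * (y - x) / (x * y)"
      using xy by simp
    also have "\<dots> = 2 / x - 2 / y"
      using xy by (simp add: field_simps)
    finally show ?thesis .
  qed
  finally show ?thesis
    by (simp add: x_def y_def)
qed

lemma sum_powr_neg_three_halves_tail:
  assumes "1 \<le> m"
  shows "(\<Sum>b=m+1..n. real b powr (- 3 / 2)) \<le> 2 / sqrt m"
proof (cases "m \<le> n")
  case True
  then have "(\<Sum>b=m+1..n. real b powr (- 3 / 2)) \<le> 2 / sqrt m - 2 / sqrt n"
  proof (induction n rule: dec_induct)
    case (step n)
    then show ?case
      using powr_neg_three_halves_le[of "Suc n"] assms by simp
  qed simp
  then show ?thesis
    by (rule order_trans) simp
qed simp

lemma sum_powr_neg_three_halves_le: "(\<Sum>b=1..n. real b powr (- 3 / 2)) \<le> 3"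
proof (cases "n = 0")
  case False
  then have "{1..n} = insert 1 {1 + 1..n}" by auto
  then have "(\<Sum>b=1..n. real b powr (- 3 / 2)) = 1 + (\<Sum>b=1+1..n. real b powr (- 3 / 2))"
    by simp
  then show ?thesis
    using sum_powr_neg_three_halves_tail[of 1 n] by simp
qed simp

text \<open>Split at b = m. Below, the summand is b^(-1/2); above, m multiplies a tail of order 1 /
  sqrt m. Each part is at most 2 * sqrt m.\<close>

lemma sum_min_powr_le:
  assumes "1 \<le> m"
  shows "(\<Sum>b=1..n. real (min m b) * real b powr (- 3 / 2)) \<le> 4 * sqrt m"
proof -
  have "(\<Sum>b=1..n. real (min m b) * real b powr (- 3 / 2))
      \<le> (\<Sum>b\<in>{1..m} \<union> {m+1..n}. real (min m b) * real b powr (- 3 / 2))"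
    by (rule sum_mono2) auto
  also have "\<dots> = (\<Sum>b=1..m. real (min m b) * real b powr (- 3 / 2)) + (\<Sum>b=m+1..n. real (min m b) * real b powr (- 3 / 2))"
    by (rule sum.union_disjoint) auto
  also have "(\<Sum>b=1..m. real (min m b) * real b powr (- 3 / 2)) = (\<Sum>b=1..m. real b powr (- 1 / 2))"
  proof (rule sum.cong[OF refl])
    fix b assume b: "b \<in> {1..m}"
    then have "real (min m b) * real b powr (- 3 / 2) = real b powr 1 * real b powr (- 3 / 2)"
      by simp
    also have "\<dots> = real b powr (- 1 / 2)"
      unfolding powr_add[symmetric] by simp
    finally show "real (min m b) * real b powr (- 3 / 2) = real b powr (- 1 / 2)" .
  qed
  also have "\<dots> \<le> 2 * sqrt m"
    by (rule sum_powr_neg_half_le)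
  also have "(\<Sum>b=m+1..n. real (min m b) * real b powr (- 3 / 2)) = real m * (\<Sum>b=m+1..n. real b powr (- 3 / 2))"
    by (simp add: sum_distrib_left)
  also have "\<dots> \<le> real m * (2 / sqrt m)"
    by (intro mult_left_mono sum_powr_neg_three_halves_tail assms) simp
  also have "\<dots> = 2 * (real m / sqrt m)"
    by simp
  also have "\<dots> = 2 * sqrt m"
    by (simp only: real_div_sqrt of_nat_0_le_iff)
  finally show ?thesis by simp
qed

lemma min_le_sqrt_mult: "real (min m b) \<le> sqrt m * sqrt b"
proof -
  have "real (min m b) = sqrt (real (min m b)) * sqrt (real (min m b))"
    by simp
  also have "\<dots> \<le> sqrt m * sqrt b"
    by (intro mult_mono) auto
  finally show ?thesis .
qed

text \<open>Bounding the min by the geometric mean decouples the two sums. This is sharp enough in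
  dimensions 1 and 2; for p = -3/2 it would leave a product of two logarithms where only one is
  allowed.\<close>

lemma overlap_sum_le_product:
  assumes \<epsilon>: "\<And>m. 0 \<le> \<epsilon> m" and C: "0 \<le> C"
  shows "overlap_sum (\<lambda>m. C * real m powr p) (\<lambda>m. \<epsilon> m * real m powr p) n
     \<le> C * (\<Sum>b=1..n. real b powr (p + 1 / 2)) * (\<Sum>m=1..2*n. \<epsilon> m * real m powr (p + 1 / 2))"
proof -
  have "overlap_sum (\<lambda>m. C * real m powr p) (\<lambda>m. \<epsilon> m * real m powr p) n
      \<le> (\<Sum>b=1..n. C * real b powr p * (\<Sum>m=1..2*n. (sqrt m * sqrt b) * (\<epsilon> m * real m powr p)))"
    unfolding overlap_sum_def using \<epsilon> C
    by (intro sum_mono mult_left_mono mult_right_mono min_le_sqrt_mult) auto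
  also have "\<dots> = (\<Sum>b=1..n. C * (real b powr p * real b powr (1 / 2)) * (\<Sum>m=1..2*n. \<epsilon> m * (real m powr p * real m powr (1 / 2))))"
    by (intro sum.cong refl) (simp add: powr_half_sqrt sum_distrib_left mult_ac)
  also have "\<dots> = C * (\<Sum>b=1..n. real b powr (p + 1 / 2)) * (\<Sum>m=1..2*n. \<epsilon> m * real m powr (p + 1 / 2))"
    by (simp only: powr_add sum_distrib_left[symmetric] sum_distrib_right[symmetric])
  finally show ?thesis .
qed

text \<open>Summing over b before m uses the exact min and so produces a single harmonic
  sum.\<close>

lemma overlap_sum_le_three:
  assumes \<epsilon>: "\<And>m. 0 \<le> \<epsilon> m" and C: "0 \<le> C"
  shows "overlap_sum (\<lambda>m. C * real m powr (- 3 / 2)) (\<lambda>m. \<epsilon> m * real m powr (- 3 / 2)) n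
     \<le> 4 * C * (\<Sum>m=1..2*n. \<epsilon> m * (1 / real m))"
proof -
  have "overlap_sum (\<lambda>m. C * real m powr (- 3 / 2)) (\<lambda>m. \<epsilon> m * real m powr (- 3 / 2)) n
      = (\<Sum>b=1..n. \<Sum>m=1..2*n. (C * (\<epsilon> m * real m powr (- 3 / 2))) * (real (min m b) * real b powr (- 3 / 2)))"
    unfolding overlap_sum_def sum_distrib_left by (intro sum.cong refl) (simp only: mult_ac)
  also have "\<dots> = (\<Sum>m=1..2*n. \<Sum>b=1..n. (C * (\<epsilon> m * real m powr (- 3 / 2))) * (real (min m b) * real b powr (- 3 / 2)))"
    by (rule sum.swap)
  also have "\<dots> = (\<Sum>m=1..2*n. (C * (\<epsilon> m * real m powr (- 3 / 2))) * (\<Sum>b=1..n. real (min m b) * real b powr (- 3 / 2)))"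
    by (simp only: sum_distrib_left)
  also have "\<dots> \<le> (\<Sum>m=1..2*n. (C * (\<epsilon> m * real m powr (- 3 / 2))) * (4 * sqrt m))"
    using \<epsilon> C by (intro sum_mono mult_left_mono sum_min_powr_le) auto
  also have "\<dots> = (\<Sum>m=1..2*n. 4 * C * (\<epsilon> m * (1 / real m)))"
  proof (rule sum.cong[OF refl])
    fix m assume m: "m \<in> {1..2*n}"
    have "real m powr (- 3 / 2) * sqrt m = real m powr (- 3 / 2) * real m powr (1 / 2)"
      by (simp add: powr_half_sqrt)
    also have "\<dots> = 1 / real m"
      unfolding powr_add[symmetric] using m by (simp add: powr_minus_divide)
    finally have "real m powr (- 3 / 2) * sqrt m = 1 / real m" .
    moreover have "(C * (\<epsilon> m * real m powr (- 3 / 2))) * (4 * sqrt m) = 4 * C * (\<epsilon> m * (real m powr (- 3 / 2) * sqrt m))"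
      by (simp only: mult_ac)
    ultimately show "(C * (\<epsilon> m * real m powr (- 3 / 2))) * (4 * sqrt m) = 4 * C * (\<epsilon> m * (1 / real m))"
      by (simp only:)
  qed
  finally show ?thesis
    by (simp add: sum_distrib_left)
qed

text \<open>In dimensions 1, 2, 3 it is applied with L = sqrt n, ln n, 1 and Y = n^2, n, ln n.
  Relative to n * L^(2 alpha - 4) * Y, disjoint pairs contribute U / Y and meeting pairs L^2 / Y.
  Since c * L >= 1, every k is dominated by k = alpha, and c^(2 alpha) absorbs all powers of
  c.\<close>

lemma variance_bound_ratio_tendsto_0:
  fixes V Q U L Y :: "nat \<Rightarrow> real"
  assumes \<alpha>: "2 \<le> \<alpha>" and K: "0 \<le> K" and c: "1 \<le> c"
    and V: "\<And>n. 0 \<le> V n" "\<And>n. V n \<le> (\<Sum>k=2..\<alpha>. K * real n * (Q n ^ (2 * k - 4) * U n + max 1 (Q n) ^ (2 * k - 2)))"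
    and Q: "\<And>n. 0 \<le> Q n" and U: "\<And>n. 0 \<le> U n"
    and ev: "\<forall>\<^sub>F n in sequentially. 0 < n \<and> 1 \<le> L n \<and> 0 < Y n \<and> max 1 (Q n) \<le> c * L n"
    and lim: "(\<lambda>n. U n / Y n) \<longlonglongrightarrow> 0" "(\<lambda>n. (L n)\<^sup>2 / Y n) \<longlonglongrightarrow> 0"
  shows "(\<lambda>n. V n / (real n * L n ^ (2 * \<alpha> - 4) * Y n)) \<longlonglongrightarrow> 0"
proof -
  define G where "G = real \<alpha> * (K * c ^ (2 * \<alpha>))"
  have "(\<lambda>n. G * (U n / Y n + (L n)\<^sup>2 / Y n)) \<longlonglongrightarrow> G * (0 + 0)"
    by (intro tendsto_intros lim)
  then have lim0: "(\<lambda>n. G * (U n / Y n + (L n)\<^sup>2 / Y n)) \<longlonglongrightarrow> 0"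
    by simp
  show ?thesis
  proof (rule tendsto_sandwich[OF _ _ tendsto_const lim0])
    show "\<forall>\<^sub>F n in sequentially. 0 \<le> V n / (real n * L n ^ (2 * \<alpha> - 4) * Y n)"
      using ev by eventually_elim (use V in \<open>auto intro!: divide_nonneg_nonneg mult_nonneg_nonneg\<close>)
    show "\<forall>\<^sub>F n in sequentially. V n / (real n * L n ^ (2 * \<alpha> - 4) * Y n) \<le> G * (U n / Y n + (L n)\<^sup>2 / Y n)"
      using ev
    proof eventually_elim
      case (elim n)
      then have n: "0 < n" "1 \<le> L n" "0 < Y n" "max 1 (Q n) \<le> c * L n"
        by auto
      let ?P = "L n ^ (2 * \<alpha> - 4)"
      have cL: "1 \<le> c * L n"
        using n(4) by simp
      have summand: "K * real n * (Q n ^ (2 * k - 4) * U n + max 1 (Q n) ^ (2 * k - 2))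
          \<le> K * real n * (c ^ (2 * \<alpha>) * ?P * (U n + (L n)\<^sup>2))" if k: "k \<in> {2..\<alpha>}" for k
      proof -
        have "Q n ^ (2 * k - 4) \<le> (c * L n) ^ (2 * k - 4)"
          using n(4) Q by (intro power_mono) auto
        also have "\<dots> \<le> (c * L n) ^ (2 * \<alpha> - 4)"
          using k cL by (intro power_increasing) auto
        also have "\<dots> \<le> c ^ (2 * \<alpha>) * ?P"
          unfolding power_mult_distrib using c n by (intro mult_right_mono power_increasing) auto
        finally have 1: "Q n ^ (2 * k - 4) * U n \<le> c ^ (2 * \<alpha>) * ?P * U n"
          by (rule mult_right_mono) (rule U)
        have "max 1 (Q n) ^ (2 * k - 2) \<le> (c * L n) ^ (2 * k - 2)"
          using n(4) by (intro power_mono) auto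
        also have "\<dots> \<le> (c * L n) ^ (2 * \<alpha> - 2)"
          using k cL by (intro power_increasing) auto
        also have "\<dots> \<le> c ^ (2 * \<alpha>) * L n ^ (2 * \<alpha> - 2)"
          unfolding power_mult_distrib using c n by (intro mult_right_mono power_increasing) auto
        also have "L n ^ (2 * \<alpha> - 2) = ?P * (L n)\<^sup>2"
        proof -
          have "2 * \<alpha> - 2 = (2 * \<alpha> - 4) + 2"
            using \<alpha> by simp
          then show ?thesis by (simp only: power_add)
        qed
        finally have 2: "max 1 (Q n) ^ (2 * k - 2) \<le> c ^ (2 * \<alpha>) * ?P * (L n)\<^sup>2"
          by (simp add: mult.assoc)
        have "Q n ^ (2 * k - 4) * U n + max 1 (Q n) ^ (2 * k - 2) \<le> c ^ (2 * \<alpha>) * ?P * (U n + (L n)\<^sup>2)"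
          unfolding distrib_left using 1 2 by (rule add_mono)
        then show ?thesis
          using K by (intro mult_left_mono) auto
      qed
      have UL: "0 \<le> U n + (L n)\<^sup>2"
        using U[of n] by simp
      have "V n \<le> (\<Sum>k=2..\<alpha>. K * real n * (c ^ (2 * \<alpha>) * ?P * (U n + (L n)\<^sup>2)))"
        by (rule order_trans[OF V(2)]) (rule sum_mono[OF summand])
      also have "\<dots> = real (\<alpha> - 1) * (K * real n * (c ^ (2 * \<alpha>) * ?P * (U n + (L n)\<^sup>2)))"
        by simp
      also have "\<dots> \<le> real \<alpha> * (K * real n * (c ^ (2 * \<alpha>) * ?P * (U n + (L n)\<^sup>2)))"
        using K c n UL by (intro mult_right_mono mult_nonneg_nonneg) auto
      also have "\<dots> = (G * (U n / Y n + (L n)\<^sup>2 / Y n)) * (real n * ?P * Y n)"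
        using n by (simp add: G_def field_simps)
      finally show ?case
        using n by (subst pos_divide_le_eq) auto
    qed
  qed
qed

context iid_walk
begin

lemma variance_ratio_tendsto_0:
  assumes gen: "genuinely_d_dim M X" and "CARD('d) \<in> {1, 2, 3}" and "0 < \<alpha>"
    and small: "(\<lambda>m. real m powr (real CARD('d) / 2) * hit m 0) \<longlonglongrightarrow> 0"
  shows "(\<lambda>n. variance (self_int_lt X \<alpha> n) / v_norm CARD('d) \<alpha> n) \<longlonglongrightarrow> 0"
proof -
  define p where "p = - real CARD('d) / 2"
  define \<epsilon> where "\<epsilon> m = real m powr (real CARD('d) / 2) * hit m 0" for m
  obtain C where C: "0 < C" "\<And>m z. 1 \<le> m \<Longrightarrow> hit m z \<le> C * real m powr p"
    using hit_le_powr[OF gen] unfolding p_def by blast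
  define q where "q m = C * real m powr p" for m
  define Q where "Q n = (\<Sum>m=1..n. q m)" for n
  define U where "U n = overlap_sum q (\<lambda>m. hit m 0) n" for n
  have \<epsilon>0: "\<epsilon> \<longlonglongrightarrow> 0" and \<epsilon>_nonneg: "0 \<le> \<epsilon> m" for m
    using small by (simp_all add: \<epsilon>_def[abs_def])
  have q_nonneg: "0 \<le> q m" for m
    using C(1) by (simp add: q_def)
  have Q_nonneg: "0 \<le> Q n" for n
    unfolding Q_def by (intro sum_nonneg q_nonneg)
  have U_nonneg: "0 \<le> U n" for n
    unfolding U_def by (intro overlap_sum_nonneg q_nonneg hit_nonneg)
  \<comment> \<open>At m = 0 the right side is 0 although \<open>hit 0 0\<close> is 1; the sums
    concerned start at 1.\<close>
  have hit_\<epsilon>: "hit m 0 = \<epsilon> m * real m powr p" if "1 \<le> m" for m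
    using that by (simp add: \<epsilon>_def p_def mult_ac powr_add[symmetric])
  have U_\<epsilon>: "U n = overlap_sum (\<lambda>m. C * real m powr p) (\<lambda>m. \<epsilon> m * real m powr p) n" for n
    unfolding U_def overlap_sum_def q_def by (intro sum.cong refl arg_cong2[where f="(*)"]) (simp add: hit_\<epsilon>)
  obtain K where K: "0 \<le> K" "\<And>n. variance (self_int_lt X \<alpha> n) \<le> (\<Sum>k=2..\<alpha>. K * real n * (Q n ^ (2 * k - 4) * U n + max 1 (Q n) ^ (2 * k - 2)))"
  proof (rule variance_self_int_lt_le[OF _ \<open>0 < \<alpha>\<close>])
    show "hit m z \<le> q m" if "1 \<le> m" for m z
      unfolding q_def by (rule C(2)[OF that])
  next
    fix K
    assume K: "0 \<le> K" "\<And>n. variance (self_int_lt X \<alpha> n) \<le> (\<Sum>k=2..\<alpha>. K * real n *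
      ((\<Sum>m=1..n. q m) ^ (2 * k - 4) * overlap_sum q (\<lambda>m. hit m 0) n + max 1 (\<Sum>m=1..n. q m) ^ (2 * k - 2)))"
    show thesis
      by (rule that[OF K(1)], unfold Q_def U_def, rule K(2))
  qed
  have var_nonneg: "0 \<le> variance (self_int_lt X \<alpha> n)" for n
    by simp
  show ?thesis
  proof (cases "2 \<le> \<alpha>")
    \<comment> \<open>For alpha = 1 the sum over k from 2 is empty, as L_n(1) = n is deterministic.
      This also settles the negative exponent of the logarithm in \<open>v_norm\<close> for d =
      2.\<close>
    case False
    then have "variance (self_int_lt X \<alpha> n) = 0" for n
      using K(2)[of n] var_nonneg[of n] by simp
    then show ?thesis by simp
  next
    case True
    note ratio = variance_bound_ratio_tendsto_0[OF True K(1) _ var_nonneg K(2) Q_nonneg U_nonneg]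
    \<comment> \<open>The 3 covers all dimensions: Q is at most C times 2 * sqrt n, 1 + ln n or 3
      respectively, and 1 + ln n <= 3 * ln n eventually.\<close>
    define c where "c = max 1 (3 * C)"
    have c: "1 \<le> c" "3 * C \<le> c"
      by (auto simp: c_def)
    from assms(2) consider (1) "CARD('d) = 1" | (2) "CARD('d) = 2" | (3) "CARD('d) = 3"
      by auto
    then show ?thesis
    proof cases
      case 1
      have p: "p = - 1 / 2"
        by (simp add: p_def 1)
      have Q: "Q n \<le> C * (2 * sqrt n)" for n
        unfolding Q_def q_def p sum_distrib_left[symmetric]
        using C(1) sum_powr_neg_half_le[of n] by (intro mult_left_mono) auto
      have limU: "(\<lambda>n. U n / (real n)\<^sup>2) \<longlonglongrightarrow> 0"
      proof (rule tendsto_sandwich)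
        show "\<forall>\<^sub>F n in sequentially. 0 \<le> U n / (real n)\<^sup>2"
          using U_nonneg by simp
        show "\<forall>\<^sub>F n in sequentially. U n / (real n)\<^sup>2 \<le> C * ((\<Sum>m=1..2*n. \<epsilon> m * 1) / real n)"
          using eventually_gt_at_top[of 0]
        proof eventually_elim
          case (elim n)
          have "U n \<le> C * (\<Sum>b=1..n. real b powr (p + 1 / 2)) * (\<Sum>m=1..2*n. \<epsilon> m * real m powr (p + 1 / 2))"
            unfolding U_\<epsilon> using C(1) \<epsilon>_nonneg by (intro overlap_sum_le_product) auto
          also have "\<dots> = C * real n * (\<Sum>m=1..2*n. \<epsilon> m * 1)"
            by (simp add: p)
          finally show ?case
            using elim by (simp add: divide_le_eq power2_eq_square field_simps)
        qed
        have "(\<lambda>n. (\<Sum>m=1..2*n. \<epsilon> m * 1) / real n) \<longlonglongrightarrow> 0"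
          by (rule weighted_average_tendsto_0[OF \<epsilon>0, where a=2]) (auto intro: filterlim_real_sequentially)
        then show "(\<lambda>n. C * ((\<Sum>m=1..2*n. \<epsilon> m * 1) / real n)) \<longlonglongrightarrow> 0"
          by (rule tendsto_mult_right_zero)
      qed simp
      have "(\<lambda>n. variance (self_int_lt X \<alpha> n) / (real n * sqrt (real n) ^ (2 * \<alpha> - 4) * (real n)\<^sup>2)) \<longlonglongrightarrow> 0"
      proof (rule ratio[OF c(1) _ limU])
        show "\<forall>\<^sub>F n in sequentially. 0 < n \<and> 1 \<le> sqrt (real n) \<and> 0 < (real n)\<^sup>2 \<and> max 1 (Q n) \<le> c * sqrt (real n)"
          using eventually_gt_at_top[of 0]
        proof eventually_elim
          case (elim n)
          have "1 \<le> sqrt (real n)"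
            using elim by simp
          moreover have "Q n \<le> c * sqrt (real n)"
          proof -
            have "2 * C * sqrt (real n) \<le> c * sqrt (real n)"
              using c(2) C(1) by (intro mult_right_mono) auto
            then show ?thesis using Q[of n] by simp
          qed
          moreover have "1 * 1 \<le> c * sqrt (real n)"
            using c(1) \<open>1 \<le> sqrt (real n)\<close> by (intro mult_mono) auto
          ultimately show ?case
            using elim by simp
        qed
        show "(\<lambda>n. (sqrt (real n))\<^sup>2 / (real n)\<^sup>2) \<longlonglongrightarrow> 0"
          by real_asymp
      qed
      moreover have "real n * sqrt (real n) ^ (2 * \<alpha> - 4) * (real n)\<^sup>2 = v_norm CARD('d) \<alpha> n" for n
      proof -
        have "2 * \<alpha> - 4 = 2 * (\<alpha> - 2)" by simp
        then have "sqrt (real n) ^ (2 * \<alpha> - 4) = real n ^ (\<alpha> - 2)"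
          by (simp add: power_mult)
        then have "real n * sqrt (real n) ^ (2 * \<alpha> - 4) * (real n)\<^sup>2 = real n ^ (1 + (\<alpha> - 2) + 2)"
          by (simp only: power_add power_one_right)
        also have "1 + (\<alpha> - 2) + 2 = 1 + \<alpha>"
          using True by simp
        finally show ?thesis
          by (simp add: v_norm_def 1)
      qed
      ultimately show ?thesis by simp
    next
      case 2
      have p: "p = - 1"
        by (simp add: p_def 2)
      have Q: "Q n \<le> C * (1 + ln n)" if "0 < n" for n
      proof -
        have "Q n = C * (\<Sum>m=1..n. 1 / real m)"
          unfolding Q_def q_def p sum_distrib_left by (intro sum.cong refl) (simp add: powr_minus_divide)
        also have "\<dots> \<le> C * (1 + ln n)"
          using C(1) sum_inverse_le_ln[OF that] by (intro mult_left_mono) auto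
        finally show ?thesis .
      qed
      have limU: "(\<lambda>n. U n / real n) \<longlonglongrightarrow> 0"
      proof (rule tendsto_sandwich)
        show "\<forall>\<^sub>F n in sequentially. 0 \<le> U n / real n"
          using U_nonneg by simp
        show "\<forall>\<^sub>F n in sequentially. U n / real n \<le> 2 * C * ((\<Sum>m=1..2*n. \<epsilon> m * real m powr (- 1 / 2)) / sqrt (real n))"
          using eventually_gt_at_top[of 0]
        proof eventually_elim
          case (elim n)
          let ?S = "\<Sum>m=1..2*n. \<epsilon> m * real m powr (- 1 / 2)"
          have S: "0 \<le> ?S"
            using \<epsilon>_nonneg by (intro sum_nonneg) auto
          have "U n \<le> C * (\<Sum>b=1..n. real b powr (p + 1 / 2)) * (\<Sum>m=1..2*n. \<epsilon> m * real m powr (p + 1 / 2))"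
            unfolding U_\<epsilon> using C(1) \<epsilon>_nonneg by (intro overlap_sum_le_product) auto
          also have "\<dots> = C * (\<Sum>b=1..n. real b powr (- 1 / 2)) * ?S"
            by (simp add: p)
          also have "\<dots> \<le> C * (2 * sqrt n) * ?S"
            using C(1) S sum_powr_neg_half_le[of n] by (intro mult_right_mono mult_left_mono) auto
          finally have "U n \<le> C * (2 * sqrt n) * ?S" .
          then have "U n / real n \<le> C * (2 * sqrt n) * ?S / real n"
            by (rule divide_right_mono) simp
          also have "\<dots> = 2 * C * (?S / sqrt n)"
            using elim by (simp add: field_simps)
          finally show ?case .
        qed
        have "(\<lambda>n. (\<Sum>m=1..2*n. \<epsilon> m * real m powr (- 1 / 2)) / sqrt (real n)) \<longlonglongrightarrow> 0"
        proof (rule weighted_average_tendsto_0[OF \<epsilon>0, where a=4])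
          show "filterlim (\<lambda>n. sqrt (real n)) at_top sequentially"
            by real_asymp
          have "(\<Sum>m=1..2*n. real m powr (- 1 / 2)) \<le> 4 * sqrt (real n)" for n
          proof -
            have "sqrt 2 \<le> 2"
              by (rule real_le_lsqrt) auto
            then have "sqrt 2 * sqrt (real n) \<le> 2 * sqrt (real n)"
              by (rule mult_right_mono) simp
            then have "2 * sqrt (real (2 * n)) \<le> 4 * sqrt (real n)"
              by (simp add: real_sqrt_mult mult.commute)
            then show ?thesis
              using sum_powr_neg_half_le[of "2 * n"] by linarith
          qed
          then show "\<forall>\<^sub>F n in sequentially. (\<Sum>m=1..2*n. real m powr (- 1 / 2)) \<le> 4 * sqrt (real n)"
            by simp
        qed simp
        then show "(\<lambda>n. 2 * C * ((\<Sum>m=1..2*n. \<epsilon> m * real m powr (- 1 / 2)) / sqrt (real n))) \<longlonglongrightarrow> 0"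
          by (rule tendsto_mult_right_zero)
      qed simp
      have "(\<lambda>n. variance (self_int_lt X \<alpha> n) / (real n * ln (real n) ^ (2 * \<alpha> - 4) * real n)) \<longlonglongrightarrow> 0"
      proof (rule ratio[OF c(1) _ limU])
        have "\<forall>\<^sub>F n in sequentially. 1 \<le> ln (real n)"
          by real_asymp
        with eventually_gt_at_top[of 0]
        show "\<forall>\<^sub>F n in sequentially. 0 < n \<and> 1 \<le> ln (real n) \<and> 0 < real n \<and> max 1 (Q n) \<le> c * ln (real n)"
        proof eventually_elim
          case (elim n)
          have "C * (1 + ln n) \<le> C * (3 * ln n)"
            using C(1) elim by (intro mult_left_mono) auto
          also have "\<dots> = 3 * C * ln n"
            by simp
          also have "\<dots> \<le> c * ln n"
            using elim by (intro mult_right_mono c(2)) auto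
          finally have "Q n \<le> c * ln n"
            using Q[of n] elim by simp
          moreover have "1 * 1 \<le> c * ln (real n)"
            using c(1) elim by (intro mult_mono) auto
          ultimately show ?case
            using elim by simp
        qed
        show "(\<lambda>n. (ln (real n))\<^sup>2 / real n) \<longlonglongrightarrow> 0"
          by real_asymp
      qed
      moreover have "real n * ln (real n) ^ (2 * \<alpha> - 4) * real n = v_norm CARD('d) \<alpha> n" for n
      proof -
        have "2 * int \<alpha> - 4 = int (2 * \<alpha> - 4)"
          using True by simp
        then have "ln (real n) powi (2 * int \<alpha> - 4) = ln (real n) ^ (2 * \<alpha> - 4)"
          by (simp only: power_int_of_nat)
        then show ?thesis
          by (simp add: v_norm_def 2 power2_eq_square)
      qed
      ultimately show ?thesis by simp
    next
      case 3
      have p: "p = - 3 / 2"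
        by (simp add: p_def 3)
      have Q: "Q n \<le> C * 3" for n
        unfolding Q_def q_def p sum_distrib_left[symmetric]
        using C(1) sum_powr_neg_three_halves_le[of n] by (intro mult_left_mono) auto
      have ev_ln: "\<forall>\<^sub>F n in sequentially. 1 \<le> ln (real n)"
        by real_asymp
      have limU: "(\<lambda>n. U n / ln (real n)) \<longlonglongrightarrow> 0"
      proof (rule tendsto_sandwich)
        show "\<forall>\<^sub>F n in sequentially. 0 \<le> U n / ln (real n)"
          using ev_ln by eventually_elim (use U_nonneg in auto)
        show "\<forall>\<^sub>F n in sequentially. U n / ln (real n) \<le> 4 * C * ((\<Sum>m=1..2*n. \<epsilon> m * (1 / real m)) / ln (real n))"
          using ev_ln
        proof eventually_elim
          case (elim n)
          have "U n \<le> 4 * C * (\<Sum>m=1..2*n. \<epsilon> m * (1 / real m))"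
            unfolding U_\<epsilon> p using C(1) \<epsilon>_nonneg by (intro overlap_sum_le_three) auto
          then have "U n / ln (real n) \<le> 4 * C * (\<Sum>m=1..2*n. \<epsilon> m * (1 / real m)) / ln (real n)"
            using elim by (intro divide_right_mono) auto
          then show ?case by simp
        qed
        have "(\<lambda>n. (\<Sum>m=1..2*n. \<epsilon> m * (1 / real m)) / ln (real n)) \<longlonglongrightarrow> 0"
        proof (rule weighted_average_tendsto_0[OF \<epsilon>0, where a=3])
          show "filterlim (\<lambda>n. ln (real n)) at_top sequentially"
            by real_asymp
          have "\<forall>\<^sub>F n in sequentially. 1 + ln (real (2 * n)) \<le> 3 * ln (real n)"
            by real_asymp
          with eventually_gt_at_top[of 0]
          show "\<forall>\<^sub>F n in sequentially. (\<Sum>m=1..2*n. 1 / real m) \<le> 3 * ln (real n)"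
          proof eventually_elim
            case (elim n)
            then show ?case
              using sum_inverse_le_ln[of "2 * n"] by linarith
          qed
        qed simp
        then show "(\<lambda>n. 4 * C * ((\<Sum>m=1..2*n. \<epsilon> m * (1 / real m)) / ln (real n))) \<longlonglongrightarrow> 0"
          by (rule tendsto_mult_right_zero)
      qed simp
      \<comment> \<open>In dimension three the bounds q are summable, so L = 1 and the logarithm
        comes from the overlap sum alone.\<close>
      have "(\<lambda>n. variance (self_int_lt X \<alpha> n) / (real n * 1 ^ (2 * \<alpha> - 4) * ln (real n))) \<longlonglongrightarrow> 0"
      proof (rule ratio[OF c(1) _ limU])
        show "\<forall>\<^sub>F n in sequentially. 0 < n \<and> 1 \<le> (1::real) \<and> 0 < ln (real n) \<and> max 1 (Q n) \<le> c * 1"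
          using eventually_gt_at_top[of 0] ev_ln
        proof eventually_elim
          case (elim n)
          show ?case
          proof (intro conjI)
            show "0 < ln (real n)"
              using elim by linarith
          qed (use elim Q[of n] c in auto)
        qed
        show "(\<lambda>n. 1\<^sup>2 / ln (real n)) \<longlonglongrightarrow> 0"
          by real_asymp
      qed
      then show ?thesis
        by (simp add: v_norm_def 3)
    qed
  qed
qed

end

text \<open>The integral of a non-integrable function is 0 by convention; square integrability in
  the first conjunct makes the second a genuine statement about the mean. The conclusion can thus
  fail in two ways: an infinite second moment, or a finite one with nonzero mean.\<close>

theorem theorem2:
  fixes M :: "'a measure" and X :: "nat \<Rightarrow> 'a \<Rightarrow> int ^ 'd" and \<alpha> :: nat
  assumes "prob_space M"
    and "CARD('d) \<in> {1, 2, 3}"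
    and "\<alpha> > 0"
    and "\<And>i. X i \<in> measurable M (count_space UNIV)"
    and "prob_space.indep_vars M (\<lambda>_. count_space UNIV) X UNIV"
    and "\<And>i. distr M (count_space UNIV) (X i) = distr M (count_space UNIV) (X 0)"
    and "genuinely_d_dim M X"
    and "liminf (\<lambda>n. ereal (prob_space.variance M (self_int_lt X \<alpha> n)
                                / v_norm CARD('d) \<alpha> n)) > 0"
  shows "integrable M (\<lambda>\<omega>. (norm (to_real_vec (X 0 \<omega>)))\<^sup>2)
         \<and> prob_space.expectation M (\<lambda>\<omega>. to_real_vec (X 0 \<omega>)) = 0"
proof -
  interpret iid_walk M X
    by (rule iid_walk.intro[OF assms(1)], unfold_locales) (fact assms)+
  show ?thesis
  proof (rule ccontr)
    assume neg: "\<not> ?thesis"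
    have "(\<lambda>m. real m powr (real CARD('d) / 2) * hit m 0) \<longlonglongrightarrow> 0"
    proof (cases "integrable M (\<lambda>\<omega>. (norm (to_real_vec (X 0 \<omega>)))\<^sup>2)")
      case True
      with neg show ?thesis
        by (intro hit_zero_small_drift[OF assms(7)]) auto
    next
      case False
      then show ?thesis
        by (rule hit_zero_small_heavy_tail[OF assms(7)])
    qed
    then have "(\<lambda>n. variance (self_int_lt X \<alpha> n) / v_norm CARD('d) \<alpha> n) \<longlonglongrightarrow> 0"
      by (rule variance_ratio_tendsto_0[OF assms(7,2,3)])
    then have "(\<lambda>n. ereal (variance (self_int_lt X \<alpha> n) / v_norm CARD('d) \<alpha> n)) \<longlonglongrightarrow> ereal 0"
      by (intro tendsto_ereal)
    then have "liminf (\<lambda>n. ereal (variance (self_int_lt X \<alpha> n) / v_norm CARD('d) \<alpha> n)) = ereal 0"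
      by (intro lim_imp_Liminf) auto
    then show False
      using assms(8) by simp
  qed
qed

end
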